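(* Let $(M,L)$ be a Finsler manifold with Finsler metric $g$, let $D^*$ be its Hashiguchi connection with hv-curvature $P^*$, and let $T$ and $\widehat P$ be the (h)hv-torsion and the (v)hv-torsion of the Cartan connection. Then for all $\pi$-vector fields $X,Y,Z,W$: (a) $P^*(X,Y,Z,W)+P^*(X,Y,W,Z)=2(D^*_{\gamma Y}\widehat P)(X,Z,W)+2\widehat P(T(X,Y),Z,W)$; (b) $\widehat{P^*}=0$; (c) $P^*(X,Y)Z-P^*(Z,Y)X=(D^*_{\beta Z}T)(Y,X)-(D^*_{\beta X}T)(Y,Z)$; (d) $P^*(X,Y)Z=P^*(X,Z)Y$; (e) $P^*(\eta,X)Y=-(D^*_{\beta\eta}T)(X,Y)$ and $P^*(X,\eta)Y=0$; (f) $(D^*_{\gamma\eta}P^* )(X,Y,Z)=-P^*(X,Y)Z$.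
   Context: $M$ is a real paracompact $C^\infty$ manifold of finite dimension, $\mathcal TM\subset TM$ is the set of nonzero tangent vectors, $\pi:\mathcal TM\to M$ the projection, $\pi^{-1}(TM)\to\mathcal TM$ the pullback of $TM$ by $\pi$; everything is $C^\infty$. Sections of $\pi^{-1}(TM)$ are called $\pi$-vector fields. $\eta$ is the $\pi$-vector field $\eta(u)=(u,u)$. $\rho:T(\mathcal TM)\to\pi^{-1}(TM)$ is $\rho(A)=(u,d\pi(A))$ for $A\in T_u(\mathcal TM)$, and $\gamma:\pi^{-1}(TM)\to T(\mathcal TM)$ is the vertical lift $\gamma(u,v)=\frac{d}{dt}|_{t=0}(u+tv)$; $V=\ker\rho=\operatorname{im}\gamma$. $(M,L)$ is a Finsler manifold: $L:TM\to[0,\infty)$ is smooth and positive on $\mathcal TM$, positively homogeneous of degree 1 on fibres, and the fibrewise Hessian of $E=\frac12L^2$ is positive definite on $\mathcal TM$; this Hessian (in coordinates $g_{ij}=\frac12\partial^2L^2/\partial y^i\partial y^j$) is the Finsler metric $g$ on $\pi^{-1}(TM)$. For a linear connection $D$ on $\pi^{-1}(TM)$, put $K(A)=D_A\eta$ and $H=\ker K$. $D$ is regular if $T(\mathcal TM)=V\oplus H$; then $\beta:=(\rho|_H)^{-1}:\pi^{-1}(TM)\to H$. Torsion: $\mathbf T(A,B)=D_A\rho B-D_B\rho A-\rho[A,B]$; curvature (note the sign): $\mathbf K(A,B)\rho C=-D_AD_B\rho C+D_BD_A\rho C+D_{[A,B]}\rho C$. $Q(X,Y)=\mathbf T(\beta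 X,\beta Y)$, $T(X,Y)=\mathbf T(\gamma X,\beta Y)$; h-, hv-, v-curvatures $R(X,Y)Z=\mathbf K(\beta X,\beta Y)Z$, $P(X,Y)Z=\mathbf K(\beta X,\gamma Y)Z$, $S(X,Y)Z=\mathbf K(\gamma X,\gamma Y)Z$; a hat denotes contraction with $\eta$: $\widehat P(X,Y)=P(X,Y)\eta$, etc. The Cartan connection $\nabla$ is the unique regular connection on $\pi^{-1}(TM)$ with $\nabla g=0$, $Q=0$, and $g(T(X,Y),Z)=g(T(X,Z),Y)$; unadorned $T,P,\widehat P,K,\beta$ refer to $\nabla$. The Hashiguchi connection $D^*$ is the unique regular connection on $\pi^{-1}(TM)$ such that $D^*_{\gamma X}g=0$, $g(T^*(X,Y),Z)=g(T^*(X,Z),Y)$, $Q^*=0$, $\widehat{P^*}=0$, and $D^*_{h^*A}L=0$ for all $A$ (where $h^*=\beta^*\circ\rho$); objects with $^*$ are those of $D^*$. Known facts: $\beta^*=\beta$, $K^*=K$, $T^*=T$, and $D^*_AY=\nabla_AY+\widehat P(\rho A,Y)$. Notation: $P^*(X,Y,Z,W):=g(P^*(X,Y)Z,W)$, $\widehat P(X,Y,Z):=g(\widehat P(X,Y),Z)$; in (a), $(D^*_A\widehat P)(X,Z,W)$ is the covariant derivative of this scalar-valued trilinear form. $(D^*_AT)(X,Y)=D^*_A(T(X,Y))-T(D^*_AX,Y)-T(X,D^*_AY)$, and $(D^*_AP^* )(X,Y,Z)$ is the vector-valued covariant derivative of $(X,Y,Z)\mapsto P^*(X,Y)Z$. 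*)

theory Defs
  imports "HOL-Analysis.Analysis" "HOL-Library.Function_Algebras"
begin

section \<open>Smooth manifolds\<close>

fun Ck_on :: "nat \<Rightarrow> 'e::real_normed_vector set \<Rightarrow> ('e \<Rightarrow> 'f::real_normed_vector) \<Rightarrow> bool" where
  "Ck_on 0 W f \<longleftrightarrow> continuous_on W f"
| "Ck_on (Suc k) W f \<longleftrightarrow>
     (\<forall>x\<in>W. f differentiable (at x)) \<and> (\<forall>v. Ck_on k W (\<lambda>x. frechet_derivative f (at x) v))"

definition smooth_on :: "'e::real_normed_vector set \<Rightarrow> ('e \<Rightarrow> 'f::real_normed_vector) \<Rightarrow> bool" where
  "smooth_on W f \<longleftrightarrow> (\<forall>k. Ck_on k W f)"

type_synonym ('a, 'e) chart = "'a set \<times> ('a \<Rightarrow> 'e)"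

definition paracompact_space :: "'a topology \<Rightarrow> bool" where
  "paracompact_space X \<longleftrightarrow>
     (\<forall>\<U>. (\<forall>U\<in>\<U>. openin X U) \<and> \<Union>\<U> = topspace X \<longrightarrow>
        (\<exists>\<V>. (\<forall>V\<in>\<V>. openin X V \<and> (\<exists>U\<in>\<U>. V \<subseteq> U)) \<and> \<Union>\<V> = topspace X \<and> locally_finite_in X \<V>))"

definition smooth_manifold :: "'m topology \<Rightarrow> ('m, 'e::euclidean_space) chart set \<Rightarrow> bool" where
  "smooth_manifold X \<A> \<longleftrightarrow>
     Hausdorff_space X \<and> paracompact_space X \<and>
     (\<Union>(U, \<phi>)\<in>\<A>. U) = topspace X \<and>
     (\<forall>(U, \<phi>)\<in>\<A>. openin X U \<and> open (\<phi> ` U) \<and>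
        homeomorphic_map (subtopology X U) (top_of_set (\<phi> ` U)) \<phi>) \<and>
     (\<forall>(U, \<phi>)\<in>\<A>. \<forall>(V, \<psi>)\<in>\<A>. smooth_on (\<phi> ` (U \<inter> V)) (\<psi> \<circ> inv_into U \<phi>))"

definition points :: "('a, 'e) chart set \<Rightarrow> 'a set" where
  "points \<A> = (\<Union>(U, \<phi>)\<in>\<A>. U)"

text \<open>A function is smooth at a point if it is \<open>C\<^sup>\<infinity>\<close> on a neighbourhood of that point; its values
  elsewhere are irrelevant.\<close>

definition smooth_at :: "('a, 'e::euclidean_space) chart set \<Rightarrow> ('a \<Rightarrow> real) \<Rightarrow> 'a \<Rightarrow> bool" where
  "smooth_at \<A> f p \<longleftrightarrow>
     (\<exists>(U, \<phi>)\<in>\<A>. p \<in> U \<and>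
        (\<exists>W. open W \<and> \<phi> p \<in> W \<and> W \<subseteq> \<phi> ` U \<and> smooth_on W (f \<circ> inv_into U \<phi>)))"

definition smooth_functions :: "('a, 'e::euclidean_space) chart set \<Rightarrow> ('a \<Rightarrow> real) set" where
  "smooth_functions \<A> = {f. \<forall>p\<in>points \<A>. smooth_at \<A> f p}"


section \<open>Tangent vectors and vector fields\<close>

type_synonym 'a tvec = "('a \<Rightarrow> real) \<Rightarrow> real"

definition scale :: "real \<Rightarrow> 'a tvec \<Rightarrow> 'a tvec"  (infixr \<open>*\<^sub>t\<close> 75) where
  "c *\<^sub>t v = (\<lambda>f. c * v f)"

text \<open>Tangent vectors at \<open>p\<close> are the derivations on functions smooth near \<open>p\<close>.  The Leibniz rule,
  applied with locally constant factors, makes them depend on germs only.  The last clause fixes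
  their values on irrelevant arguments, so that equality of tangent vectors is equality of
  functions; addition and zero are pointwise.\<close>

definition tangent_space :: "('a, 'e::euclidean_space) chart set \<Rightarrow> 'a \<Rightarrow> 'a tvec set" where
  "tangent_space \<A> p = {v.
     (\<forall>f g. smooth_at \<A> f p \<longrightarrow> smooth_at \<A> g p \<longrightarrow>
        v (\<lambda>x. f x + g x) = v f + v g \<and>
        v (\<lambda>x. f x * g x) = f p * v g + g p * v f) \<and>
     (\<forall>c f. smooth_at \<A> f p \<longrightarrow> v (\<lambda>x. c * f x) = c * v f) \<and>
     (\<forall>f. \<not> smooth_at \<A> f p \<longrightarrow> v f = 0)}"

definition vector_fields :: "('a, 'e::euclidean_space) chart set \<Rightarrow> ('a \<Rightarrow> 'a tvec) set" where
  "vector_fields \<A> = {A. \<forall>p\<in>points \<A>. A p \<in> tangent_space \<A> p \<and>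
     (\<forall>f. smooth_at \<A> f p \<longrightarrow> smooth_at \<A> (\<lambda>q. A q f) p)}"

definition lie_bracket ::
  "('a, 'e::euclidean_space) chart set \<Rightarrow> ('a \<Rightarrow> 'a tvec) \<Rightarrow> ('a \<Rightarrow> 'a tvec) \<Rightarrow> 'a \<Rightarrow> 'a tvec" where
  "lie_bracket \<A> A B = (\<lambda>p f. if smooth_at \<A> f p
     then A p (\<lambda>q. B q f) - B p (\<lambda>q. A q f) else 0)"


section \<open>The slit tangent bundle and the pullback bundle\<close>

type_synonym 'm tb = "'m \<times> 'm tvec"

definition slit_tangent_bundle ::
  "('m, 'e::euclidean_space) chart set \<Rightarrow> ('m tb, 'e \<times> 'e) chart set"  (\<open>\<T>\<close>) where
  "\<T> \<A> = (\<lambda>(U, \<phi>).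
     ({(p, v). p \<in> U \<and> v \<in> tangent_space \<A> p \<and> v \<noteq> 0},
      \<lambda>(p, v). (\<phi> p, \<Sum>b\<in>Basis. v (\<lambda>q. \<phi> q \<bullet> b) *\<^sub>R b))) ` \<A>"

text \<open>The fibre of the pullback bundle over \<open>u = (p, w)\<close> is \<open>{u} \<times> T\<^sub>pM\<close>.  The redundant component
  \<open>u\<close> is dropped everywhere: a section is a map sending \<open>u\<close> into \<open>T\<^sub>pM\<close>.\<close>

definition pi_fields :: "('m, 'e::euclidean_space) chart set \<Rightarrow> ('m tb \<Rightarrow> 'm tvec) set" where
  "pi_fields \<A> = {X. \<forall>u\<in>points (\<T> \<A>). X u \<in> tangent_space \<A> (fst u) \<and>
     (\<forall>f. smooth_at \<A> f (fst u) \<longrightarrow> smooth_at (\<T> \<A>) (\<lambda>w. X w f) u)}"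

definition eta :: "'m tb \<Rightarrow> 'm tvec" where
  "eta u = snd u"

definition rho :: "('m, 'e::euclidean_space) chart set \<Rightarrow> 'm tb \<Rightarrow> 'm tb tvec \<Rightarrow> 'm tvec" where
  "rho \<A> u a = (\<lambda>f. if smooth_at \<A> f (fst u) then a (f \<circ> fst) else 0)"

definition vlift :: "('m, 'e::euclidean_space) chart set \<Rightarrow> 'm tb \<Rightarrow> 'm tvec \<Rightarrow> 'm tb tvec" where
  "vlift \<A> u v = (\<lambda>f. if smooth_at (\<T> \<A>) f u
     then deriv (\<lambda>t. f (fst u, snd u + t *\<^sub>t v)) 0 else 0)"

abbreviation rho_f where "rho_f \<A> A \<equiv> (\<lambda>u. rho \<A> u (A u))"
abbreviation vlift_f where "vlift_f \<A> X \<equiv> (\<lambda>u. vlift \<A> u (X u))"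

definition vertical :: "('m, 'e::euclidean_space) chart set \<Rightarrow> 'm tb \<Rightarrow> 'm tb tvec set" where
  "vertical \<A> u = {a \<in> tangent_space (\<T> \<A>) u. rho \<A> u a = 0}"


section \<open>Finsler structures\<close>

definition finsler_metric :: "('m tb \<Rightarrow> real) \<Rightarrow> 'm tb \<Rightarrow> 'm tvec \<Rightarrow> 'm tvec \<Rightarrow> real" where
  "finsler_metric L u v w =
     deriv (\<lambda>s. deriv (\<lambda>t. (1/2) * (L (fst u, snd u + s *\<^sub>t v + t *\<^sub>t w))\<^sup>2) 0) 0"

definition finsler_manifold ::
  "'m topology \<Rightarrow> ('m, 'e::euclidean_space) chart set \<Rightarrow> ('m tb \<Rightarrow> real) \<Rightarrow> bool" where
  "finsler_manifold X \<A> L \<longleftrightarrow>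
     smooth_manifold X \<A> \<and>
     (\<forall>p\<in>points \<A>. \<forall>v\<in>tangent_space \<A> p.
        0 \<le> L (p, v) \<and> (\<forall>c>0. L (p, c *\<^sub>t v) = c * L (p, v))) \<and>
     L \<in> smooth_functions (\<T> \<A>) \<and>
     (\<forall>u\<in>points (\<T> \<A>). 0 < L u) \<and>
     (\<forall>u\<in>points (\<T> \<A>). \<forall>v\<in>tangent_space \<A> (fst u). v \<noteq> 0 \<longrightarrow> 0 < finsler_metric L u v v)"


section \<open>Connections on the pullback bundle\<close>

text \<open>\<open>D u a Y\<close> is the covariant derivative of the section \<open>Y\<close> along the tangent vector \<open>a\<close> at \<open>u\<close>.
  Only smooth sections over the whole slit tangent bundle are differentiated; their values outside
  it do not matter, by the Leibniz rule for the indicator function of the complement.\<close>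

type_synonym 'm connection = "'m tb \<Rightarrow> 'm tb tvec \<Rightarrow> ('m tb \<Rightarrow> 'm tvec) \<Rightarrow> 'm tvec"

definition cov ::
  "'m connection \<Rightarrow> ('m tb \<Rightarrow> 'm tb tvec) \<Rightarrow> ('m tb \<Rightarrow> 'm tvec) \<Rightarrow> 'm tb \<Rightarrow> 'm tvec" where
  "cov D A Y = (\<lambda>u. D u (A u) Y)"

definition linear_connection ::
  "('m, 'e::euclidean_space) chart set \<Rightarrow> 'm connection \<Rightarrow> bool" where
  "linear_connection \<A> D \<longleftrightarrow>
     (\<forall>A\<in>vector_fields (\<T> \<A>). \<forall>Y\<in>pi_fields \<A>. cov D A Y \<in> pi_fields \<A>) \<and>
     (\<forall>u\<in>points (\<T> \<A>). \<forall>Y\<in>pi_fields \<A>.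
        (\<forall>a\<in>tangent_space (\<T> \<A>) u. D u a Y \<in> tangent_space \<A> (fst u)) \<and>
        (\<forall>a\<in>tangent_space (\<T> \<A>) u. \<forall>b\<in>tangent_space (\<T> \<A>) u. D u (a + b) Y = D u a Y + D u b Y) \<and>
        (\<forall>a\<in>tangent_space (\<T> \<A>) u. \<forall>c. D u (c *\<^sub>t a) Y = c *\<^sub>t D u a Y) \<and>
        (\<forall>a\<in>tangent_space (\<T> \<A>) u. \<forall>Z\<in>pi_fields \<A>. D u a (Y + Z) = D u a Y + D u a Z) \<and>
        (\<forall>a\<in>tangent_space (\<T> \<A>) u. \<forall>f\<in>smooth_functions (\<T> \<A>).
           D u a (\<lambda>w. f w *\<^sub>t Y w) = a f *\<^sub>t Y u + f u *\<^sub>t D u a Y))"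

definition conn_map :: "'m connection \<Rightarrow> 'm tb \<Rightarrow> 'm tb tvec \<Rightarrow> 'm tvec" where
  "conn_map D u a = D u a eta"

definition horizontal ::
  "('m, 'e::euclidean_space) chart set \<Rightarrow> 'm connection \<Rightarrow> 'm tb \<Rightarrow> 'm tb tvec set" where
  "horizontal \<A> D u = {a \<in> tangent_space (\<T> \<A>) u. conn_map D u a = 0}"

definition regular_connection ::
  "('m, 'e::euclidean_space) chart set \<Rightarrow> 'm connection \<Rightarrow> bool" where
  "regular_connection \<A> D \<longleftrightarrow> linear_connection \<A> D \<and>
     (\<forall>u\<in>points (\<T> \<A>). vertical \<A> u \<inter> horizontal \<A> D u = {0} \<and>
        tangent_space (\<T> \<A>) u = {a + b | a b. a \<in> vertical \<A> u \<and> b \<in> horizontal \<A> D u})"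

definition hlift ::
  "('m, 'e::euclidean_space) chart set \<Rightarrow> 'm connection \<Rightarrow> 'm tb \<Rightarrow> 'm tvec \<Rightarrow> 'm tb tvec" where
  "hlift \<A> D u = inv_into (horizontal \<A> D u) (rho \<A> u)"

abbreviation hlift_f where "hlift_f \<A> D X \<equiv> (\<lambda>u. hlift \<A> D u (X u))"

definition torsion where
  "torsion \<A> D A B =
     cov D A (rho_f \<A> B) - cov D B (rho_f \<A> A) - rho_f \<A> (lie_bracket (\<T> \<A>) A B)"

text \<open>The vector field \<open>C\<close> enters \<open>\<^bold>K(A,B)\<rho>C\<close> only through \<open>\<rho>C\<close>, which is replaced by a
  section \<open>Z\<close>.  The sign is opposite to the usual one.\<close>

definition curvature where
  "curvature \<A> D A B Z =
     - cov D A (cov D B Z) + cov D B (cov D A Z) + cov D (lie_bracket (\<T> \<A>) A B) Z"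

definition Q_torsion where
  "Q_torsion \<A> D X Y = torsion \<A> D (hlift_f \<A> D X) (hlift_f \<A> D Y)"

definition T_torsion where
  "T_torsion \<A> D X Y = torsion \<A> D (vlift_f \<A> X) (hlift_f \<A> D Y)"

definition P_curvature where
  "P_curvature \<A> D X Y Z = curvature \<A> D (hlift_f \<A> D X) (vlift_f \<A> Y) Z"

definition P_hat where
  "P_hat \<A> D X Y = P_curvature \<A> D X Y eta"

definition metric_f ::
  "('m tb \<Rightarrow> real) \<Rightarrow> ('m tb \<Rightarrow> 'm tvec) \<Rightarrow> ('m tb \<Rightarrow> 'm tvec) \<Rightarrow> 'm tb \<Rightarrow> real" where
  "metric_f L X Y = (\<lambda>u. finsler_metric L u (X u) (Y u))"


section \<open>Covariant derivatives of tensor fields\<close>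

definition dir :: "('a \<Rightarrow> 'a tvec) \<Rightarrow> ('a \<Rightarrow> real) \<Rightarrow> 'a \<Rightarrow> real" where
  "dir A f = (\<lambda>u. A u f)"

text \<open>The letter \<open>s\<close> stands for scalar-valued, \<open>v\<close> for vector-valued; the digit is the number of
  arguments of the tensor field.\<close>

definition cov_s2 where
  "cov_s2 D A \<omega> X Y = dir A (\<omega> X Y) - \<omega> (cov D A X) Y - \<omega> X (cov D A Y)"

definition cov_s3 where
  "cov_s3 D A \<omega> X Y Z = dir A (\<omega> X Y Z)
     - \<omega> (cov D A X) Y Z - \<omega> X (cov D A Y) Z - \<omega> X Y (cov D A Z)"

definition cov_v2 where
  "cov_v2 D A \<omega> X Y = cov D A (\<omega> X Y) - \<omega> (cov D A X) Y - \<omega> X (cov D A Y)"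

definition cov_v3 where
  "cov_v3 D A \<omega> X Y Z = cov D A (\<omega> X Y Z)
     - \<omega> (cov D A X) Y Z - \<omega> X (cov D A Y) Z - \<omega> X Y (cov D A Z)"


section \<open>The Cartan and Hashiguchi connections\<close>

definition T_symmetric ::
  "('m, 'e::euclidean_space) chart set \<Rightarrow> ('m tb \<Rightarrow> real) \<Rightarrow> 'm connection \<Rightarrow> bool" where
  "T_symmetric \<A> L D \<longleftrightarrow>
     (\<forall>X\<in>pi_fields \<A>. \<forall>Y\<in>pi_fields \<A>. \<forall>Z\<in>pi_fields \<A>. \<forall>u\<in>points (\<T> \<A>).
        metric_f L (T_torsion \<A> D X Y) Z u = metric_f L (T_torsion \<A> D X Z) Y u)"

definition cartan_connection ::
  "('m, 'e::euclidean_space) chart set \<Rightarrow> ('m tb \<Rightarrow> real) \<Rightarrow> 'm connection \<Rightarrow> bool" where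
  "cartan_connection \<A> L D \<longleftrightarrow> regular_connection \<A> D \<and>
     (\<forall>A\<in>vector_fields (\<T> \<A>). \<forall>Y\<in>pi_fields \<A>. \<forall>Z\<in>pi_fields \<A>. \<forall>u\<in>points (\<T> \<A>).
        cov_s2 D A (metric_f L) Y Z u = 0) \<and>
     (\<forall>X\<in>pi_fields \<A>. \<forall>Y\<in>pi_fields \<A>. \<forall>u\<in>points (\<T> \<A>). Q_torsion \<A> D X Y u = 0) \<and>
     T_symmetric \<A> L D"

definition hashiguchi_connection ::
  "('m, 'e::euclidean_space) chart set \<Rightarrow> ('m tb \<Rightarrow> real) \<Rightarrow> 'm connection \<Rightarrow> bool" where
  "hashiguchi_connection \<A> L D \<longleftrightarrow> regular_connection \<A> D \<and>
     (\<forall>X\<in>pi_fields \<A>. \<forall>Y\<in>pi_fields \<A>. \<forall>Z\<in>pi_fields \<A>. \<forall>u\<in>points (\<T> \<A>).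
        cov_s2 D (vlift_f \<A> X) (metric_f L) Y Z u = 0) \<and>
     T_symmetric \<A> L D \<and>
     (\<forall>X\<in>pi_fields \<A>. \<forall>Y\<in>pi_fields \<A>. \<forall>u\<in>points (\<T> \<A>). Q_torsion \<A> D X Y u = 0) \<and>
     (\<forall>X\<in>pi_fields \<A>. \<forall>Y\<in>pi_fields \<A>. \<forall>u\<in>points (\<T> \<A>). P_hat \<A> D X Y u = 0) \<and>
     (\<forall>A\<in>vector_fields (\<T> \<A>). \<forall>u\<in>points (\<T> \<A>). dir (hlift_f \<A> D (rho_f \<A> A)) L u = 0)"

end

theory Submission
  imports Defs
begin

text \<open>The identities are formal consequences of a small algebraic structure: the Lie algebra of
  vector fields on the slit tangent bundle acting on functions and sections, the maps \<open>\<rho>\<close> and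
  \<open>\<gamma>\<close>, and the flat connection \<open>X, Y \<mapsto> \<rho>[\<gamma>X, A]\<close> with \<open>\<rho>A = Y\<close> along the fibres; the
  metric is the Hessian of \<open>E = L\<^sup>2/2\<close> for the latter.  Only additivity of the operations is used.

  In this structure \<open>T\<close> is determined by the metric, is totally symmetric and kills \<open>\<eta>\<close>, so that
  \<open>D\<^bsub>\<gamma>X\<^esub>\<eta> = X\<close>.  For the Cartan connection, metricity and the hv Bianchi identity
  give \<open>P(\<eta>, Y)\<eta> = 0\<close> (the Christoffel trick), which makes \<open>\<beta>\<eta>\<close> the Euler--Lagrange
  spray of \<open>E\<close>.  The same holds for the Hashiguchi connection, so both have the same
  spray, hence the same \<open>\<beta>\<close>, and \<open>D\<^sup>*\<^sub>A Y = D\<^sub>A Y + P(\<rho>A, Y)\<eta>\<close>.  Then (a) is the Ricci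
  identity for \<open>D\<^sup>*\<close> applied to the metric, (c) is the Bianchi identity for the torsion, (d)
  the analogous identity for \<open>A \<mapsto> D\<^sup>*\<^sub>A\<eta>\<close> in place of \<open>\<rho>\<close>, and (f) the second Bianchi
  identity.

  The geometric input is Hadamard's lemma, which identifies derivations with coordinate vectors,
  and bump functions, without which a connection acting on global fields need not produce smooth
  horizontal lifts.\<close>

section \<open>Calculus of smooth maps\<close>

text \<open>Two obstacles shape the argument. \<open>hlift\<close> is a pointwise inverse of
  \<open>rho\<close>, and nothing in its definition makes the lift of a smooth section smooth. The
  proof of smoothness uses \<open>D (gam X) et = X\<close>, a consequence of the torsion symmetry,
  while \<open>T_torsion\<close> is itself defined through \<open>hlift\<close>. The circle is
  broken because the bracket term of the torsion depends only on \<open>rho (hlift v) = v\<close>: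
  the torsion is the difference between \<open>D\<close> and the flat derivative, whatever the lift
  does elsewhere. The vertical theory therefore precedes the lifts. The second obstacle is that the
  slit tangent bundle is given by charts only, without a topology; nearness of points is read off in
  charts. The algebraic part never multiplies by functions. Tensor arguments are global fields, a
  tensor identity is tested by nondegeneracy on the difference of its two sides, and division by two
  is replaced by the absence of 2-torsion. The coincidence of the two horizontal lifts and of the
  two torsions, and the formula expressing one connection by the other, are derived on the
  way.\<close>

lemma Ck_on_cong:
  assumes "open W" "\<And>x. x \<in> W \<Longrightarrow> f x = g x" "Ck_on k W f"
  shows "Ck_on k W g"
  using assms(2,3)
proof (induction k arbitrary: f g)
  case 0
  then show ?case using continuous_on_cong[of W W f g] by simp
next
  case (Suc k)
  have d: "(g has_derivative frechet_derivative f (at x)) (at x)" if "x \<in> W" for x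
    using Suc.prems that assms(1) frechet_derivative_works
    by (metis (no_types, lifting) Ck_on.simps(2) has_derivative_transform_within_open)
  have "Ck_on k W (\<lambda>x. frechet_derivative g (at x) v)" for v
  proof (rule Suc.IH)
    show "Ck_on k W (\<lambda>x. frechet_derivative f (at x) v)" using Suc.prems(2) by simp
    show "frechet_derivative f (at x) v = frechet_derivative g (at x) v" if "x \<in> W" for x
      using frechet_derivative_at[OF d[OF that]] by simp
  qed
  then show ?case using d by (auto simp: differentiable_def)
qed

lemma Ck_on_SucI:
  assumes "open W" "\<And>x. x \<in> W \<Longrightarrow> (f has_derivative f' x) (at x)" "\<And>v. Ck_on k W (\<lambda>x. f' x v)"
  shows "Ck_on (Suc k) W f"
proof -
  have "frechet_derivative f (at x) = f' x" if "x \<in> W" for x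
    using assms(2)[OF that] frechet_derivative_at by metis
  then have "Ck_on k W (\<lambda>x. frechet_derivative f (at x) v)" for v
    by (intro Ck_on_cong[OF assms(1) _ assms(3)]) simp
  then show ?thesis using assms(2) by (auto simp: differentiable_def)
qed

lemma Ck_on_SucD:
  assumes "Ck_on (Suc k) W f"
  shows "x \<in> W \<Longrightarrow> (f has_derivative frechet_derivative f (at x)) (at x)"
    and "Ck_on k W (\<lambda>x. frechet_derivative f (at x) v)"
  using assms frechet_derivative_works by auto

lemma Ck_on_imp_continuous_on: "Ck_on k W f \<Longrightarrow> continuous_on W f"
proof (cases k)
  case (Suc n)
  assume "Ck_on k W f"
  with Suc show ?thesis
    by (meson Ck_on.simps(2) continuous_at_imp_continuous_on differentiable_imp_continuous_within)
qed simp

lemma Ck_on_lower: "Ck_on (Suc k) W f \<Longrightarrow> Ck_on k W f"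
proof (induction k arbitrary: f)
  case 0
  then show ?case using Ck_on_imp_continuous_on by (metis Ck_on.simps(1))
next
  case (Suc k)
  then show ?case by (metis Ck_on.simps(2))
qed

lemma Ck_on_subset: "Ck_on k W f \<Longrightarrow> W' \<subseteq> W \<Longrightarrow> Ck_on k W' f"
proof (induction k arbitrary: f)
  case 0
  then show ?case using continuous_on_subset by auto
qed auto

lemma Ck_on_const: "Ck_on k W (\<lambda>x. c)"
proof (induction k arbitrary: c)
  case (Suc k)
  then show ?case by (simp add: frechet_derivative_const)
qed simp

lemma Ck_on_bounded_linear:
  assumes "bounded_linear f"
  shows "Ck_on k W f"
proof (cases k)
  case 0
  then show ?thesis using assms linear_continuous_on by auto
next
  case (Suc n)
  have "frechet_derivative f (at x) = f" for x
    using assms bounded_linear_imp_has_derivative frechet_derivative_at by metis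
  then show ?thesis using Suc assms
    by (auto simp: Ck_on_const bounded_linear_imp_differentiable)
qed

lemma Ck_on_add:
  assumes "open W" "Ck_on k W f" "Ck_on k W g"
  shows "Ck_on k W (\<lambda>x. f x + g x)"
  using assms(2,3)
proof (induction k arbitrary: f g)
  case 0
  then show ?case using continuous_on_add by auto
next
  case (Suc k)
  show ?case
    by (rule Ck_on_SucI[OF assms(1)])
      (auto intro!: has_derivative_add Ck_on_SucD[OF Suc.prems(1)] Ck_on_SucD[OF Suc.prems(2)] Suc.IH)
qed

lemma Ck_on_sum:
  assumes "open W" "\<And>i. i \<in> I \<Longrightarrow> Ck_on k W (f i)"
  shows "Ck_on k W (\<lambda>x. \<Sum>i\<in>I. f i x)"
  using assms(2)
  by (induction I rule: infinite_finite_induct) (auto intro: Ck_on_const Ck_on_add[OF assms(1)])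

lemma (in bounded_bilinear) Ck_on_prod:
  assumes "open W" "Ck_on k W f" "Ck_on k W g"
  shows "Ck_on k W (\<lambda>x. prod (f x) (g x))"
  using assms(2,3)
proof (induction k arbitrary: f g)
  case 0
  then show ?case using continuous_on by auto
next
  case (Suc k)
  show ?case
  proof (rule Ck_on_SucI[OF assms(1)])
    show "((\<lambda>x. prod (f x) (g x)) has_derivative (\<lambda>h. prod (f x) (frechet_derivative g (at x) h)
        + prod (frechet_derivative f (at x) h) (g x))) (at x)" if "x \<in> W" for x
      using FDERIV[OF Ck_on_SucD(1)[OF Suc.prems(1) that] Ck_on_SucD(1)[OF Suc.prems(2) that]] .
    show "Ck_on k W (\<lambda>x. prod (f x) (frechet_derivative g (at x) v)
        + prod (frechet_derivative f (at x) v) (g x))" for v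
      by (intro Ck_on_add assms(1) Suc.IH Ck_on_lower[OF Suc.prems(1)] Ck_on_lower[OF Suc.prems(2)]
          Ck_on_SucD(2)[OF Suc.prems(1)] Ck_on_SucD(2)[OF Suc.prems(2)])
  qed
qed

lemmas Ck_on_mult = bounded_bilinear.Ck_on_prod[OF bounded_bilinear_mult]
lemmas Ck_on_scaleR = bounded_bilinear.Ck_on_prod[OF bounded_bilinear_scaleR]
lemmas Ck_on_inner = bounded_bilinear.Ck_on_prod[OF bounded_bilinear_inner]

lemma frechet_derivative_euclidean:
  fixes f :: "'e::euclidean_space \<Rightarrow> 'f::real_normed_vector"
  assumes "f differentiable (at x)"
  shows "frechet_derivative f (at x) v = (\<Sum>b\<in>Basis. (v \<bullet> b) *\<^sub>R frechet_derivative f (at x) b)"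
proof -
  interpret linear "frechet_derivative f (at x)"
    using assms linear_frechet_derivative by blast
  show ?thesis
    by (subst (1) euclidean_representation[of v, symmetric]) (simp add: sum scaleR)
qed

text \<open>\<open>Ck_on\<close> speaks of derivatives in a fixed direction, whereas the chain rule
  evaluates the derivative of \<open>g\<close> in a direction that moves with \<open>x\<close>.
  Expanding this direction in the basis of the middle space gives a finite sum of products, to which
  the induction hypothesis applies.\<close>

lemma Ck_on_compose:
  fixes f :: "'a::real_normed_vector \<Rightarrow> 'b::euclidean_space"
  assumes "open W" "open S" "Ck_on k W f" "Ck_on k S g" "\<And>x. x \<in> W \<Longrightarrow> f x \<in> S"
  shows "Ck_on k W (\<lambda>x. g (f x))"
  using assms(3,4)
proof (induction k arbitrary: g)
  case 0
  then show ?case using assms(5) continuous_on_compose2[of S g W f] by auto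
next
  case (Suc k)
  let ?g = "\<lambda>x. frechet_derivative g (at (f x))"
  have dg: "(g has_derivative ?g x) (at (f x))" if "x \<in> W" for x
    using Ck_on_SucD(1)[OF Suc.prems(2) assms(5)[OF that]] .
  show ?case
  proof (rule Ck_on_SucI[OF assms(1)])
    show "((\<lambda>x. g (f x)) has_derivative
        (\<lambda>v. \<Sum>b\<in>Basis. (frechet_derivative f (at x) v \<bullet> b) *\<^sub>R ?g x b)) (at x)"
      if "x \<in> W" for x
    proof -
      have "((\<lambda>x. g (f x)) has_derivative (\<lambda>v. ?g x (frechet_derivative f (at x) v))) (at x)"
        using has_derivative_compose[OF Ck_on_SucD(1)[OF Suc.prems(1) that] dg[OF that]] .
      moreover have "g differentiable (at (f x))" using dg[OF that] differentiable_def by blast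
      ultimately show ?thesis using frechet_derivative_euclidean by (metis (no_types, lifting) ext)
    qed
    have "Ck_on k W (\<lambda>x. ?g x b)" for b
      using Suc.IH[of "\<lambda>y. frechet_derivative g (at y) b"] Ck_on_lower[OF Suc.prems(1)]
        Ck_on_SucD(2)[OF Suc.prems(2)] by blast
    then show "Ck_on k W (\<lambda>x. \<Sum>b\<in>Basis. (frechet_derivative f (at x) v \<bullet> b) *\<^sub>R ?g x b)" for v
      by (intro Ck_on_sum Ck_on_scaleR Ck_on_inner Ck_on_const assms(1) Ck_on_SucD(2)[OF Suc.prems(1)])
  qed
qed

section \<open>Closure properties of smooth maps\<close>

lemma smooth_on_cong: "open W \<Longrightarrow> (\<And>x. x \<in> W \<Longrightarrow> f x = g x) \<Longrightarrow> smooth_on W f \<Longrightarrow> smooth_on W g"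
  unfolding smooth_on_def using Ck_on_cong by blast

lemma smooth_on_subset: "smooth_on W f \<Longrightarrow> W' \<subseteq> W \<Longrightarrow> smooth_on W' f"
  unfolding smooth_on_def using Ck_on_subset by blast

lemma smooth_on_const: "smooth_on W (\<lambda>x. c)"
  by (simp add: smooth_on_def Ck_on_const)

lemma smooth_on_bounded_linear: "bounded_linear f \<Longrightarrow> smooth_on W f"
  by (simp add: smooth_on_def Ck_on_bounded_linear)

lemma smooth_on_add:
  "open W \<Longrightarrow> smooth_on W f \<Longrightarrow> smooth_on W g \<Longrightarrow> smooth_on W (\<lambda>x. f x + g x)"
  by (simp add: smooth_on_def Ck_on_add)

lemma smooth_on_sum:
  "open W \<Longrightarrow> (\<And>i. i \<in> I \<Longrightarrow> smooth_on W (f i)) \<Longrightarrow> smooth_on W (\<lambda>x. \<Sum>i\<in>I. f i x)"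
  by (simp add: smooth_on_def Ck_on_sum)

lemma smooth_on_mult:
  fixes f g :: "_ \<Rightarrow> real"
  shows "open W \<Longrightarrow> smooth_on W f \<Longrightarrow> smooth_on W g \<Longrightarrow> smooth_on W (\<lambda>x. f x * g x)"
  by (simp add: smooth_on_def Ck_on_mult)

lemma smooth_on_scaleR:
  "open W \<Longrightarrow> smooth_on W f \<Longrightarrow> smooth_on W g \<Longrightarrow> smooth_on W (\<lambda>x. f x *\<^sub>R g x)"
  by (simp add: smooth_on_def Ck_on_scaleR)

lemma smooth_on_inner:
  "open W \<Longrightarrow> smooth_on W f \<Longrightarrow> smooth_on W g \<Longrightarrow> smooth_on W (\<lambda>x. f x \<bullet> g x)"
  by (simp add: smooth_on_def Ck_on_inner)

lemma smooth_on_compose: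
  fixes f :: "'a::real_normed_vector \<Rightarrow> 'b::euclidean_space"
  shows "open W \<Longrightarrow> open S \<Longrightarrow> smooth_on W f \<Longrightarrow> smooth_on S g \<Longrightarrow> (\<And>x. x \<in> W \<Longrightarrow> f x \<in> S)
    \<Longrightarrow> smooth_on W (\<lambda>x. g (f x))"
  by (simp add: smooth_on_def Ck_on_compose)

lemma smooth_on_has_derivative:
  "smooth_on W f \<Longrightarrow> x \<in> W \<Longrightarrow> (f has_derivative frechet_derivative f (at x)) (at x)"
  unfolding smooth_on_def using Ck_on_SucD(1) by blast

lemma smooth_on_differentiable: "smooth_on W f \<Longrightarrow> x \<in> W \<Longrightarrow> f differentiable (at x)"
  using smooth_on_has_derivative differentiable_def by blast

lemma smooth_on_frechet_derivative:
  "smooth_on W f \<Longrightarrow> smooth_on W (\<lambda>x. frechet_derivative f (at x) v)"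
  unfolding smooth_on_def using Ck_on_SucD(2) by blast

lemma smooth_on_continuous_on: "smooth_on W f \<Longrightarrow> continuous_on W f"
  unfolding smooth_on_def using Ck_on_imp_continuous_on by blast

lemma smooth_on_Pair:
  fixes f :: "'a::real_normed_vector \<Rightarrow> 'b::euclidean_space" and g :: "'a \<Rightarrow> 'c::euclidean_space"
  assumes "open W" "smooth_on W f" "smooth_on W g"
  shows "smooth_on W (\<lambda>x. (f x, g x))"
proof -
  have "smooth_on UNIV (\<lambda>x::'b. (x, 0::'c))"
    by (rule smooth_on_bounded_linear) (rule bounded_linear_Pair[OF bounded_linear_ident bounded_linear_zero])
  from smooth_on_compose[OF assms(1) open_UNIV assms(2) this]
  have 1: "smooth_on W (\<lambda>x. (f x, 0::'c))" by simp
  have "smooth_on UNIV (\<lambda>y::'c. (0::'b, y))"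
    by (rule smooth_on_bounded_linear) (rule bounded_linear_Pair[OF bounded_linear_zero bounded_linear_ident])
  from smooth_on_compose[OF assms(1) open_UNIV assms(3) this]
  have "smooth_on W (\<lambda>x. (0::'b, g x))" by simp
  from smooth_on_add[OF assms(1) 1 this] show ?thesis by simp
qed

subsection \<open>Hadamard's lemma\<close>

lemma segment_in_ball:
  fixes a :: "'e::real_normed_vector"
  assumes "x \<in> ball a r" "t \<in> {0..1}"
  shows "a + t *\<^sub>R (x - a) \<in> ball a r"
proof -
  have "t * norm (x - a) \<le> 1 * norm (x - a)" using assms by (intro mult_right_mono) auto
  moreover have "dist a (a + t *\<^sub>R (x - a)) = t * norm (x - a)" using assms by (simp add: dist_norm)
  moreover have "norm (x - a) < r" using assms by (simp add: dist_norm norm_minus_commute)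
  ultimately show ?thesis by simp
qed

text \<open>Differentiation under the integral sign produces one more factor \<open>t\<close> from
  the inner map. The weights \<open>t ^ m\<close> make the family of these integrals closed under
  differentiation, which the induction for smoothness needs.\<close>

lemma radial_integral_has_derivative:
  fixes h :: "'e::euclidean_space \<Rightarrow> real"
  assumes h: "Ck_on (Suc 0) (ball a r) h" and x: "x \<in> ball a r"
  shows "((\<lambda>x. integral {0..1} (\<lambda>t. t ^ m * h (a + t *\<^sub>R (x - a)))) has_derivative
     (\<lambda>v. integral {0..1} (\<lambda>t. t ^ Suc m * frechet_derivative h (at (a + t *\<^sub>R (x - a))) v))) (at x)"
proof -
  let ?c = "\<lambda>x t. a + t *\<^sub>R (x - a)"
  note in_ball = segment_in_ball[of _ a r]
  \<comment> \<open>The Leibniz rule for integrals asks for a jointly continuous operator-valued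
    derivative. \<open>Blinfun\<close> is meaningful only where its argument is known to be bounded
    linear, hence the restriction to the ball and the unit interval below.\<close>
  define fx where "fx y t = Blinfun (\<lambda>v. t ^ Suc m * frechet_derivative h (at (?c y t)) v)" for y t
  have bl: "bounded_linear (\<lambda>v. t ^ Suc m * frechet_derivative h (at (?c y t)) v)"
    if "y \<in> ball a r" "t \<in> {0..1}" for y t
    using Ck_on_SucD(1)[OF h in_ball[OF that]] has_derivative_bounded_linear
    by (intro bounded_linear_const_mult) blast
  have fx: "blinfun_apply (fx y t) v = t ^ Suc m * frechet_derivative h (at (?c y t)) v"
    if "y \<in> ball a r" "t \<in> {0..1}" for y t v
    unfolding fx_def using bounded_linear_Blinfun_apply[OF bl[OF that]] by simp
  have cont_c: "continuous_on (ball a r \<times> {0..1}) (\<lambda>(y, t). ?c y t)"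
    by (auto simp: split_beta intro!: continuous_intros)
  have cont: "continuous_on (ball a r \<times> {0..1}) (\<lambda>(y, t). fx y t)"
  proof (rule continuous_on_blinfun_componentwise)
    fix b :: 'e assume "b \<in> Basis"
    have "continuous_on (ball a r) (\<lambda>z. frechet_derivative h (at z) b)"
      using Ck_on_SucD(2)[OF h] by simp
    then have "continuous_on (ball a r \<times> {0..1}) (\<lambda>p. frechet_derivative h (at ((\<lambda>(y, t). ?c y t) p)) b)"
      by (rule continuous_on_compose2[OF _ cont_c]) (use in_ball in auto)
    then have "continuous_on (ball a r \<times> {0..1})
        (\<lambda>p. snd p ^ Suc m * frechet_derivative h (at (?c (fst p) (snd p))) b)"
      by (intro continuous_intros) (simp add: split_beta)
    then show "continuous_on (ball a r \<times> {0..1}) (\<lambda>p. blinfun_apply (case p of (y, t) \<Rightarrow> fx y t) b)"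
      by (rule continuous_on_eq) (use fx in auto)
  qed
  have cont_fx: "continuous_on {0..1} (fx y)" if "y \<in> ball a r" for y
    by (rule continuous_on_compose2[OF cont, of _ "\<lambda>t. (y, t)", simplified])
      (use that in \<open>auto intro!: continuous_intros\<close>)
  have "((\<lambda>x. integral (cbox 0 1) (\<lambda>t. t ^ m * h (?c x t))) has_derivative
      blinfun_apply (integral (cbox 0 1) (fx x))) (at x within ball a r)"
  proof (rule leibniz_rule)
    fix y t assume y: "y \<in> ball a r" and t: "t \<in> cbox (0::real) 1"
    have "((\<lambda>y. ?c y t) has_derivative (\<lambda>v. t *\<^sub>R v)) (at y within ball a r)"
      by (auto intro!: derivative_eq_intros)
    then have "((\<lambda>y. h (?c y t)) has_derivative (\<lambda>v. frechet_derivative h (at (?c y t)) (t *\<^sub>R v)))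
        (at y within ball a r)"
      by (rule has_derivative_compose) (use Ck_on_SucD(1)[OF h in_ball] y t in auto)
    then have "((\<lambda>y. t ^ m * h (?c y t)) has_derivative
        (\<lambda>v. t ^ m * frechet_derivative h (at (?c y t)) (t *\<^sub>R v))) (at y within ball a r)"
      by (rule has_derivative_mult_right)
    moreover have "t ^ m * frechet_derivative h (at (?c y t)) (t *\<^sub>R v) = blinfun_apply (fx y t) v" for v
    proof -
      have "linear (frechet_derivative h (at (?c y t)))"
        using Ck_on_SucD(1)[OF h in_ball[OF y]] t has_derivative_linear by auto
      then show ?thesis using fx[OF y, of t v] t by (simp add: linear_scale)
    qed
    ultimately show "((\<lambda>y. t ^ m * h (?c y t)) has_derivative blinfun_apply (fx y t)) (at y within ball a r)"
      by simp
  next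
    fix y assume "y \<in> ball a r"
    then have "continuous_on {0..1} (\<lambda>t. h (?c y t))"
      by (intro continuous_on_compose2[OF Ck_on_imp_continuous_on[OF h]])
        (use in_ball in \<open>auto intro!: continuous_intros\<close>)
    then show "(\<lambda>t. t ^ m * h (?c y t)) integrable_on cbox 0 1"
      by (intro integrable_continuous) (auto intro!: continuous_intros)
  qed (use cont x in \<open>auto simp: convex_ball\<close>)
  moreover have "blinfun_apply (integral (cbox 0 1) (fx x))
      = (\<lambda>v. integral {0..1} (\<lambda>t. t ^ Suc m * frechet_derivative h (at (?c x t)) v))"
  proof
    fix v
    have "fx x integrable_on {0..1}" using cont_fx[OF x] integrable_continuous_real by blast
    then have "blinfun_apply (integral {0..1} (fx x)) v = integral {0..1} (\<lambda>t. blinfun_apply (fx x t) v)"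
      using blinfun_apply_integral by blast
    also have "\<dots> = integral {0..1} (\<lambda>t. t ^ Suc m * frechet_derivative h (at (?c x t)) v)"
      by (rule integral_cong) (use fx x in auto)
    finally show "blinfun_apply (integral (cbox 0 1) (fx x)) v
      = integral {0..1} (\<lambda>t. t ^ Suc m * frechet_derivative h (at (?c x t)) v)" by simp
  qed
  ultimately show ?thesis using at_within_open[OF x] by (simp only: cbox_interval) simp
qed

lemma smooth_on_radial_integral:
  fixes h :: "'e::euclidean_space \<Rightarrow> real"
  assumes "smooth_on (ball a r) h"
  shows "smooth_on (ball a r) (\<lambda>x. integral {0..1} (\<lambda>t. t ^ m * h (a + t *\<^sub>R (x - a))))"
  unfolding smooth_on_def
proof
  fix k
  show "Ck_on k (ball a r) (\<lambda>x. integral {0..1} (\<lambda>t. t ^ m * h (a + t *\<^sub>R (x - a))))"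
    using assms
  proof (induction k arbitrary: h m)
    case 0
    have "Ck_on (Suc 0) (ball a r) h" using 0 smooth_on_def by blast
    from has_derivative_continuous[OF radial_integral_has_derivative[OF this]]
    show ?case by (simp add: continuous_at_imp_continuous_on)
  next
    case (Suc k)
    have "Ck_on (Suc 0) (ball a r) h" using Suc.prems smooth_on_def by blast
    note d = radial_integral_has_derivative[OF this]
    show ?case
      by (rule Ck_on_SucI[OF open_ball d], assumption, rule Suc.IH[OF smooth_on_frechet_derivative[OF Suc.prems]])
  qed
qed

text \<open>Integrate the derivative of \<open>f\<close> along the segment from \<open>a\<close> to
  \<open>x\<close>: the coefficient of the \<open>b\<close>-th coordinate of \<open>x - a\<close> is
  the mean of the \<open>b\<close>-th partial derivative over the segment. It is smooth in
  \<open>x\<close>, and at \<open>x = a\<close> the mean is taken over a single point.\<close>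

lemma hadamard:
  fixes f :: "'e::euclidean_space \<Rightarrow> real"
  assumes f: "smooth_on (ball a r) f"
  obtains g where "\<And>b. b \<in> Basis \<Longrightarrow> smooth_on (ball a r) (g b)"
    and "\<And>x. x \<in> ball a r \<Longrightarrow> f x = f a + (\<Sum>b\<in>Basis. ((x - a) \<bullet> b) * g b x)"
    and "\<And>b. b \<in> Basis \<Longrightarrow> g b a = frechet_derivative f (at a) b"
proof
  define g where "g b x = integral {0..1} (\<lambda>t. t ^ 0 * frechet_derivative f (at (a + t *\<^sub>R (x - a))) b)" for b x
  show "smooth_on (ball a r) (g b)" for b
    unfolding g_def by (intro smooth_on_radial_integral smooth_on_frechet_derivative f)
  show "g b a = frechet_derivative f (at a) b" for b
    by (simp add: g_def)
  fix x assume x: "x \<in> ball a r"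
  let ?c = "\<lambda>t. a + t *\<^sub>R (x - a)"
  note in_ball = segment_in_ball[OF x]
  have cont: "continuous_on {0..1} (\<lambda>t. frechet_derivative f (at (?c t)) b)" for b
    by (intro continuous_on_compose2[OF smooth_on_continuous_on[OF smooth_on_frechet_derivative[OF f]]])
      (use in_ball in \<open>auto intro!: continuous_intros\<close>)
  have "((\<lambda>t. frechet_derivative f (at (?c t)) (x - a)) has_integral f (?c 1) - f (?c 0)) {0..1}"
  proof (rule fundamental_theorem_of_calculus)
    fix t :: real assume t: "t \<in> {0..1}"
    have "(?c has_derivative (\<lambda>s. s *\<^sub>R (x - a))) (at t within {0..1})"
      by (auto intro!: derivative_eq_intros)
    then have "((\<lambda>t. f (?c t)) has_derivative (\<lambda>s. frechet_derivative f (at (?c t)) (s *\<^sub>R (x - a))))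
        (at t within {0..1})"
      by (rule has_derivative_compose) (use smooth_on_has_derivative[OF f in_ball[OF t]] in auto)
    then show "((\<lambda>t. f (?c t)) has_vector_derivative frechet_derivative f (at (?c t)) (x - a)) (at t within {0..1})"
      using smooth_on_has_derivative[OF f in_ball[OF t], THEN has_derivative_linear]
      by (simp add: has_vector_derivative_def linear_scale)
  qed simp
  moreover have "((\<lambda>t. frechet_derivative f (at (?c t)) (x - a))
      has_integral (\<Sum>b\<in>Basis. ((x - a) \<bullet> b) * g b x)) {0..1}"
  proof (rule has_integral_eq)
    show "(\<Sum>b\<in>Basis. ((x - a) \<bullet> b) *\<^sub>R frechet_derivative f (at (?c t)) b) = frechet_derivative f (at (?c t)) (x - a)"
      if "t \<in> {0..1}" for t
      using frechet_derivative_euclidean[OF smooth_on_differentiable[OF f in_ball[OF that]]] by metis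
    have "((\<lambda>t. frechet_derivative f (at (?c t)) b) has_integral g b x) {0..1}" for b
      unfolding g_def using cont[of b] by (simp add: integrable_continuous_real integrable_integral)
    then show "((\<lambda>t. \<Sum>b\<in>Basis. ((x - a) \<bullet> b) *\<^sub>R frechet_derivative f (at (?c t)) b)
        has_integral (\<Sum>b\<in>Basis. ((x - a) \<bullet> b) * g b x)) {0..1}"
      by (intro has_integral_sum) (auto intro!: has_integral_mult_right)
  qed
  ultimately have "f (?c 1) - f (?c 0) = (\<Sum>b\<in>Basis. ((x - a) \<bullet> b) * g b x)"
    by (rule has_integral_unique)
  then show "f x = f a + (\<Sum>b\<in>Basis. ((x - a) \<bullet> b) * g b x)"
    by simp
qed

subsection \<open>Bump functions\<close>

text \<open>\<open>flat 0\<close> is the classical smooth function that is flat at 0. The powers of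
  \<open>inverse t\<close> are included because they arise as factors of its derivatives.\<close>

definition flat :: "nat \<Rightarrow> real \<Rightarrow> real" where
  "flat n t = (if t > 0 then inverse t ^ n * exp (- inverse t) else 0)"

lemma flat_tendsto_0: "(flat n \<longlongrightarrow> 0) (at_right 0)"
proof -
  have "((\<lambda>t. inverse t ^ n / exp (inverse t)) \<longlongrightarrow> (0::real)) (at_right 0)"
    by (rule filterlim_compose[OF tendsto_power_div_exp_0 filterlim_inverse_at_top_right])
  then show ?thesis
    by (rule Lim_transform_eventually)
      (auto simp: flat_def exp_minus divide_inverse eventually_at_right_less intro: eventually_mono[OF eventually_at_right_less])
qed

lemma flat_has_derivative:
  "(flat n has_real_derivative flat (n + 2) t - real n * flat (n + 1) t) (at t)"
proof -
  consider "t > 0" | "t < 0" | "t = 0" by linarith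
  then show ?thesis
  proof cases
    case 1
    have "((\<lambda>t. inverse t ^ n * exp (- inverse t)) has_real_derivative
        flat (n + 2) t - real n * flat (n + 1) t) (at t)"
      using 1 apply (auto intro!: derivative_eq_intros simp: flat_def)
      by (cases n) (auto simp: field_simps power2_eq_square)
    then show ?thesis
      by (rule has_field_derivative_transform_within_open[of _ _ _ "{0<..}"]) (use 1 in \<open>auto simp: flat_def\<close>)
  next
    case 2
    have "((\<lambda>t. 0) has_real_derivative flat (n + 2) t - real n * flat (n + 1) t) (at t)"
      using 2 by (auto simp: flat_def)
    then show ?thesis
      by (rule has_field_derivative_transform_within_open[of _ _ _ "{..<0}"]) (use 2 in \<open>auto simp: flat_def\<close>)
  next
    case 3
    have "((\<lambda>y. flat n y / y) \<longlongrightarrow> 0) (at_left 0)"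
      by (rule tendsto_eventually) (auto simp: flat_def eventually_at_filter)
    \<comment> \<open>On the right the difference quotient at 0 is \<open>flat (Suc n)\<close>,
      again a member of the family.\<close>
    moreover have "((\<lambda>y. flat n y / y) \<longlongrightarrow> 0) (at_right 0)"
      by (rule Lim_transform_eventually[OF flat_tendsto_0[of "Suc n"]])
        (auto simp: flat_def divide_inverse eventually_at_filter)
    ultimately have "((\<lambda>y. flat n y / y) \<longlongrightarrow> 0) (at 0)"
      by (rule filterlim_split_at)
    then show ?thesis using 3
      by (simp add: has_field_derivative_iff flat_def)
  qed
qed

lemma smooth_on_flat: "smooth_on UNIV (flat n)"
  unfolding smooth_on_def
proof
  fix k show "Ck_on k UNIV (flat n)"
  proof (induction k arbitrary: n)
    case 0
    then show ?case using flat_has_derivative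
      by (metis Ck_on.simps(1) DERIV_isCont continuous_at_imp_continuous_on)
  next
    case (Suc k)
    have d: "(flat n has_derivative (*) (flat (n + 2) t - real n * flat (n + 1) t)) (at t)" for t
      using flat_has_derivative has_field_derivative_def by blast
    have "Ck_on k UNIV (\<lambda>t. (flat (n + 2) t + (- real n) * flat (n + 1) t) * v)" for v
      by (intro Ck_on_mult Ck_on_add Ck_on_const Suc.IH) auto
    then show ?case
      by (intro Ck_on_SucI[OF _ d]) (auto simp: algebra_simps)
  qed
qed

lemma bump_function:
  fixes a :: "'e::euclidean_space"
  assumes "r > 0"
  obtains \<psi> :: "'e \<Rightarrow> real" and r' where "smooth_on UNIV \<psi>" "0 < r'"
    "\<And>x. x \<in> ball a r' \<Longrightarrow> \<psi> x = 1" "\<And>x. x \<notin> ball a r \<Longrightarrow> \<psi> x = 0"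
proof -
  \<comment> \<open>\<open>f\<close> vanishes on the ball of radius \<open>r/2\<close> and is at
    least \<open>c\<close>, its value at distance \<open>r\<close>, off the ball of radius
    \<open>r\<close>. Thus \<open>flat 0 (c - f x)\<close> is constant on the former and zero off
    the latter.\<close>
  define f where "f x = flat 0 ((x - a) \<bullet> (x - a) - (r/2)\<^sup>2)" for x :: 'e
  define c where "c = flat 0 (r\<^sup>2 - (r/2)\<^sup>2)"
  define \<psi> where "\<psi> x = inverse (flat 0 c) * flat 0 (c - f x)" for x :: 'e
  have mono: "flat 0 s \<le> flat 0 t" if "s \<le> t" for s t
    using that by (auto simp: flat_def le_imp_inverse_le)
  have "r\<^sup>2 - (r/2)\<^sup>2 > 0" using assms by (simp add: power2_eq_square)
  then have c: "c > 0" by (simp add: c_def flat_def)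
  have aff: "smooth_on UNIV (\<lambda>x::'e. x - a)"
    using smooth_on_add[OF _ smooth_on_bounded_linear[OF bounded_linear_ident] smooth_on_const[of UNIV "-a"]] by simp
  have "smooth_on UNIV (\<lambda>x::'e. (x - a) \<bullet> (x - a) + - (r/2)\<^sup>2)"
    by (intro smooth_on_add smooth_on_inner aff smooth_on_const) auto
  then have "smooth_on UNIV f"
    unfolding f_def by (intro smooth_on_compose[OF _ _ _ smooth_on_flat]) auto
  then have "smooth_on UNIV (\<lambda>x. c + (-1) * f x)"
    by (intro smooth_on_add smooth_on_mult smooth_on_const) auto
  then have "smooth_on UNIV \<psi>"
    unfolding \<psi>_def by (intro smooth_on_mult smooth_on_const smooth_on_compose[OF _ _ _ smooth_on_flat]) auto
  moreover have "\<psi> x = 1" if "x \<in> ball a (r/2)" for x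
  proof -
    have "norm (x - a) \<le> r/2" using that by (simp add: dist_norm norm_minus_commute)
    then have "(norm (x - a))\<^sup>2 \<le> (r/2)\<^sup>2" by (rule power_mono) simp
    then have "f x = 0" by (simp add: f_def flat_def dot_square_norm)
    then show ?thesis using c by (simp add: \<psi>_def flat_def)
  qed
  moreover have "\<psi> x = 0" if "x \<notin> ball a r" for x
  proof -
    have "r \<le> norm (x - a)" using that by (simp add: dist_norm norm_minus_commute)
    then have "r\<^sup>2 \<le> (norm (x - a))\<^sup>2" by (rule power_mono) (use assms in simp)
    then have "c \<le> f x" unfolding c_def f_def by (intro mono) (simp add: dot_square_norm)
    then show ?thesis by (simp add: \<psi>_def flat_def)
  qed
  ultimately show ?thesis using that[of \<psi> "r/2"] assms by simp
qed

section \<open>Atlases without topology\<close>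

text \<open>Charts without a topology on the carrier, so that the base and the slit tangent bundle
  are both instances.\<close>

locale atlas =
  fixes A :: "('a, 'e::euclidean_space) chart set"
  assumes inj_chart: "(U, \<phi>) \<in> A \<Longrightarrow> inj_on \<phi> U"
    and open_overlap: "(U, \<phi>) \<in> A \<Longrightarrow> (V, \<psi>) \<in> A \<Longrightarrow> open (\<phi> ` (U \<inter> V))"
    and smooth_transition: "(U, \<phi>) \<in> A \<Longrightarrow> (V, \<psi>) \<in> A \<Longrightarrow> smooth_on (\<phi> ` (U \<inter> V)) (\<psi> \<circ> inv_into U \<phi>)"
begin

lemma open_chart: "(U, \<phi>) \<in> A \<Longrightarrow> open (\<phi> ` U)"
  using open_overlap[of U \<phi> U \<phi>] by simp

lemma inv_chart: "(U, \<phi>) \<in> A \<Longrightarrow> p \<in> U \<Longrightarrow> inv_into U \<phi> (\<phi> p) = p"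
  using inj_chart inv_into_f_f by metis

lemma points_chart: "p \<in> points A \<Longrightarrow> \<exists>U \<phi>. (U, \<phi>) \<in> A \<and> p \<in> U"
  by (auto simp: points_def)

lemma chart_points: "(U, \<phi>) \<in> A \<Longrightarrow> p \<in> U \<Longrightarrow> p \<in> points A"
  by (auto simp: points_def)

text \<open>The neighbourhood filter of \<open>p\<close>, transported back from the charts. The
  supremum avoids choosing a chart. The values of \<open>inv_into\<close> outside the image of a
  chart are irrelevant, because chart images are open.\<close>

definition nearby :: "'a \<Rightarrow> 'a filter" where
  "nearby p = (SUP c\<in>{c\<in>A. p \<in> fst c}. filtermap (inv_into (fst c) (snd c)) (nhds (snd c p)))"

text \<open>Transition maps are continuous on open overlaps, so a property valid near
  \<open>p\<close> in one chart is carried over to every other.\<close>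

lemma eventually_nearby:
  assumes c: "(U, \<phi>) \<in> A" "p \<in> U"
  shows "eventually Q (nearby p) \<longleftrightarrow> (\<forall>\<^sub>F x in nhds (\<phi> p). Q (inv_into U \<phi> x))"
proof
  assume "eventually Q (nearby p)"
  then show "\<forall>\<^sub>F x in nhds (\<phi> p). Q (inv_into U \<phi> x)"
    using c unfolding nearby_def eventually_Sup by (force simp: eventually_filtermap)
next
  assume Q: "\<forall>\<^sub>F x in nhds (\<phi> p). Q (inv_into U \<phi> x)"
  have "\<forall>\<^sub>F y in nhds (\<psi> p). Q (inv_into V \<psi> y)" if d: "(V, \<psi>) \<in> A" "p \<in> V" for V \<psi>
  proof -
    let ?\<tau> = "\<phi> \<circ> inv_into V \<psi>" and ?N = "\<psi> ` (V \<inter> U)"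
    have N: "open ?N" "\<psi> p \<in> ?N" using open_overlap[OF d(1) c(1)] c d by auto
    have "continuous_on ?N ?\<tau>" using smooth_transition[OF d(1) c(1)] smooth_on_continuous_on by blast
    then have "isCont ?\<tau> (\<psi> p)" using continuous_on_eq_continuous_at[OF N(1)] N(2) by blast
    then have "(?\<tau> \<longlongrightarrow> ?\<tau> (\<psi> p)) (nhds (\<psi> p))"
      by (simp only: isCont_def tendsto_at_iff_tendsto_nhds)
    then have "(?\<tau> \<longlongrightarrow> \<phi> p) (nhds (\<psi> p))" using inv_chart[OF d] by simp
    then have "\<forall>\<^sub>F y in nhds (\<psi> p). Q (inv_into U \<phi> (?\<tau> y))"
      using Q by (rule eventually_compose_filterlim[rotated])
    moreover have "\<forall>\<^sub>F y in nhds (\<psi> p). y \<in> ?N" using N eventually_nhds_in_open by blast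
    ultimately show ?thesis
    proof eventually_elim
      case (elim y)
      then obtain q where "q \<in> V" "q \<in> U" "y = \<psi> q" by auto
      with elim inv_chart[OF d(1)] inv_chart[OF c(1)] show ?case by simp
    qed
  qed
  then show "eventually Q (nearby p)"
    unfolding nearby_def eventually_Sup by (auto simp: eventually_filtermap)
qed

lemma nearby_self: "eventually Q (nearby p) \<Longrightarrow> p \<in> points A \<Longrightarrow> Q p"
  using points_chart eventually_nearby inv_chart by (metis eventually_nhds_x_imp_x)

lemma nearby_chart: "(U, \<phi>) \<in> A \<Longrightarrow> p \<in> U \<Longrightarrow> \<forall>\<^sub>F q in nearby p. q \<in> U"
proof -
  assume c: "(U, \<phi>) \<in> A" "p \<in> U"
  then have "\<forall>\<^sub>F x in nhds (\<phi> p). x \<in> \<phi> ` U" using open_chart[OF c(1)] eventually_nhds_in_open by blast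
  then show ?thesis unfolding eventually_nearby[OF c]
    by eventually_elim (rule inv_into_into)
qed

lemma nearby_points: "p \<in> points A \<Longrightarrow> \<forall>\<^sub>F q in nearby p. q \<in> points A"
  using points_chart nearby_chart chart_points by (metis (mono_tags, lifting) eventually_mono)

lemma nearby_open:
  assumes c: "(U, \<phi>) \<in> A" "p \<in> U" and N: "open N" "\<phi> p \<in> N"
  shows "\<forall>\<^sub>F q in nearby p. q \<in> U \<and> \<phi> q \<in> N"
proof -
  have "\<forall>\<^sub>F x in nhds (\<phi> p). x \<in> N \<inter> \<phi> ` U"
    using open_chart[OF c(1)] N c by (intro eventually_nhds_in_open) auto
  then show ?thesis unfolding eventually_nearby[OF c]
    by eventually_elim (auto simp: inv_chart[OF c(1)])
qed

lemma nearby_openE: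
  assumes c: "(U, \<phi>) \<in> A" "p \<in> U" and Q: "eventually Q (nearby p)"
  obtains N where "open N" "\<phi> p \<in> N" "N \<subseteq> \<phi> ` U" "\<And>x. x \<in> N \<Longrightarrow> Q (inv_into U \<phi> x)"
proof -
  have "\<forall>\<^sub>F x in nhds (\<phi> p). x \<in> \<phi> ` U"
    using open_chart[OF c(1)] c by (intro eventually_nhds_in_open) auto
  with Q have "\<forall>\<^sub>F x in nhds (\<phi> p). Q (inv_into U \<phi> x) \<and> x \<in> \<phi> ` U"
    unfolding eventually_nearby[OF c] by (rule eventually_conj)
  then show ?thesis using that unfolding eventually_nhds by blast
qed

text \<open>\<open>smooth_at\<close> is existential in the chart; composing with the smooth
  transition map makes every chart around \<open>p\<close> available.\<close>

lemma smooth_at_chartE: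
  assumes c: "(U, \<phi>) \<in> A" "p \<in> U" and f: "smooth_at A f p"
  obtains N where "open N" "\<phi> p \<in> N" "N \<subseteq> \<phi> ` U" "smooth_on N (f \<circ> inv_into U \<phi>)"
proof -
  obtain V \<psi> W where d: "(V, \<psi>) \<in> A" "p \<in> V"
    and W: "open W" "\<psi> p \<in> W" "W \<subseteq> \<psi> ` V" "smooth_on W (f \<circ> inv_into V \<psi>)"
    using f unfolding smooth_at_def by blast
  let ?\<tau> = "\<psi> \<circ> inv_into U \<phi>" and ?S = "\<phi> ` (U \<inter> V)"
  define N where "N = ?S \<inter> ?\<tau> -` W"
  have S: "open ?S" "smooth_on ?S ?\<tau>" using open_overlap[OF c(1) d(1)] smooth_transition[OF c(1) d(1)] by auto
  then have "open N" unfolding N_def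
    using smooth_on_continuous_on W(1) continuous_on_open_vimage[OF S(1)] by (metis Int_commute)
  moreover have "\<phi> p \<in> N" using c d W by (auto simp: N_def inv_chart[OF c])
  moreover have "N \<subseteq> \<phi> ` U" by (auto simp: N_def)
  moreover have "smooth_on N (f \<circ> inv_into U \<phi>)"
  proof (rule smooth_on_cong[OF \<open>open N\<close>])
    show "smooth_on N (\<lambda>x. (f \<circ> inv_into V \<psi>) (?\<tau> x))"
      by (rule smooth_on_compose[OF \<open>open N\<close> W(1) smooth_on_subset[OF S(2)] W(4)]) (auto simp: N_def)
    show "(f \<circ> inv_into V \<psi>) (?\<tau> x) = (f \<circ> inv_into U \<phi>) x" if "x \<in> N" for x
      using that by (auto simp: N_def inv_chart[OF c(1)] inv_chart[OF d(1)])
  qed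
  ultimately show ?thesis using that by blast
qed

lemma smooth_atI:
  assumes c: "(U, \<phi>) \<in> A" "p \<in> U" and h: "open N" "\<phi> p \<in> N" "smooth_on N h"
    and f: "\<forall>\<^sub>F q in nearby p. f q = h (\<phi> q)"
  shows "smooth_at A f p"
proof -
  obtain S where S: "open S" "\<phi> p \<in> S" "S \<subseteq> \<phi> ` U"
    "\<And>x. x \<in> S \<Longrightarrow> f (inv_into U \<phi> x) = h (\<phi> (inv_into U \<phi> x))"
    using nearby_openE[OF c f] by metis
  have "smooth_on (S \<inter> N) (f \<circ> inv_into U \<phi>)"
  proof (rule smooth_on_cong)
    show "smooth_on (S \<inter> N) h" by (rule smooth_on_subset[OF h(3)]) auto
    show "h x = (f \<circ> inv_into U \<phi>) x" if "x \<in> S \<inter> N" for x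
      using that S(3) S(4)[of x] f_inv_into_f[of x \<phi> U] by auto
  qed (use S h in auto)
  then show ?thesis unfolding smooth_at_def using c S h by blast
qed

lemma smooth_at_points: "smooth_at A f p \<Longrightarrow> p \<in> points A"
  unfolding smooth_at_def points_def by blast

lemma smooth_at_cong:
  assumes "smooth_at A f p" "\<forall>\<^sub>F q in nearby p. f q = g q"
  shows "smooth_at A g p"
proof -
  obtain U \<phi> where c: "(U, \<phi>) \<in> A" "p \<in> U" using smooth_at_points[OF assms(1)] points_chart by blast
  obtain N where N: "open N" "\<phi> p \<in> N" "smooth_on N (f \<circ> inv_into U \<phi>)"
    using smooth_at_chartE[OF c assms(1)] by metis
  show ?thesis
    by (rule smooth_atI[OF c N]) (use assms(2) nearby_chart[OF c] in eventually_elim, auto simp: inv_chart[OF c(1)])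
qed

lemma smooth_at_cong_iff: "\<forall>\<^sub>F q in nearby p. f q = g q \<Longrightarrow> smooth_at A f p \<longleftrightarrow> smooth_at A g p"
  using smooth_at_cong[of f p g] smooth_at_cong[of g p f] by (auto simp: eq_commute)

lemma smooth_at_nearby:
  assumes "smooth_at A f p"
  shows "\<forall>\<^sub>F q in nearby p. smooth_at A f q"
proof -
  obtain U \<phi> where c: "(U, \<phi>) \<in> A" "p \<in> U" using smooth_at_points[OF assms(1)] points_chart by blast
  obtain N where N: "open N" "\<phi> p \<in> N" "N \<subseteq> \<phi> ` U" "smooth_on N (f \<circ> inv_into U \<phi>)"
    using smooth_at_chartE[OF c assms(1)] by metis
  show ?thesis using nearby_open[OF c N(1,2)]
    by (rule eventually_mono) (use c N in \<open>auto simp: smooth_at_def\<close>)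
qed

lemma smooth_at_const: "p \<in> points A \<Longrightarrow> smooth_at A (\<lambda>q. c) p"
  using points_chart smooth_atI[of _ _ p UNIV "\<lambda>x. c" "\<lambda>q. c"] smooth_on_const by force

lemma smooth_at_combine:
  assumes "smooth_at A f p" "smooth_at A g p"
    and h: "\<And>W f g. open W \<Longrightarrow> smooth_on W f \<Longrightarrow> smooth_on W g \<Longrightarrow> smooth_on W (\<lambda>x :: 'e. h (f x) (g x))"
  shows "smooth_at A (\<lambda>q. h (f q) (g q)) p"
proof -
  obtain U \<phi> where c: "(U, \<phi>) \<in> A" "p \<in> U" using smooth_at_points[OF assms(1)] points_chart by blast
  obtain N where N: "open N" "\<phi> p \<in> N" "smooth_on N (f \<circ> inv_into U \<phi>)"
    using smooth_at_chartE[OF c assms(1)] by metis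
  obtain S where S: "open S" "\<phi> p \<in> S" "smooth_on S (g \<circ> inv_into U \<phi>)"
    using smooth_at_chartE[OF c assms(2)] by metis
  have "smooth_on (N \<inter> S) (\<lambda>x. h ((f \<circ> inv_into U \<phi>) x) ((g \<circ> inv_into U \<phi>) x))"
    using N S by (intro h open_Int smooth_on_subset[OF N(3)] smooth_on_subset[OF S(3)]) auto
  then show ?thesis
    by (rule smooth_atI[OF c, of "N \<inter> S", rotated 2])
      (use N S nearby_chart[OF c] in \<open>auto elim: eventually_mono simp: inv_chart[OF c(1)]\<close>)
qed

lemma smooth_at_add: "smooth_at A f p \<Longrightarrow> smooth_at A g p \<Longrightarrow> smooth_at A (\<lambda>q. f q + g q) p"
  by (rule smooth_at_combine[of f p g "(+)"]) (auto intro: smooth_on_add)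

lemma smooth_at_mult: "smooth_at A f p \<Longrightarrow> smooth_at A g p \<Longrightarrow> smooth_at A (\<lambda>q. f q * g q) p"
  by (rule smooth_at_combine[of f p g "(*)"]) (auto intro: smooth_on_mult)

lemma smooth_at_cmult: "smooth_at A f p \<Longrightarrow> smooth_at A (\<lambda>q. c * f q) p"
  using smooth_at_mult smooth_at_const smooth_at_points by blast

lemma smooth_at_minus: "smooth_at A f p \<Longrightarrow> smooth_at A (\<lambda>q. - f q) p"
  using smooth_at_cmult[of f p "-1"] by simp

lemma smooth_at_diff: "smooth_at A f p \<Longrightarrow> smooth_at A g p \<Longrightarrow> smooth_at A (\<lambda>q. f q - g q) p"
  using smooth_at_add[OF _ smooth_at_minus] by fastforce

lemma smooth_at_sum:
  assumes "p \<in> points A" "\<And>i. i \<in> I \<Longrightarrow> smooth_at A (f i) p"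
  shows "smooth_at A (\<lambda>q. \<Sum>i\<in>I. f i q) p"
  using assms(2)
  by (induction I rule: infinite_finite_induct) (auto intro: smooth_at_const assms(1) smooth_at_add)

lemma smooth_at_chart_compose:
  assumes "(U, \<phi>) \<in> A" "p \<in> U" "open N" "\<phi> p \<in> N" "smooth_on N h"
  shows "smooth_at A (\<lambda>q. h (\<phi> q)) p"
  by (rule smooth_atI[OF assms]) simp

lemma smooth_at_coordinate:
  assumes "(U, \<phi>) \<in> A" "p \<in> U"
  shows "smooth_at A (\<lambda>q. \<phi> q \<bullet> b) p"
  by (rule smooth_at_chart_compose[OF assms open_UNIV])
    (auto intro: smooth_on_bounded_linear bounded_linear_inner_left)

subsection \<open>Derivations\<close>

lemma tangent_add: "v \<in> tangent_space A p \<Longrightarrow> smooth_at A f p \<Longrightarrow> smooth_at A g p \<Longrightarrow> v (\<lambda>x. f x + g x) = v f + v g"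
  and tangent_mult: "v \<in> tangent_space A p \<Longrightarrow> smooth_at A f p \<Longrightarrow> smooth_at A g p \<Longrightarrow>
    v (\<lambda>x. f x * g x) = f p * v g + g p * v f"
  and tangent_cmult: "v \<in> tangent_space A p \<Longrightarrow> smooth_at A f p \<Longrightarrow> v (\<lambda>x. c * f x) = c * v f"
  and tangent_undefined: "v \<in> tangent_space A p \<Longrightarrow> \<not> smooth_at A f p \<Longrightarrow> v f = 0"
  unfolding tangent_space_def by blast+

lemma tangentI:
  assumes "\<And>f g. smooth_at A f p \<Longrightarrow> smooth_at A g p \<Longrightarrow> v (\<lambda>x. f x + g x) = v f + v g"
    and "\<And>f g. smooth_at A f p \<Longrightarrow> smooth_at A g p \<Longrightarrow> v (\<lambda>x. f x * g x) = f p * v g + g p * v f"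
    and "\<And>c f. smooth_at A f p \<Longrightarrow> v (\<lambda>x. c * f x) = c * v f"
    and "\<And>f. \<not> smooth_at A f p \<Longrightarrow> v f = 0"
  shows "v \<in> tangent_space A p"
  using assms unfolding tangent_space_def by blast

lemma tangent_eqI:
  assumes "v \<in> tangent_space A p" "w \<in> tangent_space A p" "\<And>f. smooth_at A f p \<Longrightarrow> v f = w f"
  shows "v = w"
  using assms tangent_undefined by (metis ext)

lemma tangent_const: "v \<in> tangent_space A p \<Longrightarrow> v (\<lambda>x. c) = 0"
proof -
  assume v: "v \<in> tangent_space A p"
  show ?thesis
  proof (cases "p \<in> points A")
    case True
    have "v (\<lambda>x. 1 * 1) = 1 * v (\<lambda>x. 1) + 1 * v (\<lambda>x. 1)"
      by (rule tangent_mult[OF v]) (auto intro: smooth_at_const True)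
    then have "v (\<lambda>x. 1) = 0" by simp
    then show ?thesis using tangent_cmult[OF v smooth_at_const[OF True], of c 1] by simp
  qed (use v smooth_at_points tangent_undefined in blast)
qed

lemma tangent_minus: "v \<in> tangent_space A p \<Longrightarrow> smooth_at A f p \<Longrightarrow> v (\<lambda>x. - f x) = - v f"
  using tangent_cmult[of v p f "-1"] by simp

lemma tangent_diff:
  "v \<in> tangent_space A p \<Longrightarrow> smooth_at A f p \<Longrightarrow> smooth_at A g p \<Longrightarrow> v (\<lambda>x. f x - g x) = v f - v g"
  using tangent_add[of v p f "\<lambda>x. - g x"] smooth_at_minus[of g] tangent_minus[of v p g] by simp

lemma tangent_sum:
  assumes "v \<in> tangent_space A p" "p \<in> points A" "\<And>i. i \<in> I \<Longrightarrow> smooth_at A (f i) p"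
  shows "v (\<lambda>q. \<Sum>i\<in>I. f i q) = (\<Sum>i\<in>I. v (f i))"
  using assms(3)
proof (induction I rule: infinite_finite_induct)
  case (insert i I)
  then have "v (\<lambda>q. f i q + (\<Sum>i\<in>I. f i q)) = v (f i) + v (\<lambda>q. \<Sum>i\<in>I. f i q)"
    by (intro tangent_add[OF assms(1)] smooth_at_sum[OF assms(2)]) auto
  with insert show ?case by simp
qed (auto simp: tangent_const[OF assms(1)])

text \<open>The indicator \<open>h\<close> of the set where \<open>f\<close> and \<open>g\<close>
  agree is constant near \<open>p\<close>, hence smooth there, and \<open>h * (f - g)\<close> is
  identically zero. The Leibniz rule then leaves only \<open>v (f - g) = 0\<close>. No bump function
  is required, since functions smooth at \<open>p\<close> are unrestricted elsewhere.\<close>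

lemma tangent_cong:
  assumes v: "v \<in> tangent_space A p" and fg: "\<forall>\<^sub>F q in nearby p. f q = g q"
  shows "v f = v g"
proof (cases "smooth_at A f p")
  case False
  then have "\<not> smooth_at A g p" using smooth_at_cong_iff[OF fg] by simp
  with False show ?thesis using tangent_undefined[OF v] by simp
next
  case f: True
  then have g: "smooth_at A g p" and p: "p \<in> points A"
    using smooth_at_cong_iff[OF fg] smooth_at_points by auto
  define h where "h q = (if f q = g q then 1 else 0 :: real)" for q
  have "smooth_at A h p"
    by (rule smooth_at_cong[OF smooth_at_const[OF p, of 1]]) (use fg in \<open>auto simp: h_def elim: eventually_mono\<close>)
  then have "v (\<lambda>q. h q * (f q - g q)) = h p * v (\<lambda>q. f q - g q) + (f p - g p) * v h"
    by (rule tangent_mult[OF v _ smooth_at_diff[OF f g]])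
  moreover have "(\<lambda>q. h q * (f q - g q)) = (\<lambda>q. 0)" by (auto simp: h_def)
  moreover have "f p = g p" using nearby_self[OF fg p] .
  ultimately show ?thesis using tangent_const[OF v] tangent_diff[OF v f g] by (simp add: h_def)
qed

lemma tangent_space_zero: "0 \<in> tangent_space A p"
  and tangent_space_add: "v \<in> tangent_space A p \<Longrightarrow> w \<in> tangent_space A p \<Longrightarrow> v + w \<in> tangent_space A p"
  and tangent_space_scale: "v \<in> tangent_space A p \<Longrightarrow> c *\<^sub>t v \<in> tangent_space A p"
  and tangent_space_minus: "v \<in> tangent_space A p \<Longrightarrow> - v \<in> tangent_space A p"
  and tangent_space_diff: "v \<in> tangent_space A p \<Longrightarrow> w \<in> tangent_space A p \<Longrightarrow> v - w \<in> tangent_space A p"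
  by (auto simp: tangent_space_def scale_def algebra_simps)

lemma tangent_space_sum:
  "(\<And>i. i \<in> I \<Longrightarrow> v i \<in> tangent_space A p) \<Longrightarrow> (\<Sum>i\<in>I. v i) \<in> tangent_space A p"
  by (induction I rule: infinite_finite_induct) (auto intro: tangent_space_zero tangent_space_add)

subsection \<open>Coordinate vectors\<close>

definition cvec :: "'a set \<Rightarrow> ('a \<Rightarrow> 'e) \<Rightarrow> 'a \<Rightarrow> 'e \<Rightarrow> 'a tvec" where
  "cvec U \<phi> p y = (\<lambda>f. if smooth_at A f p then frechet_derivative (f \<circ> inv_into U \<phi>) (at (\<phi> p)) y else 0)"

definition comps :: "('a \<Rightarrow> 'e) \<Rightarrow> 'a tvec \<Rightarrow> 'e" where
  "comps \<phi> v = (\<Sum>b\<in>Basis. v (\<lambda>q. \<phi> q \<bullet> b) *\<^sub>R b)"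

context
  fixes U \<phi> p
  assumes c: "(U, \<phi>) \<in> A" "p \<in> U"
begin

lemma rep_has_derivative:
  assumes "smooth_at A f p"
  shows "(f \<circ> inv_into U \<phi> has_derivative frechet_derivative (f \<circ> inv_into U \<phi>) (at (\<phi> p))) (at (\<phi> p))"
  using smooth_at_chartE[OF c assms] smooth_on_has_derivative by metis

lemma frechet_rep_eqI:
  assumes "(h has_derivative h') (at (\<phi> p))" "\<forall>\<^sub>F q in nearby p. f q = h (\<phi> q)"
  shows "frechet_derivative (f \<circ> inv_into U \<phi>) (at (\<phi> p)) = h'"
proof -
  obtain N where N: "open N" "\<phi> p \<in> N" "N \<subseteq> \<phi> ` U"
    "\<And>x. x \<in> N \<Longrightarrow> f (inv_into U \<phi> x) = h (\<phi> (inv_into U \<phi> x))"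
    using nearby_openE[OF c assms(2)] by metis
  have "(f \<circ> inv_into U \<phi> has_derivative h') (at (\<phi> p))"
  proof (rule has_derivative_transform_within_open[OF assms(1) N(1,2)])
    fix x assume "x \<in> N"
    then show "h x = (f \<circ> inv_into U \<phi>) x" using N(3) N(4)[of x] f_inv_into_f[of x \<phi> U] by auto
  qed
  then show ?thesis using frechet_derivative_at by metis
qed

lemma cvec_eqI:
  assumes "smooth_at A f p" "(h has_derivative h') (at (\<phi> p))" "\<forall>\<^sub>F q in nearby p. f q = h (\<phi> q)"
  shows "cvec U \<phi> p y f = h' y"
  using frechet_rep_eqI[OF assms(2,3)] assms(1) by (simp add: cvec_def)

lemma cvec_tangent: "cvec U \<phi> p y \<in> tangent_space A p"
proof (rule tangentI)
  fix f g assume fg: "smooth_at A f p" "smooth_at A g p"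
  note d = rep_has_derivative[OF fg(1)] rep_has_derivative[OF fg(2)]
  have inv: "\<forall>\<^sub>F q in nearby p. inv_into U \<phi> (\<phi> q) = q"
    using nearby_chart[OF c] by eventually_elim (simp add: inv_chart[OF c(1)])
  show "cvec U \<phi> p y (\<lambda>x. f x + g x) = cvec U \<phi> p y f + cvec U \<phi> p y g"
    using fg inv by (subst cvec_eqI[OF smooth_at_add[OF fg] has_derivative_add[OF d]])
      (auto simp: cvec_def elim: eventually_mono)
  show "cvec U \<phi> p y (\<lambda>x. f x * g x) = f p * cvec U \<phi> p y g + g p * cvec U \<phi> p y f"
    using fg inv by (subst cvec_eqI[OF smooth_at_mult[OF fg] has_derivative_mult[OF d]])
      (auto simp: cvec_def inv_chart[OF c] elim: eventually_mono)
next
  fix k f assume f: "smooth_at A f p"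
  have inv: "\<forall>\<^sub>F q in nearby p. inv_into U \<phi> (\<phi> q) = q"
    using nearby_chart[OF c] by eventually_elim (simp add: inv_chart[OF c(1)])
  show "cvec U \<phi> p y (\<lambda>x. k * f x) = k * cvec U \<phi> p y f"
    using f inv by (subst cvec_eqI[OF smooth_at_cmult[OF f] has_derivative_mult_right[OF rep_has_derivative[OF f]]])
      (auto simp: cvec_def elim: eventually_mono)
qed (simp add: cvec_def)

lemma comps_inner: "b \<in> Basis \<Longrightarrow> comps \<phi> v \<bullet> b = v (\<lambda>q. \<phi> q \<bullet> b)"
  by (simp add: comps_def inner_sum_left inner_Basis if_distrib cong: if_cong)

lemma cvec_coordinate: "cvec U \<phi> p y (\<lambda>q. \<phi> q \<bullet> b) = y \<bullet> b"
  by (rule cvec_eqI[OF smooth_at_coordinate[OF c]]) (auto intro!: derivative_eq_intros)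

lemma comps_cvec: "comps \<phi> (cvec U \<phi> p y) = y"
  by (simp add: comps_def cvec_coordinate euclidean_representation)

lemma cvec_linear: "smooth_at A f p \<Longrightarrow> linear (\<lambda>y. cvec U \<phi> p y f)"
  using has_derivative_linear[OF rep_has_derivative] by (simp add: cvec_def)

text \<open>Hadamard's lemma writes \<open>f\<close> near \<open>p\<close> as a constant plus
  products of coordinate differences, which vanish at \<open>p\<close>, with smooth functions. By
  the Leibniz rule only the values of these functions at \<open>p\<close> survive, and they are the
  partial derivatives of \<open>f\<close>.\<close>

lemma tangent_expand:
  assumes v: "v \<in> tangent_space A p" and f: "smooth_at A f p"
  shows "v f = (\<Sum>b\<in>Basis. v (\<lambda>q. \<phi> q \<bullet> b) * cvec U \<phi> p b f)"
proof -
  let ?f = "f \<circ> inv_into U \<phi>" and ?a = "\<phi> p"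
  obtain N where N: "open N" "?a \<in> N" "smooth_on N ?f"
    using smooth_at_chartE[OF c f] by metis
  then obtain r where r: "r > 0" "ball ?a r \<subseteq> N" using open_contains_ball by blast
  obtain g where g: "\<And>b. b \<in> Basis \<Longrightarrow> smooth_on (ball ?a r) (g b)"
    "\<And>x. x \<in> ball ?a r \<Longrightarrow> ?f x = ?f ?a + (\<Sum>b\<in>Basis. ((x - ?a) \<bullet> b) * g b x)"
    "\<And>b. b \<in> Basis \<Longrightarrow> g b ?a = frechet_derivative ?f (at ?a) b"
  proof (rule hadamard[OF smooth_on_subset[OF N(3) r(2)]])
    fix g assume "\<And>b. b \<in> Basis \<Longrightarrow> smooth_on (ball ?a r) (g b)"
      "\<And>x. x \<in> ball ?a r \<Longrightarrow> ?f x = ?f ?a + (\<Sum>b\<in>Basis. ((x - ?a) \<bullet> b) * g b x)"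
      "\<And>b. b \<in> Basis \<Longrightarrow> g b ?a = frechet_derivative ?f (at ?a) b"
    then show thesis by (rule that)
  qed
  have p: "p \<in> points A" using c chart_points by blast
  have sg: "smooth_at A (\<lambda>q. g b (\<phi> q)) p" if "b \<in> Basis" for b
    by (rule smooth_at_chart_compose[OF c open_ball _ g(1)[OF that]]) (use r in auto)
  have sc: "smooth_at A (\<lambda>q. \<phi> q \<bullet> b - ?a \<bullet> b) p" for b
    by (intro smooth_at_diff smooth_at_coordinate[OF c] smooth_at_const[OF p])
  have "\<forall>\<^sub>F q in nearby p. f q = ?f ?a + (\<Sum>b\<in>Basis. (\<phi> q \<bullet> b - ?a \<bullet> b) * g b (\<phi> q))"
  proof (rule eventually_mono[OF nearby_open[OF c open_ball, of ?a r]])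
    show "?a \<in> ball ?a r" using r by simp
    fix q assume q: "q \<in> U \<and> \<phi> q \<in> ball ?a r"
    then have "?f (\<phi> q) = f q" by (simp add: inv_chart[OF c(1)])
    then show "f q = ?f ?a + (\<Sum>b\<in>Basis. (\<phi> q \<bullet> b - ?a \<bullet> b) * g b (\<phi> q))"
      using g(2)[of "\<phi> q"] q by (simp only: inner_diff_left)
  qed
  then have "v f = v (\<lambda>q. ?f ?a + (\<Sum>b\<in>Basis. (\<phi> q \<bullet> b - ?a \<bullet> b) * g b (\<phi> q)))"
    by (rule tangent_cong[OF v])
  also have "\<dots> = v (\<lambda>q. ?f ?a) + v (\<lambda>q. \<Sum>b\<in>Basis. (\<phi> q \<bullet> b - ?a \<bullet> b) * g b (\<phi> q))"
    by (intro tangent_add[OF v] smooth_at_const[OF p] smooth_at_sum[OF p] smooth_at_mult sc sg)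
  also have "\<dots> = (\<Sum>b\<in>Basis. v (\<lambda>q. (\<phi> q \<bullet> b - ?a \<bullet> b) * g b (\<phi> q)))"
    by (simp add: tangent_const[OF v] tangent_sum[OF v p] smooth_at_mult sc sg)
  also have "\<dots> = (\<Sum>b\<in>Basis. v (\<lambda>q. \<phi> q \<bullet> b) * cvec U \<phi> p b f)"
  proof (rule sum.cong[OF refl])
    fix b :: 'e assume b: "b \<in> Basis"
    have "v (\<lambda>q. (\<phi> q \<bullet> b - ?a \<bullet> b) * g b (\<phi> q)) = g b ?a * v (\<lambda>q. \<phi> q \<bullet> b - ?a \<bullet> b)"
      using tangent_mult[OF v sc sg[OF b]] by simp
    also have "v (\<lambda>q. \<phi> q \<bullet> b - ?a \<bullet> b) = v (\<lambda>q. \<phi> q \<bullet> b)"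
      using tangent_diff[OF v smooth_at_coordinate[OF c] smooth_at_const[OF p]] tangent_const[OF v] by simp
    finally show "v (\<lambda>q. (\<phi> q \<bullet> b - ?a \<bullet> b) * g b (\<phi> q)) = v (\<lambda>q. \<phi> q \<bullet> b) * cvec U \<phi> p b f"
      using g(3)[OF b] f by (simp add: cvec_def)
  qed
  finally show ?thesis .
qed

lemma cvec_comps: "v \<in> tangent_space A p \<Longrightarrow> cvec U \<phi> p (comps \<phi> v) = v"
proof (rule tangent_eqI[OF cvec_tangent])
  fix f assume v: "v \<in> tangent_space A p" and f: "smooth_at A f p"
  interpret linear "\<lambda>y. cvec U \<phi> p y f" by (rule cvec_linear[OF f])
  show "cvec U \<phi> p (comps \<phi> v) f = v f"
    unfolding tangent_expand[OF v f] comps_def by (simp add: sum scaleR)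
qed

lemma cvec_add: "cvec U \<phi> p (x + y) = cvec U \<phi> p x + cvec U \<phi> p y"
  and cvec_scaleR: "cvec U \<phi> p (k *\<^sub>R x) = k *\<^sub>t cvec U \<phi> p x"
  using cvec_linear by (auto simp: fun_eq_iff scale_def linear_add linear_scale cvec_def)

lemma cvec_zero: "cvec U \<phi> p 0 = 0"
  using cvec_linear by (auto simp: fun_eq_iff linear_0 cvec_def)

lemma comps_add: "comps \<phi> (v + w) = comps \<phi> v + comps \<phi> w"
  and comps_scale: "comps \<phi> (k *\<^sub>t v) = k *\<^sub>R comps \<phi> v"
  and comps_zero: "comps \<phi> 0 = 0"
  by (simp_all add: comps_def scale_def sum.distrib algebra_simps scaleR_sum_right)

lemma comps_eq_zero_iff: "v \<in> tangent_space A p \<Longrightarrow> comps \<phi> v = 0 \<longleftrightarrow> v = 0"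
  using cvec_comps cvec_zero comps_zero by metis

end

lemma smooth_at_cvec:
  assumes c: "(U, \<phi>) \<in> A" "p \<in> U" and f: "smooth_at A f p"
  shows "smooth_at A (\<lambda>q. cvec U \<phi> q y f) p"
proof -
  obtain N where N: "open N" "\<phi> p \<in> N" "N \<subseteq> \<phi> ` U" "smooth_on N (f \<circ> inv_into U \<phi>)"
    using smooth_at_chartE[OF c f] by metis
  show ?thesis
    by (rule smooth_atI[OF c N(1,2) smooth_on_frechet_derivative[OF N(4), of y]])
      (use smooth_at_nearby[OF f] in \<open>auto elim: eventually_mono simp: cvec_def\<close>)
qed

end

context atlas
begin

subsection \<open>Vector fields\<close>

lemma vector_field_tangent: "B \<in> vector_fields A \<Longrightarrow> p \<in> points A \<Longrightarrow> B p \<in> tangent_space A p"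
  and vector_field_smooth: "B \<in> vector_fields A \<Longrightarrow> smooth_at A f p \<Longrightarrow> smooth_at A (\<lambda>q. B q f) p"
  using smooth_at_points by (auto simp: vector_fields_def)

lemma vector_fieldI:
  "(\<And>p. p \<in> points A \<Longrightarrow> B p \<in> tangent_space A p) \<Longrightarrow>
   (\<And>p f. smooth_at A f p \<Longrightarrow> smooth_at A (\<lambda>q. B q f) p) \<Longrightarrow> B \<in> vector_fields A"
  by (auto simp: vector_fields_def)

lemma vector_fields_zero: "0 \<in> vector_fields A"
  and vector_fields_add: "B \<in> vector_fields A \<Longrightarrow> C \<in> vector_fields A \<Longrightarrow> B + C \<in> vector_fields A"
  and vector_fields_minus: "B \<in> vector_fields A \<Longrightarrow> - B \<in> vector_fields A"
  by (auto simp: vector_fields_def intro: tangent_space_add tangent_space_zero tangent_space_minus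
      smooth_at_add smooth_at_minus smooth_at_const)

lemma vector_fields_diff: "B \<in> vector_fields A \<Longrightarrow> C \<in> vector_fields A \<Longrightarrow> B - C \<in> vector_fields A"
  using vector_fields_add[OF _ vector_fields_minus] by fastforce

lemma lie_bracket_vector_fields:
  assumes B: "B \<in> vector_fields A" and C: "C \<in> vector_fields A"
  shows "lie_bracket A B C \<in> vector_fields A"
proof (rule vector_fieldI)
  fix p assume p: "p \<in> points A"
  note Bp = vector_field_tangent[OF B p] and Cp = vector_field_tangent[OF C p]
  note BS = vector_field_smooth[OF B] and CS = vector_field_smooth[OF C]
  \<comment> \<open>The terms that mix a derivative of \<open>f\<close> with one of \<open>g\<close>
    are symmetric in the two vector fields; they spoil the Leibniz rule for the composite and cancel
    in the bracket.\<close>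
  have expand: "b (\<lambda>q. E q (\<lambda>x. f x * g x)) = f p * b (\<lambda>q. E q g) + E p g * b f + (g p * b (\<lambda>q. E q f) + E p f * b g)"
    if "smooth_at A f p" "smooth_at A g p" and b: "b \<in> tangent_space A p" and E: "E \<in> vector_fields A" for f g b E
  proof -
    have "\<forall>\<^sub>F q in nearby p. E q (\<lambda>x. f x * g x) = f q * E q g + g q * E q f"
      using smooth_at_nearby[OF that(1)] smooth_at_nearby[OF that(2)] nearby_points[OF p]
      by eventually_elim (rule tangent_mult[OF vector_field_tangent[OF E]])
    then have "b (\<lambda>q. E q (\<lambda>x. f x * g x)) = b (\<lambda>q. f q * E q g + g q * E q f)"
      by (rule tangent_cong[OF b])
    then show ?thesis
      using that by (simp add: tangent_add[OF b] tangent_mult[OF b] smooth_at_mult vector_field_smooth[OF E])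
  qed
  have add: "b (\<lambda>q. E q (\<lambda>x. f x + g x)) = b (\<lambda>q. E q f) + b (\<lambda>q. E q g)"
    if "smooth_at A f p" "smooth_at A g p" and b: "b \<in> tangent_space A p" and E: "E \<in> vector_fields A" for f g b E
  proof -
    have "\<forall>\<^sub>F q in nearby p. E q (\<lambda>x. f x + g x) = E q f + E q g"
      using smooth_at_nearby[OF that(1)] smooth_at_nearby[OF that(2)] nearby_points[OF p]
      by eventually_elim (rule tangent_add[OF vector_field_tangent[OF E]])
    then have "b (\<lambda>q. E q (\<lambda>x. f x + g x)) = b (\<lambda>q. E q f + E q g)"
      by (rule tangent_cong[OF b])
    then show ?thesis
      using that by (simp add: tangent_add[OF b] vector_field_smooth[OF E])
  qed
  have cmult: "b (\<lambda>q. E q (\<lambda>x. k * f x)) = k * b (\<lambda>q. E q f)"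
    if "smooth_at A f p" and b: "b \<in> tangent_space A p" and E: "E \<in> vector_fields A" for f b E k
  proof -
    have "\<forall>\<^sub>F q in nearby p. E q (\<lambda>x. k * f x) = k * E q f"
      using smooth_at_nearby[OF that(1)] nearby_points[OF p]
      by eventually_elim (rule tangent_cmult[OF vector_field_tangent[OF E]])
    then have "b (\<lambda>q. E q (\<lambda>x. k * f x)) = b (\<lambda>q. k * E q f)"
      by (rule tangent_cong[OF b])
    then show ?thesis
      using that by (simp add: tangent_cmult[OF b] vector_field_smooth[OF E])
  qed
  show "lie_bracket A B C p \<in> tangent_space A p"
    by (rule tangentI)
      (simp_all add: lie_bracket_def smooth_at_add smooth_at_mult smooth_at_cmult
        expand[OF _ _ Bp C] expand[OF _ _ Cp B] add[OF _ _ Bp C] add[OF _ _ Cp B] cmult[OF _ Bp C] cmult[OF _ Cp B]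
        algebra_simps)
next
  fix p f assume f: "smooth_at A f p"
  have "smooth_at A (\<lambda>q. B q (\<lambda>r. C r f) - C q (\<lambda>r. B r f)) p"
    by (intro smooth_at_diff vector_field_smooth[OF B] vector_field_smooth[OF C] f)
  then show "smooth_at A (\<lambda>q. lie_bracket A B C q f) p"
    by (rule smooth_at_cong)
      (use smooth_at_nearby[OF f] in \<open>auto simp: lie_bracket_def elim: eventually_mono\<close>)
qed

text \<open>The bracket is set to zero on functions that are not smooth at the point in question. As
  \<open>f\<close> is smooth near \<open>p\<close>, this convention does not affect the germ that
  \<open>a\<close> differentiates.\<close>

lemma tangent_lie_bracket:
  assumes a: "a \<in> tangent_space A p" and B: "B \<in> vector_fields A" and C: "C \<in> vector_fields A"
    and f: "smooth_at A f p"
  shows "a (\<lambda>q. lie_bracket A B C q f) = a (\<lambda>q. B q (\<lambda>r. C r f)) - a (\<lambda>q. C q (\<lambda>r. B r f))"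
proof -
  have "a (\<lambda>q. lie_bracket A B C q f) = a (\<lambda>q. B q (\<lambda>r. C r f) - C q (\<lambda>r. B r f))"
    by (rule tangent_cong[OF a])
      (use smooth_at_nearby[OF f] in \<open>auto simp: lie_bracket_def elim: eventually_mono\<close>)
  also have "\<dots> = a (\<lambda>q. B q (\<lambda>r. C r f)) - a (\<lambda>q. C q (\<lambda>r. B r f))"
    by (intro tangent_diff[OF a] vector_field_smooth[OF B] vector_field_smooth[OF C] f)
  finally show ?thesis .
qed

lemma jacobi:
  assumes B: "B \<in> vector_fields A" and C: "C \<in> vector_fields A" and E: "E \<in> vector_fields A"
    and p: "p \<in> points A"
  shows "lie_bracket A B (lie_bracket A C E) p =
    lie_bracket A (lie_bracket A B C) E p + lie_bracket A C (lie_bracket A B E) p"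
proof
  fix f
  show "lie_bracket A B (lie_bracket A C E) p f =
    (lie_bracket A (lie_bracket A B C) E p + lie_bracket A C (lie_bracket A B E) p) f"
  proof (cases "smooth_at A f p")
    case f: True
    note t = tangent_lie_bracket[OF vector_field_tangent[OF _ p] _ _ f]
    show ?thesis
      by (simp add: f lie_bracket_def[of A B "lie_bracket A C E"]
          lie_bracket_def[of A "lie_bracket A B C" E] lie_bracket_def[of A C "lie_bracket A B E"] t B C E)
        (simp add: lie_bracket_def vector_field_smooth[OF B f] vector_field_smooth[OF C f] vector_field_smooth[OF E f])
  qed (simp add: lie_bracket_def)
qed

lemma lie_bracket_add:
  assumes "B \<in> vector_fields A" "C \<in> vector_fields A" "E \<in> vector_fields A" "p \<in> points A"
  shows "lie_bracket A (B + C) E p = lie_bracket A B E p + lie_bracket A C E p"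
    and "lie_bracket A E (B + C) p = lie_bracket A E B p + lie_bracket A E C p"
proof -
  note t = tangent_add[OF vector_field_tangent[OF assms(1,4)]]
    tangent_add[OF vector_field_tangent[OF assms(2,4)]] tangent_add[OF vector_field_tangent[OF assms(3,4)]]
  show "lie_bracket A (B + C) E p = lie_bracket A B E p + lie_bracket A C E p"
    "lie_bracket A E (B + C) p = lie_bracket A E B p + lie_bracket A E C p"
    using assms by (auto simp: lie_bracket_def fun_eq_iff t vector_field_smooth)
qed

lemma lie_bracket_cong:
  assumes "\<And>q. q \<in> points A \<Longrightarrow> B q = B' q" "\<And>q. q \<in> points A \<Longrightarrow> C q = C' q"
    and B: "B \<in> vector_fields A" and C: "C \<in> vector_fields A" and p: "p \<in> points A"
  shows "lie_bracket A B C p = lie_bracket A B' C' p"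
proof
  fix f
  have "B p (\<lambda>q. C q f) = B p (\<lambda>q. C' q f)"
    by (rule tangent_cong[OF vector_field_tangent[OF B p]]) (use nearby_points[OF p] assms in \<open>auto elim: eventually_mono\<close>)
  moreover have "C p (\<lambda>q. B q f) = C p (\<lambda>q. B' q f)"
    by (rule tangent_cong[OF vector_field_tangent[OF C p]]) (use nearby_points[OF p] assms in \<open>auto elim: eventually_mono\<close>)
  ultimately show "lie_bracket A B C p f = lie_bracket A B' C' p f"
    using assms p by (simp add: lie_bracket_def)
qed

end

section \<open>The slit tangent bundle as a manifold\<close>

definition tdom :: "('m, 'e::euclidean_space) chart set \<Rightarrow> 'm set \<Rightarrow> 'm tb set" where
  "tdom \<A> U = {(p, v). p \<in> U \<and> v \<in> tangent_space \<A> p \<and> v \<noteq> 0}"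

definition tchart :: "('m \<Rightarrow> 'e::euclidean_space) \<Rightarrow> 'm tb \<Rightarrow> 'e \<times> 'e" where
  "tchart \<phi> = (\<lambda>(p, v). (\<phi> p, \<Sum>b\<in>Basis. v (\<lambda>q. \<phi> q \<bullet> b) *\<^sub>R b))"

lemma slit_tangent_bundle_alt: "\<T> \<A> = (\<lambda>(U, \<phi>). (tdom \<A> U, tchart \<phi>)) ` \<A>"
  unfolding slit_tangent_bundle_def tdom_def tchart_def by simp

locale base_atlas = atlas A for A :: "('m, 'e::euclidean_space) chart set"
begin

lemma tchart_apply: "tchart \<phi> (p, v) = (\<phi> p, comps \<phi> v)"
  by (simp add: tchart_def comps_def)

lemma fst_tchart: "fst (tchart \<phi> u) = \<phi> (fst u)"
  and snd_tchart: "snd (tchart \<phi> u) = comps \<phi> (snd u)"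
  using tchart_apply[of \<phi> "fst u" "snd u"] by auto

lemma tcharts: "(U, \<phi>) \<in> A \<Longrightarrow> (tdom A U, tchart \<phi>) \<in> \<T> A"
  by (force simp: slit_tangent_bundle_alt)

lemma tchartsE:
  assumes "(U', \<Phi>) \<in> \<T> A"
  obtains U \<phi> where "(U, \<phi>) \<in> A" "U' = tdom A U" "\<Phi> = tchart \<phi>"
  using assms by (force simp: slit_tangent_bundle_alt)

lemma tpoints: "u \<in> points (\<T> A) \<longleftrightarrow> fst u \<in> points A \<and> snd u \<in> tangent_space A (fst u) \<and> snd u \<noteq> 0"
  by (force simp: slit_tangent_bundle_alt points_def tdom_def)

lemma tdom_iff: "u \<in> tdom A U \<longleftrightarrow> fst u \<in> U \<and> snd u \<in> tangent_space A (fst u) \<and> snd u \<noteq> 0"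
  by (auto simp: tdom_def)

lemma image_tchart:
  assumes c: "(U, \<phi>) \<in> A" and S: "S \<subseteq> U"
  shows "tchart \<phi> ` tdom A S = \<phi> ` S \<times> (- {0} :: 'e set)"
proof (intro equalityI subsetI)
  fix z assume "z \<in> tchart \<phi> ` tdom A S"
  then show "z \<in> \<phi> ` S \<times> - {0}"
    using comps_eq_zero_iff[OF c] S by (auto simp: tdom_def tchart_apply)
next
  fix z assume "z \<in> \<phi> ` S \<times> (- {0} :: 'e set)"
  then obtain p y where z: "z = (\<phi> p, y)" "p \<in> S" "y \<noteq> 0" by auto
  then have p: "p \<in> U" using S by auto
  have "(p, cvec U \<phi> p y) \<in> tdom A S"
    using z p cvec_tangent[OF c] comps_cvec[OF c p, of y] comps_zero[OF c p] by (auto simp: tdom_def)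
  moreover have "tchart \<phi> (p, cvec U \<phi> p y) = z" using z p comps_cvec[OF c] by (simp add: tchart_apply)
  ultimately show "z \<in> tchart \<phi> ` tdom A S" by force
qed

lemma inj_tchart:
  assumes c: "(U, \<phi>) \<in> A"
  shows "inj_on (tchart \<phi>) (tdom A U)"
proof (rule inj_onI)
  fix u w assume uw: "u \<in> tdom A U" "w \<in> tdom A U" and eq: "tchart \<phi> u = tchart \<phi> w"
  then have "\<phi> (fst u) = \<phi> (fst w)" and c': "comps \<phi> (snd u) = comps \<phi> (snd w)"
    by (metis fst_tchart, metis snd_tchart)
  then have f: "fst u = fst w" using inj_chart[OF c] uw by (auto simp: tdom_iff dest: inj_onD)
  then have "snd u = snd w" using c' cvec_comps[OF c] uw by (metis tdom_iff)
  with f show "u = w" by (simp add: prod_eq_iff)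
qed

lemma inv_tchart:
  assumes c: "(U, \<phi>) \<in> A" and "p \<in> U" "y \<noteq> 0"
  shows "inv_into (tdom A U) (tchart \<phi>) (\<phi> p, y) = (p, cvec U \<phi> p y)"
proof (rule inv_into_f_eq[OF inj_tchart[OF c]])
  show "(p, cvec U \<phi> p y) \<in> tdom A U"
    using assms cvec_tangent[OF c] comps_cvec[OF c, of p y] comps_zero[OF c, of p] by (auto simp: tdom_def)
  show "tchart \<phi> (p, cvec U \<phi> p y) = (\<phi> p, y)" using assms comps_cvec[OF c] by (simp add: tchart_apply)
qed

lemma smooth_on_fst:
  fixes h :: "'e \<Rightarrow> 'f::real_normed_vector"
  assumes "open N" "smooth_on N h"
  shows "smooth_on (N \<times> (UNIV :: 'e set)) (\<lambda>z. h (fst z))"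
  by (rule smooth_on_compose[OF _ assms(1) _ assms(2)])
    (auto intro: open_Times assms smooth_on_bounded_linear bounded_linear_fst)

lemma smooth_on_snd_inner: "smooth_on N (\<lambda>z :: 'e \<times> 'e. snd z \<bullet> b)"
  by (rule smooth_on_bounded_linear)
    (rule bounded_linear_compose[OF bounded_linear_inner_left bounded_linear_snd])

text \<open>In bundle charts the transition sends \<open>(x, y)\<close> to the image of
  \<open>x\<close> under the base transition, paired with its Jacobian at \<open>x\<close> applied
  to \<open>y\<close>. The functions \<open>?h b c\<close> are the Jacobian entries and
  \<open>?F\<close> is the resulting map, smooth also where \<open>y = 0\<close>.\<close>

lemma smooth_on_transition_tchart:
  assumes c: "(U, \<phi>) \<in> A" and d: "(V, \<psi>) \<in> A"
  shows "smooth_on (\<phi> ` (U \<inter> V) \<times> - {0}) (tchart \<psi> \<circ> inv_into (tdom A U) (tchart \<phi>))"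
proof -
  let ?S = "\<phi> ` (U \<inter> V)" and ?\<tau> = "\<psi> \<circ> inv_into U \<phi>"
  let ?h = "\<lambda>b c x. frechet_derivative (\<lambda>x. ?\<tau> x \<bullet> b) (at x) c"
  let ?F = "\<lambda>z. (?\<tau> (fst z), \<Sum>b\<in>Basis. (\<Sum>c\<in>Basis. (snd z \<bullet> c) * ?h b c (fst z)) *\<^sub>R b)"
  have S: "open ?S" "smooth_on ?S ?\<tau>" using open_overlap[OF c d] smooth_transition[OF c d] by auto
  have op: "open (?S \<times> (UNIV::'e set))" using S open_Times by blast
  have s\<tau>: "smooth_on ?S (\<lambda>x. ?\<tau> x \<bullet> b)" for b
    by (intro smooth_on_inner S smooth_on_const)
  have sh: "smooth_on ?S (?h b c)" for b c
    by (rule smooth_on_frechet_derivative[OF s\<tau>])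
  have "smooth_on (?S \<times> UNIV) ?F"
    by (intro smooth_on_Pair op smooth_on_fst S smooth_on_sum smooth_on_scaleR smooth_on_mult
        smooth_on_snd_inner smooth_on_fst[OF S(1) sh] smooth_on_const)
  then have "smooth_on (?S \<times> - {0}) ?F" by (rule smooth_on_subset) auto
  then show ?thesis
  proof (rule smooth_on_cong[rotated 2])
    show "open (?S \<times> - {0::'e})" using S by (intro open_Times) auto
    fix z :: "'e \<times> 'e" assume "z \<in> ?S \<times> - {0}"
    then obtain p y where z: "z = (\<phi> p, y)" and p: "p \<in> U" "p \<in> V" and y: "y \<noteq> 0" by auto
    have "cvec U \<phi> p y (\<lambda>q. \<psi> q \<bullet> b) = (\<Sum>c\<in>Basis. (y \<bullet> c) * ?h b c (\<phi> p))" if "b \<in> Basis" for b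
    proof -
      have "smooth_at A (\<lambda>q. \<psi> q \<bullet> b) p" by (rule smooth_at_coordinate[OF d p(2)])
      moreover have "(\<lambda>x. ?\<tau> x \<bullet> b) differentiable (at (\<phi> p))"
        by (rule smooth_on_differentiable[OF s\<tau>]) (use p in auto)
      ultimately show ?thesis
        by (simp add: cvec_def o_def frechet_derivative_euclidean[of _ _ y])
    qed
    then show "?F z = (tchart \<psi> \<circ> inv_into (tdom A U) (tchart \<phi>)) z"
      using inv_tchart[OF c p(1) y] by (simp add: z tchart_apply comps_def inv_chart[OF c p(1)])
  qed
qed

sublocale T: atlas "\<T> A"
proof
  fix U' \<Phi> assume "(U', \<Phi>) \<in> \<T> A"
  then obtain U \<phi> where c: "(U, \<phi>) \<in> A" "U' = tdom A U" "\<Phi> = tchart \<phi>" by (rule tchartsE)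
  then show "inj_on \<Phi> U'" using inj_tchart by simp
  fix V' \<Psi> assume "(V', \<Psi>) \<in> \<T> A"
  then obtain V \<psi> where d: "(V, \<psi>) \<in> A" "V' = tdom A V" "\<Psi> = tchart \<psi>" by (rule tchartsE)
  have "U' \<inter> V' = tdom A (U \<inter> V)" using c d by (auto simp: tdom_def)
  then have eq: "\<Phi> ` (U' \<inter> V') = \<phi> ` (U \<inter> V) \<times> - {0}" using c d image_tchart[OF c(1)] by simp
  show "open (\<Phi> ` (U' \<inter> V'))" unfolding eq
    using open_overlap[OF c(1) d(1)] by (intro open_Times) auto
  show "smooth_on (\<Phi> ` (U' \<inter> V')) (\<Psi> \<circ> inv_into U' \<Phi>)"
    unfolding eq using c d smooth_on_transition_tchart by simp
qed

lemma tpoint_chart: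
  assumes "u \<in> points (\<T> A)"
  obtains U \<phi> where "(U, \<phi>) \<in> A" "fst u \<in> U" "(tdom A U, tchart \<phi>) \<in> \<T> A" "u \<in> tdom A U"
  using assms points_chart tcharts by (metis tpoints tdom_iff)

lemma tnearby_fst:
  assumes u: "u \<in> points (\<T> A)" and Q: "eventually Q (nearby (fst u))"
  shows "\<forall>\<^sub>F w in T.nearby u. Q (fst w)"
proof -
  obtain U \<phi> where c: "(U, \<phi>) \<in> A" "fst u \<in> U" and t: "(tdom A U, tchart \<phi>) \<in> \<T> A" "u \<in> tdom A U"
    using tpoint_chart[OF u] .
  obtain N where N: "open N" "\<phi> (fst u) \<in> N" "N \<subseteq> \<phi> ` U" "\<And>x. x \<in> N \<Longrightarrow> Q (inv_into U \<phi> x)"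
    using nearby_openE[OF c Q] by metis
  have "\<forall>\<^sub>F w in T.nearby u. w \<in> tdom A U \<and> tchart \<phi> w \<in> N \<times> UNIV"
    by (rule T.nearby_open[OF t]) (use N in \<open>auto simp: open_Times mem_Times_iff fst_tchart\<close>)
  then show ?thesis
  proof eventually_elim
    case (elim w)
    then show ?case using N(4)[of "\<phi> (fst w)"] inv_chart[OF c(1)] by (simp add: mem_Times_iff fst_tchart tdom_iff)
  qed
qed

lemma smooth_at_fst:
  assumes u: "u \<in> points (\<T> A)" and f: "smooth_at A f (fst u)"
  shows "smooth_at (\<T> A) (\<lambda>w. f (fst w)) u"
proof -
  obtain U \<phi> where c: "(U, \<phi>) \<in> A" "fst u \<in> U" and t: "(tdom A U, tchart \<phi>) \<in> \<T> A" "u \<in> tdom A U"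
    using tpoint_chart[OF u] .
  obtain N where N: "open N" "\<phi> (fst u) \<in> N" "smooth_on N (f \<circ> inv_into U \<phi>)"
    using smooth_at_chartE[OF c f] by metis
  show ?thesis
    by (rule T.smooth_atI[OF t _ _ smooth_on_fst[OF N(1,3)]])
      (use N T.nearby_chart[OF t] in \<open>auto simp: open_Times mem_Times_iff fst_tchart tdom_iff
        inv_chart[OF c(1)] elim!: eventually_mono\<close>)
qed

text \<open>This function is the differential of \<open>f\<close>, viewed as a fibrewise linear
  function on the bundle. Vertical vectors will be identified by their values on such
  functions.\<close>

lemma smooth_at_snd:
  assumes u: "u \<in> points (\<T> A)" and f: "smooth_at A f (fst u)"
  shows "smooth_at (\<T> A) (\<lambda>w. snd w f) u"
proof -
  obtain U \<phi> where c: "(U, \<phi>) \<in> A" "fst u \<in> U" and t: "(tdom A U, tchart \<phi>) \<in> \<T> A" "u \<in> tdom A U"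
    using tpoint_chart[OF u] .
  have "smooth_at (\<T> A) (\<lambda>w. \<Sum>b\<in>Basis. (tchart \<phi> w \<bullet> (0, b)) * cvec U \<phi> (fst w) b f) u"
    by (intro T.smooth_at_sum u T.smooth_at_mult T.smooth_at_coordinate[OF t] smooth_at_fst smooth_at_cvec c f)
  then show ?thesis
  proof (rule T.smooth_at_cong)
    show "\<forall>\<^sub>F w in T.nearby u. (\<Sum>b\<in>Basis. (tchart \<phi> w \<bullet> (0, b)) * cvec U \<phi> (fst w) b f) = snd w f"
      using T.nearby_chart[OF t] tnearby_fst[OF u smooth_at_nearby[OF f]]
    proof eventually_elim
      case (elim w)
      then have "snd w \<in> tangent_space A (fst w)" and U: "fst w \<in> U" by (auto simp: tdom_iff)
      from tangent_expand[OF c(1) U this(1) elim(2)] show ?case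
        by (simp add: inner_prod_def snd_tchart comps_inner[OF c(1) U])
    qed
  qed
qed

subsection \<open>Projection and vertical lift\<close>

lemma rho_apply: "smooth_at A f (fst u) \<Longrightarrow> rho A u a f = a (\<lambda>w. f (fst w))"
  by (simp add: rho_def o_def)

lemma rho_tangent:
  assumes a: "a \<in> tangent_space (\<T> A) u" and u: "u \<in> points (\<T> A)"
  shows "rho A u a \<in> tangent_space A (fst u)"
  by (rule tangentI)
    (simp_all add: rho_apply smooth_at_add smooth_at_mult smooth_at_cmult smooth_at_fst[OF u]
      T.tangent_add[OF a] T.tangent_mult[OF a] T.tangent_cmult[OF a], simp add: rho_def)

lemma rho_add: "rho A u (a + b) = rho A u a + rho A u b"
  and rho_scale: "rho A u (k *\<^sub>t a) = k *\<^sub>t rho A u a"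
  and rho_zero: "rho A u 0 = 0"
  by (auto simp: rho_def fun_eq_iff scale_def)

context
  fixes U \<phi> u
  assumes c: "(U, \<phi>) \<in> A" "fst u \<in> U" and t: "(tdom A U, tchart \<phi>) \<in> \<T> A" "u \<in> tdom A U"
begin

lemma tpt: "u \<in> points (\<T> A)"
  using T.chart_points[OF t] .

lemma rho_tcvec: "rho A u (T.cvec (tdom A U) (tchart \<phi>) u z) = cvec U \<phi> (fst u) (fst z)"
proof (rule tangent_eqI[OF rho_tangent[OF T.cvec_tangent[OF t] tpt] cvec_tangent[OF c]])
  fix f assume f: "smooth_at A f (fst u)"
  let ?f = "f \<circ> inv_into U \<phi>"
  have "(?f has_derivative frechet_derivative ?f (at (\<phi> (fst u)))) (at (fst (tchart \<phi> u)))"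
    using rep_has_derivative[OF c f] by (simp add: fst_tchart)
  from has_derivative_compose[OF has_derivative_fst[OF has_derivative_ident] this]
  have "((\<lambda>z. ?f (fst z)) has_derivative (\<lambda>z. frechet_derivative ?f (at (\<phi> (fst u))) (fst z))) (at (tchart \<phi> u))" .
  then have "T.cvec (tdom A U) (tchart \<phi>) u z (\<lambda>w. f (fst w)) = frechet_derivative ?f (at (\<phi> (fst u))) (fst z)"
    by (rule T.cvec_eqI[OF t smooth_at_fst[OF tpt f]])
      (use T.nearby_chart[OF t] in \<open>auto simp: fst_tchart tdom_iff inv_chart[OF c(1)] elim!: eventually_mono\<close>)
  then show "rho A u (T.cvec (tdom A U) (tchart \<phi>) u z) f = cvec U \<phi> (fst u) (fst z) f"
    using f by (simp add: rho_apply cvec_def)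
qed

text \<open>In a bundle chart the curve is a straight line in the fibre. For small \<open>s\<close>
  it avoids the zero section, and only there does the inverse of the bundle chart return the
  intended point.\<close>

lemma vlift_has_derivative_chart:
  assumes v: "v \<in> tangent_space A (fst u)" and f: "smooth_at (\<T> A) f u"
  shows "((\<lambda>s. f (fst u, snd u + s *\<^sub>t v)) has_real_derivative
    T.cvec (tdom A U) (tchart \<phi>) u (0, comps \<phi> v) f) (at 0)"
proof -
  let ?F = "f \<circ> inv_into (tdom A U) (tchart \<phi>)" and ?D = "frechet_derivative (f \<circ> inv_into (tdom A U) (tchart \<phi>)) (at (tchart \<phi> u))"
  let ?c = "\<lambda>s. (\<phi> (fst u), comps \<phi> (snd u) + s *\<^sub>R comps \<phi> v)"
  have u: "snd u \<in> tangent_space A (fst u)" "snd u \<noteq> 0" using t by (auto simp: tdom_iff)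
  have c0: "?c 0 = tchart \<phi> u" by (simp add: prod_eq_iff fst_tchart snd_tchart)
  have "(?c has_derivative (\<lambda>s. (0, s *\<^sub>R comps \<phi> v))) (at 0)"
    by (auto intro!: derivative_eq_intros)
  from has_derivative_compose[OF this, of ?F ?D]
  have *: "((\<lambda>s. ?F (?c s)) has_derivative (\<lambda>s. ?D (0, s *\<^sub>R comps \<phi> v))) (at 0)"
    using T.rep_has_derivative[OF t f] c0 by simp
  have "?D (0, s *\<^sub>R comps \<phi> v) = T.cvec (tdom A U) (tchart \<phi>) u (0, comps \<phi> v) f * s" for s
  proof -
    have "linear ?D" using T.rep_has_derivative[OF t f] has_derivative_linear by blast
    from linear_scale[OF this, of s "(0, comps \<phi> v)"] show ?thesis by (simp add: T.cvec_def f)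
  qed
  with * have d: "((\<lambda>s. ?F (?c s)) has_real_derivative T.cvec (tdom A U) (tchart \<phi>) u (0, comps \<phi> v) f) (at 0)"
    by (simp add: has_field_derivative_def)
  have "continuous_on UNIV (\<lambda>s. comps \<phi> (snd u) + s *\<^sub>R comps \<phi> v)"
    by (intro continuous_intros)
  then have "open ((\<lambda>s. comps \<phi> (snd u) + s *\<^sub>R comps \<phi> v) -` (- {0}))"
    by (intro open_vimage) auto
  then show ?thesis
  proof (rule has_field_derivative_transform_within_open[OF d])
    show "0 \<in> (\<lambda>s. comps \<phi> (snd u) + s *\<^sub>R comps \<phi> v) -` (- {0})"
      using u comps_eq_zero_iff[OF c] by simp
    fix s assume "s \<in> (\<lambda>s. comps \<phi> (snd u) + s *\<^sub>R comps \<phi> v) -` (- {0})"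
    then have "?F (?c s) = f (fst u, cvec U \<phi> (fst u) (comps \<phi> (snd u) + s *\<^sub>R comps \<phi> v))"
      using inv_tchart[OF c] by simp
    then show "?F (?c s) = f (fst u, snd u + s *\<^sub>t v)"
      by (simp add: cvec_add[OF c] cvec_scaleR[OF c] cvec_comps[OF c] u v)
  qed
qed

lemma vlift_eq_tcvec:
  assumes v: "v \<in> tangent_space A (fst u)"
  shows "vlift A u v = T.cvec (tdom A U) (tchart \<phi>) u (0, comps \<phi> v)"
  using DERIV_imp_deriv[OF vlift_has_derivative_chart[OF v]]
  by (auto simp: fun_eq_iff vlift_def T.cvec_def)

end

lemma vlift_has_derivative:
  assumes u: "u \<in> points (\<T> A)" and v: "v \<in> tangent_space A (fst u)" and f: "smooth_at (\<T> A) f u"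
  shows "((\<lambda>s. f (fst u, snd u + s *\<^sub>t v)) has_real_derivative vlift A u v f) (at 0)"
proof -
  obtain U \<phi> where c: "(U, \<phi>) \<in> A" "fst u \<in> U" "(tdom A U, tchart \<phi>) \<in> \<T> A" "u \<in> tdom A U"
    using tpoint_chart[OF u] .
  show ?thesis using vlift_has_derivative_chart[OF c v f] vlift_eq_tcvec[OF c v] by simp
qed

lemma vlift_tangent:
  assumes u: "u \<in> points (\<T> A)" and v: "v \<in> tangent_space A (fst u)"
  shows "vlift A u v \<in> tangent_space (\<T> A) u"
proof -
  obtain U \<phi> where c: "(U, \<phi>) \<in> A" "fst u \<in> U" "(tdom A U, tchart \<phi>) \<in> \<T> A" "u \<in> tdom A U"
    using tpoint_chart[OF u] .
  show ?thesis using T.cvec_tangent[OF c(3,4)] vlift_eq_tcvec[OF c v] by simp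
qed

lemma rho_vlift:
  assumes u: "u \<in> points (\<T> A)" and v: "v \<in> tangent_space A (fst u)"
  shows "rho A u (vlift A u v) = 0"
proof -
  obtain U \<phi> where c: "(U, \<phi>) \<in> A" "fst u \<in> U" "(tdom A U, tchart \<phi>) \<in> \<T> A" "u \<in> tdom A U"
    using tpoint_chart[OF u] .
  show ?thesis by (simp add: vlift_eq_tcvec[OF c v] rho_tcvec[OF c] cvec_zero[OF c(1,2)])
qed

lemma rho_surj:
  assumes u: "u \<in> points (\<T> A)" and v: "v \<in> tangent_space A (fst u)"
  obtains a where "a \<in> tangent_space (\<T> A) u" "rho A u a = v"
proof -
  obtain U \<phi> where c: "(U, \<phi>) \<in> A" "fst u \<in> U" "(tdom A U, tchart \<phi>) \<in> \<T> A" "u \<in> tdom A U"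
    using tpoint_chart[OF u] .
  have "rho A u (T.cvec (tdom A U) (tchart \<phi>) u (comps \<phi> v, 0)) = v"
    by (simp add: rho_tcvec[OF c] cvec_comps[OF c(1,2) v])
  then show ?thesis using that T.cvec_tangent[OF c(3,4)] by blast
qed

lemma vlift_snd:
  assumes u: "u \<in> points (\<T> A)" and v: "v \<in> tangent_space A (fst u)" and f: "smooth_at A f (fst u)"
  shows "vlift A u v (\<lambda>w. snd w f) = v f"
proof -
  have "((\<lambda>s. snd u f + s * v f) has_real_derivative v f) (at 0)"
    by (auto intro!: derivative_eq_intros)
  moreover have "((\<lambda>s. snd u f + s * v f) has_real_derivative vlift A u v (\<lambda>w. snd w f)) (at 0)"
    using vlift_has_derivative[OF u v smooth_at_snd[OF u f]] by (simp add: scale_def)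
  ultimately show ?thesis using DERIV_unique by blast
qed

text \<open>A bundle chart splits a tangent vector into a base and a fibre component.
  \<open>rho\<close> sees exactly the base component, and a vector with only a fibre component is a
  vertical lift.\<close>

lemma vertical_eq_vlift:
  assumes u: "u \<in> points (\<T> A)" and a: "a \<in> tangent_space (\<T> A) u" and "rho A u a = 0"
  obtains v where "v \<in> tangent_space A (fst u)" "a = vlift A u v"
proof -
  obtain U \<phi> where c: "(U, \<phi>) \<in> A" "fst u \<in> U" "(tdom A U, tchart \<phi>) \<in> \<T> A" "u \<in> tdom A U"
    using tpoint_chart[OF u] .
  let ?z = "T.comps (tchart \<phi>) a" and ?C = "T.cvec (tdom A U) (tchart \<phi>) u"
  have a': "?C ?z = a" by (rule T.cvec_comps[OF c(3,4) a])
  then have "cvec U \<phi> (fst u) (fst ?z) = 0" using rho_tcvec[OF c, of ?z] assms(3) by simp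
  then have "fst ?z = 0" using comps_cvec[OF c(1,2)] comps_zero[OF c(1,2)] by metis
  then have "?z = (0, comps \<phi> (cvec U \<phi> (fst u) (snd ?z)))"
    by (simp add: prod_eq_iff comps_cvec[OF c(1,2)])
  then have "a = vlift A u (cvec U \<phi> (fst u) (snd ?z))"
    using vlift_eq_tcvec[OF c cvec_tangent[OF c(1,2)]] a' by metis
  then show ?thesis using that cvec_tangent[OF c(1,2)] by blast
qed

lemma vlift_add:
  assumes u: "u \<in> points (\<T> A)" and v: "v \<in> tangent_space A (fst u)" "w \<in> tangent_space A (fst u)"
  shows "vlift A u (v + w) = vlift A u v + vlift A u w"
proof -
  obtain U \<phi> where c: "(U, \<phi>) \<in> A" "fst u \<in> U" "(tdom A U, tchart \<phi>) \<in> \<T> A" "u \<in> tdom A U"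
    using tpoint_chart[OF u] .
  have "(0, comps \<phi> (v + w)) = (0, comps \<phi> v) + (0::'e, comps \<phi> w)" by (simp add: comps_add[OF c(1,2)])
  then show ?thesis
    by (simp only: vlift_eq_tcvec[OF c] v tangent_space_add T.cvec_add[OF c(3,4)])
qed

end

section \<open>An algebraic model of Finsler connections\<close>

definition additive_subgroup :: "'a::ab_group_add set \<Rightarrow> bool" where
  "additive_subgroup S \<longleftrightarrow> 0 \<in> S \<and> (\<forall>x\<in>S. \<forall>y\<in>S. x + y \<in> S) \<and> (\<forall>x\<in>S. - x \<in> S)"

text \<open>The smooth fields are only a part of their function type, and the operations are
  additive only there. The subgroup condition is included so that zero, negation and subtraction are
  respected as well.\<close>

definition additive_on :: "'a::ab_group_add set \<Rightarrow> ('a \<Rightarrow> 'b::ab_group_add) \<Rightarrow> bool" where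
  "additive_on S f \<longleftrightarrow> additive_subgroup S \<and> (\<forall>x\<in>S. \<forall>y\<in>S. f (x + y) = f x + f y)"

lemma additive_subgroupD:
  assumes "additive_subgroup S"
  shows "0 \<in> S" "x \<in> S \<Longrightarrow> y \<in> S \<Longrightarrow> x + y \<in> S" "x \<in> S \<Longrightarrow> - x \<in> S" "x \<in> S \<Longrightarrow> y \<in> S \<Longrightarrow> x - y \<in> S"
  using assms unfolding additive_subgroup_def by (auto simp: diff_conv_add_uminus simp del: add_uminus_conv_diff)

lemma additive_onD:
  assumes "additive_on S f"
  shows "x \<in> S \<Longrightarrow> y \<in> S \<Longrightarrow> f (x + y) = f x + f y" and "f 0 = 0"
    and "x \<in> S \<Longrightarrow> f (- x) = - f x" and "x \<in> S \<Longrightarrow> y \<in> S \<Longrightarrow> f (x - y) = f x - f y"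
proof -
  have S: "additive_subgroup S" and add: "\<And>x y. x \<in> S \<Longrightarrow> y \<in> S \<Longrightarrow> f (x + y) = f x + f y"
    using assms by (auto simp: additive_on_def)
  note S = additive_subgroupD[OF S]
  show "x \<in> S \<Longrightarrow> y \<in> S \<Longrightarrow> f (x + y) = f x + f y" by (rule add)
  show z: "f 0 = 0" using add[OF S(1) S(1)] by simp
  have m: "f (- x) = - f x" if "x \<in> S" for x
    using add[OF that S(3)[OF that]] z by (simp add: eq_neg_iff_add_eq_0 add.commute)
  then show "x \<in> S \<Longrightarrow> f (- x) = - f x" .
  show "x \<in> S \<Longrightarrow> y \<in> S \<Longrightarrow> f (x - y) = f x - f y"
    using add[of x "- y"] m S(3)[of y] by simp
qed

lemma sum3_eq_0D: "a + b + c = 0 \<Longrightarrow> a = - b - c" for a b c :: "'a::ab_group_add"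
  using eq_neg_iff_add_eq_0[of a "b + c"] by (simp add: add.assoc)

text \<open>Here \<open>rh\<close>, \<open>gam\<close>, \<open>et\<close> stand for \<open>\<rho>\<close>, \<open>\<gamma>\<close>, \<open>\<eta>\<close>, \<open>E\<close> for \<open>L\<^sup>2/2\<close>, and \<open>fl\<close> for the
  flat connection along the fibres.\<close>

locale vertical_calculus =
  fixes V :: "'v::ab_group_add set" and P :: "'p::ab_group_add set" and F :: "'f::ab_group_add set"
    and act :: "'v \<Rightarrow> 'f \<Rightarrow> 'f" and br :: "'v \<Rightarrow> 'v \<Rightarrow> 'v"
    and rh :: "'v \<Rightarrow> 'p" and gam :: "'p \<Rightarrow> 'v" and fl :: "'p \<Rightarrow> 'p \<Rightarrow> 'p"
    and et :: 'p and E :: 'f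
  assumes V: "additive_subgroup V" and P: "additive_subgroup P" and F: "additive_subgroup F"
    and act_closed [simp]: "A \<in> V \<Longrightarrow> f \<in> F \<Longrightarrow> act A f \<in> F"
    and act_left: "f \<in> F \<Longrightarrow> additive_on V (\<lambda>A. act A f)"
    and act_right: "A \<in> V \<Longrightarrow> additive_on F (act A)"
    and br_closed [simp]: "A \<in> V \<Longrightarrow> B \<in> V \<Longrightarrow> br A B \<in> V"
    and br_right: "A \<in> V \<Longrightarrow> additive_on V (br A)"
    and br_left: "A \<in> V \<Longrightarrow> additive_on V (\<lambda>B. br B A)"
    and br_skew: "A \<in> V \<Longrightarrow> B \<in> V \<Longrightarrow> br A B = - br B A"
    and jacobi: "A \<in> V \<Longrightarrow> B \<in> V \<Longrightarrow> C \<in> V \<Longrightarrow> br A (br B C) = br (br A B) C + br B (br A C)"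
    and act_br: "A \<in> V \<Longrightarrow> B \<in> V \<Longrightarrow> f \<in> F \<Longrightarrow> act (br A B) f = act A (act B f) - act B (act A f)"
    and rh_closed [simp]: "A \<in> V \<Longrightarrow> rh A \<in> P"
    and rh_additive: "additive_on V rh"
    and gam_closed [simp]: "X \<in> P \<Longrightarrow> gam X \<in> V"
    and gam_additive: "additive_on P gam"
    and rh_gam [simp]: "X \<in> P \<Longrightarrow> rh (gam X) = 0"
    and vertical: "A \<in> V \<Longrightarrow> rh A = 0 \<Longrightarrow> \<exists>X\<in>P. A = gam X"
    and gam_inj: "X \<in> P \<Longrightarrow> gam X = 0 \<Longrightarrow> X = 0"
    and fl_closed [simp]: "X \<in> P \<Longrightarrow> Y \<in> P \<Longrightarrow> fl X Y \<in> P"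
    and fl_left: "Y \<in> P \<Longrightarrow> additive_on P (\<lambda>X. fl X Y)"
    and fl_right: "X \<in> P \<Longrightarrow> additive_on P (fl X)"
    and rh_br_gam: "X \<in> P \<Longrightarrow> A \<in> V \<Longrightarrow> rh (br (gam X) A) = fl X (rh A)"
    and br_gam: "X \<in> P \<Longrightarrow> Y \<in> P \<Longrightarrow> br (gam X) (gam Y) = gam (fl X Y - fl Y X)"
    and flat: "X \<in> P \<Longrightarrow> Y \<in> P \<Longrightarrow> Z \<in> P \<Longrightarrow> fl X (fl Y Z) - fl Y (fl X Z) = fl (fl X Y - fl Y X) Z"
    and et_closed [simp]: "et \<in> P"
    and fl_et [simp]: "X \<in> P \<Longrightarrow> fl X et = X"
    and E_closed [simp]: "E \<in> F"
    and E_homogeneous: "act (gam et) E = E + E"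
    and F_torsion: "f \<in> F \<Longrightarrow> f + f = 0 \<Longrightarrow> f = 0"
    and P_torsion: "X \<in> P \<Longrightarrow> X + X = 0 \<Longrightarrow> X = 0"
    and definite: "X \<in> P \<Longrightarrow> act (gam X) (act (gam X) E) - act (gam (fl X X)) E = 0 \<Longrightarrow> X = 0"
begin

lemmas closed [simp] = additive_subgroupD[OF V] additive_subgroupD[OF P] additive_subgroupD[OF F]
lemmas add [simp] = additive_onD[OF act_left] additive_onD[OF act_right] additive_onD[OF br_left]
  additive_onD[OF br_right] additive_onD[OF rh_additive] additive_onD[OF gam_additive]
  additive_onD[OF fl_left] additive_onD[OF fl_right]

lemma rh_br_gam' [simp]: "X \<in> P \<Longrightarrow> A \<in> V \<Longrightarrow> rh (br A (gam X)) = - fl X (rh A)"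
  using br_skew[of A "gam X"] by (simp add: rh_br_gam)

lemma jacobi_cyclic:
  assumes [simp]: "A \<in> V" "B \<in> V" "C \<in> V"
  shows "br (br A B) C + br (br B C) A + br (br C A) B = 0"
proof -
  have "br A (br B C) = br (br A B) C + br B (br A C)" by (rule jacobi) simp_all
  moreover have "br B (br A C) = br (br C A) B"
    by (subst br_skew) (simp_all add: br_skew[of A C])
  moreover have "br A (br B C) = - br (br B C) A" by (rule br_skew) simp_all
  ultimately have "- br (br B C) A = br (br A B) C + br (br C A) B" by (simp only:)
  then show ?thesis by (simp add: neg_eq_iff_add_eq_0 ac_simps)
qed

text \<open>Solved for one double bracket, so that an instance can serve as a rewrite rule inside
  the proofs of the Bianchi identities.\<close>

lemma additive_jacobi:
  assumes h: "additive_on V h" and [simp]: "A \<in> V" "B \<in> V" "C \<in> V"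
  shows "h (br (br A B) C) = - h (br (br B C) A) - h (br (br C A) B)"
proof -
  have "h (br (br A B) C) + h (br (br B C) A) + h (br (br C A) B)
      = h (br (br A B) C + br (br B C) A + br (br C A) B)" by (simp add: additive_onD[OF h])
  also have "\<dots> = 0" by (simp only: jacobi_cyclic assms additive_onD(2)[OF h])
  finally show ?thesis by (rule sum3_eq_0D)
qed

section \<open>The fibrewise Hessian of the energy and its fibre derivative\<close>

definition g :: "'p \<Rightarrow> 'p \<Rightarrow> 'f" where
  "g X Y = act (gam X) (act (gam Y) E) - act (gam (fl X Y)) E"

lemma g_closed [simp]: "X \<in> P \<Longrightarrow> Y \<in> P \<Longrightarrow> g X Y \<in> F"
  by (simp add: g_def)

lemma g_left: "Y \<in> P \<Longrightarrow> additive_on P (\<lambda>X. g X Y)"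
  and g_right: "X \<in> P \<Longrightarrow> additive_on P (g X)"
  by (simp_all add: additive_on_def P g_def)

lemmas g_add [simp] = additive_onD[OF g_left] additive_onD[OF g_right]

lemma g_sym: "X \<in> P \<Longrightarrow> Y \<in> P \<Longrightarrow> g X Y = g Y X"
  using act_br[of "gam X" "gam Y" E] by (simp add: g_def br_gam algebra_simps)

text \<open>Homogeneity turns the first term of the Hessian into two copies of
  \<open>act (gam X) E\<close>; the second takes one of them back, as
  \<open>fl X et = X\<close>.\<close>

lemma g_et: "X \<in> P \<Longrightarrow> g X et = act (gam X) E"
  by (simp add: g_def E_homogeneous)

lemma g_nondegenerate:
  assumes "X \<in> P" "Y \<in> P" "\<And>Z. Z \<in> P \<Longrightarrow> g X Z = g Y Z"
  shows "X = Y"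
proof -
  have "g (X - Y) (X - Y) = 0" using assms by simp
  then have "X - Y = 0" using definite[of "X - Y"] assms unfolding g_def by simp
  then show ?thesis by simp
qed

lemma F_double: "f \<in> F \<Longrightarrow> h \<in> F \<Longrightarrow> f + f = h + h \<Longrightarrow> f = h"
  using F_torsion[of "f - h"] by (simp add: algebra_simps)

text \<open>The third fibre derivative of \<open>E\<close>. In coordinates it is the derivative of
  the metric in the fibre variables, that is, twice the Cartan tensor.\<close>

definition dg :: "'p \<Rightarrow> 'p \<Rightarrow> 'p \<Rightarrow> 'f" where
  "dg X Y Z = act (gam X) (g Y Z) - g (fl X Y) Z - g Y (fl X Z)"

text \<open>Fibre derivatives commute: flatness of \<open>fl\<close> accounts for the iterated flat
  derivatives, and the bracket of vertical fields for the iterated derivatives of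
  \<open>E\<close>.\<close>

lemma dg_sym:
  assumes [simp]: "X \<in> P" "Y \<in> P" "Z \<in> P"
  shows "dg X Y Z = dg Y X Z"
proof -
  have "act (gam (fl (fl X Y) Z)) E - act (gam (fl (fl Y X) Z)) E = act (gam (fl X (fl Y Z))) E - act (gam (fl Y (fl X Z))) E"
    using arg_cong[OF flat[of X Y Z], of "\<lambda>W. act (gam W) E"] by simp
  moreover have "act (gam (fl X Y)) (act (gam Z) E) - act (gam (fl Y X)) (act (gam Z) E)
      = act (gam X) (act (gam Y) (act (gam Z) E)) - act (gam Y) (act (gam X) (act (gam Z) E))"
    using act_br[of "gam X" "gam Y" "act (gam Z) E"] by (simp add: br_gam)
  ultimately show ?thesis
    by (simp add: dg_def g_def algebra_simps)
qed

text \<open>Infinitesimal form of the homogeneity of degree 0 of the metric: by \<open>g_et\<close>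
  what remains is \<open>g X Y - g Y X\<close>.\<close>

lemma dg_et: "X \<in> P \<Longrightarrow> Y \<in> P \<Longrightarrow> dg X Y et = 0"
  using g_sym[of X Y] by (simp add: dg_def g_et) (simp add: g_def)

end

section \<open>Linear connections: curvature, Bianchi and Ricci identities\<close>

locale linear_conn = vertical_calculus +
  fixes D :: "'a \<Rightarrow> 'b \<Rightarrow> 'b"
  assumes D_closed [simp]: "A \<in> V \<Longrightarrow> Y \<in> P \<Longrightarrow> D A Y \<in> P"
    and D_left: "Y \<in> P \<Longrightarrow> additive_on V (\<lambda>A. D A Y)"
    and D_right: "A \<in> V \<Longrightarrow> additive_on P (D A)"
begin

lemmas D_add [simp] = additive_onD[OF D_left] additive_onD[OF D_right]

text \<open>The (h)hv-torsion without its horizontal lift: by \<open>rh_br_gam\<close> the bracket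
  of \<open>gam X\<close> with any field that projects to \<open>Y\<close> projects to
  \<open>fl X Y\<close>.\<close>

definition T :: "'b \<Rightarrow> 'b \<Rightarrow> 'b" where
  "T X Y = D (gam X) Y - fl X Y"

definition R :: "'a \<Rightarrow> 'a \<Rightarrow> 'b \<Rightarrow> 'b" where
  "R A B Z = - D A (D B Z) + D B (D A Z) + D (br A B) Z"

lemma T_closed [simp]: "X \<in> P \<Longrightarrow> Y \<in> P \<Longrightarrow> T X Y \<in> P"
  by (simp add: T_def)

lemma R_closed [simp]: "A \<in> V \<Longrightarrow> B \<in> V \<Longrightarrow> Z \<in> P \<Longrightarrow> R A B Z \<in> P"
  by (simp add: R_def)

lemma T_left: "Y \<in> P \<Longrightarrow> additive_on P (\<lambda>X. T X Y)"
  and T_right: "X \<in> P \<Longrightarrow> additive_on P (T X)"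
  by (simp_all add: additive_on_def P T_def algebra_simps)

lemma R_add:
  "B \<in> V \<Longrightarrow> Z \<in> P \<Longrightarrow> additive_on V (\<lambda>A. R A B Z)"
  "A \<in> V \<Longrightarrow> Z \<in> P \<Longrightarrow> additive_on V (\<lambda>B. R A B Z)"
  "A \<in> V \<Longrightarrow> B \<in> V \<Longrightarrow> additive_on P (R A B)"
  by (simp_all add: additive_on_def V P R_def algebra_simps)

lemmas TR_add [simp] = additive_onD[OF T_left] additive_onD[OF T_right]
  additive_onD[OF R_add(1)] additive_onD[OF R_add(2)] additive_onD[OF R_add(3)]

lemma R_skew: "A \<in> V \<Longrightarrow> B \<in> V \<Longrightarrow> Z \<in> P \<Longrightarrow> R A B Z = - R B A Z"
  using br_skew[of A B] by (simp add: R_def)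

text \<open>With \<open>s\<close> the projection \<open>rh\<close> this is the first Bianchi identity; the other instance needed
  is the connection map \<open>\<lambda>A. D A et\<close>.\<close>

lemma bianchi1:
  fixes s :: "'a \<Rightarrow> 'b"
  assumes s: "additive_on V s" "\<And>A. A \<in> V \<Longrightarrow> s A \<in> P"
    and [simp]: "A \<in> V" "B \<in> V" "C \<in> V"
  defines "t \<equiv> \<lambda>A B. D A (s B) - D B (s A) - s (br A B)"
  shows "R A B (s C) + R B C (s A) + R C A (s B) =
    t (br A B) C + t (br B C) A + t (br C A) B - (D A (t B C) + D B (t C A) + D C (t A B))"
proof -
  note [simp] = s(2) additive_onD[OF s(1)]
  note e = additive_jacobi[OF s(1) assms(3-5)]
  show ?thesis
    unfolding t_def R_def by (simp add: e algebra_simps)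
qed

lemma bianchi2:
  assumes [simp]: "A \<in> V" "B \<in> V" "C \<in> V" "Z \<in> P"
  shows "D A (R B C Z) - R B C (D A Z) + (D B (R C A Z) - R C A (D B Z)) + (D C (R A B Z) - R A B (D C Z))
    = R (br A B) C Z + R (br B C) A Z + R (br C A) B Z"
  unfolding R_def by (simp add: additive_jacobi[OF D_left[OF assms(4)] assms(1-3)] algebra_simps)

text \<open>The covariant derivative of the metric. It is kept as a separate term because the
  Hashiguchi connection is assumed metric in vertical directions only.\<close>

definition G :: "'a \<Rightarrow> 'b \<Rightarrow> 'b \<Rightarrow> 'c" where
  "G A Z W = act A (g Z W) - g (D A Z) W - g Z (D A W)"

lemma G_left: "Z \<in> P \<Longrightarrow> W \<in> P \<Longrightarrow> additive_on V (\<lambda>A. G A Z W)"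
  by (simp add: additive_on_def V G_def algebra_simps)

lemmas G_add [simp] = additive_onD[OF G_left]

lemma ricci_identity:
  assumes [simp]: "A \<in> V" "B \<in> V" "Z \<in> P" "W \<in> P"
  shows "g (R A B Z) W + g Z (R A B W) =
    (act A (G B Z W) - G B (D A Z) W - G B Z (D A W))
    - (act B (G A Z W) - G A (D B Z) W - G A Z (D B W)) - G (br A B) Z W"
  by (simp add: G_def R_def act_br algebra_simps)

end

section \<open>Connections that are metric along the fibres, with symmetric torsion\<close>

locale vertical_conn = linear_conn +
  assumes metric_v: "X \<in> P \<Longrightarrow> Y \<in> P \<Longrightarrow> Z \<in> P \<Longrightarrow>
      act (gam X) (g Y Z) - g (D (gam X) Y) Z - g Y (D (gam X) Z) = 0"
    and torsion_sym: "X \<in> P \<Longrightarrow> Y \<in> P \<Longrightarrow> Z \<in> P \<Longrightarrow> g (T X Y) Z = g (T X Z) Y"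
begin

text \<open>Vertical metricity splits \<open>dg\<close> into two torsion terms, which the symmetry
  of the torsion makes equal. Since \<open>dg\<close> depends on the metric alone, so does
  \<open>T\<close>.\<close>

lemma dg_eq:
  assumes [simp]: "X \<in> P" "Y \<in> P" "Z \<in> P"
  shows "dg X Y Z = g (T X Y) Z + g (T X Y) Z"
proof -
  have "act (gam X) (g Y Z) = g (D (gam X) Y) Z + g Y (D (gam X) Z)"
    using metric_v[of X Y Z] by (simp add: algebra_simps)
  then have "dg X Y Z = g (T X Y) Z + g Y (T X Z)"
    by (simp add: dg_def T_def algebra_simps)
  then show ?thesis using torsion_sym[of X Y Z] g_sym[of Y "T X Z"] by simp
qed

lemma T_sym: "X \<in> P \<Longrightarrow> Y \<in> P \<Longrightarrow> T X Y = T Y X"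
proof (rule g_nondegenerate)
  fix Z assume [simp]: "X \<in> P" "Y \<in> P" "Z \<in> P"
  show "g (T X Y) Z = g (T Y X) Z"
  proof -
    have "g (T X Y) Z + g (T X Y) Z = g (T Y X) Z + g (T Y X) Z"
      using dg_sym[of X Y Z] by (simp add: dg_eq)
    then show ?thesis by (rule F_double[rotated 2]) simp_all
  qed
qed auto

text \<open>Homogeneity makes \<open>g (T X Z) et\<close> vanish by \<open>dg_eq\<close> and
  \<open>dg_et\<close>; the symmetry of the torsion then moves \<open>et\<close> into an argument of
  \<open>T\<close>.\<close>

lemma T_et [simp]: "X \<in> P \<Longrightarrow> T X et = 0" "X \<in> P \<Longrightarrow> T et X = 0"
proof -
  show *: "T X et = 0" if "X \<in> P" for X
  proof (rule g_nondegenerate)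
    fix Z assume "Z \<in> P"
    then have "g (T X Z) et + g (T X Z) et = 0" "g (T X Z) et \<in> F"
      using that dg_eq[of X Z et] dg_et[of X Z] by simp_all
    then have "g (T X Z) et = 0" by (rule F_torsion[rotated])
    then show "g (T X et) Z = g 0 Z" using torsion_sym[of X et Z] that \<open>Z \<in> P\<close> by simp
  qed (use that in auto)
  show "X \<in> P \<Longrightarrow> T et X = 0" using * T_sym[of et X] by simp
qed

lemma D_gam_et [simp]: "X \<in> P \<Longrightarrow> D (gam X) et = X"
  using T_et(1)[of X] by (simp add: T_def)

lemma D_gam: "X \<in> P \<Longrightarrow> Y \<in> P \<Longrightarrow> D (gam X) Y = fl X Y + T X Y"
  by (simp add: T_def)

text \<open>Because \<open>D (gam Y) et = Y\<close>, this is the torsion in the sense of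
  \<open>bianchi1\<close>, for \<open>s\<close> the map sending \<open>A\<close> to
  \<open>D A et\<close>, on two vertical fields.\<close>

lemma K_torsion_vv [simp]:
  "X \<in> P \<Longrightarrow> Y \<in> P \<Longrightarrow> D (gam X) Y - D (gam Y) X - D (br (gam X) (gam Y)) et = 0"
  by (simp add: br_gam D_gam T_sym[of X Y])

lemma G_gam [simp]: "X \<in> P \<Longrightarrow> Y \<in> P \<Longrightarrow> Z \<in> P \<Longrightarrow> G (gam X) Y Z = 0"
  using metric_v by (simp add: G_def)

text \<open>The v-curvature is skew in both pairs and cyclic, hence symmetric under exchange of the pairs;
  since it kills \<open>et\<close> in the third slot, it does so in the second.\<close>

lemma S_et:
  assumes [simp]: "X \<in> P" "Z \<in> P"
  shows "R (gam X) (gam et) Z = 0"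
proof (rule g_nondegenerate)
  fix W assume [simp]: "W \<in> P"
  define S where "S X Y Z W = g (R (gam X) (gam Y) Z) W" for X Y Z W
  have skew1: "S X Y Z W = - S Y X Z W" if "X \<in> P" "Y \<in> P" "Z \<in> P" "W \<in> P" for X Y Z W
    using R_skew[of "gam X" "gam Y" Z] that by (simp add: S_def)
  have skew2: "S X Y Z W = - S X Y W Z" if "X \<in> P" "Y \<in> P" "Z \<in> P" "W \<in> P" for X Y Z W
    using ricci_identity[of "gam X" "gam Y" Z W] that g_sym[of Z "R (gam X) (gam Y) W"]
    by (simp add: S_def br_gam eq_neg_iff_add_eq_0)
  have cyc: "S X Y Z W + S Y Z X W + S Z X Y W = 0" if [simp]: "X \<in> P" "Y \<in> P" "Z \<in> P" "W \<in> P" for X Y Z W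
  proof -
    \<comment> \<open>With \<open>rh\<close> in the role of \<open>s\<close> the Bianchi identity
      would say nothing here, as \<open>rh\<close> kills vertical fields. The map sending
      \<open>A\<close> to \<open>D A et\<close> instead takes \<open>gam Z\<close> to
      \<open>Z\<close>, and its torsion vanishes on vertical pairs.\<close>
    have ad: "additive_on V (\<lambda>A. D A et)" "\<And>A. A \<in> V \<Longrightarrow> D A et \<in> P" by (auto simp: D_left)
    define t where "t = (\<lambda>A B. D A (D B et) - D B (D A et) - D (br A B) et)"
    have t0: "t (gam A) (gam B) = 0" if "A \<in> P" "B \<in> P" for A B
      unfolding t_def using K_torsion_vv[OF that] that by (simp only: D_gam_et)
    have t1: "t (br (gam A) (gam B)) (gam C) = 0" if "A \<in> P" "B \<in> P" "C \<in> P" for A B C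
      using that by (simp only: br_gam t0 fl_closed closed)
    have "R (gam X) (gam Y) (D (gam Z) et) + R (gam Y) (gam Z) (D (gam X) et) + R (gam Z) (gam X) (D (gam Y) et) =
      t (br (gam X) (gam Y)) (gam Z) + t (br (gam Y) (gam Z)) (gam X) + t (br (gam Z) (gam X)) (gam Y)
      - (D (gam X) (t (gam Y) (gam Z)) + D (gam Y) (t (gam Z) (gam X)) + D (gam Z) (t (gam X) (gam Y)))"
      unfolding t_def by (rule bianchi1[OF ad]) simp_all
    then have "R (gam X) (gam Y) Z + R (gam Y) (gam Z) X + R (gam Z) (gam X) Y = 0"
      by (simp add: t0 t1)
    then have "g (R (gam X) (gam Y) Z + R (gam Y) (gam Z) X + R (gam Z) (gam X) Y) W = 0" by simp
    then show ?thesis by (simp add: S_def)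
  qed
  have et3: "S X Y et W = 0" if "X \<in> P" "Y \<in> P" "W \<in> P" for X Y W
    using that by (simp add: S_def R_def br_gam D_gam T_sym[of X Y])
  have "S X et Z W = S Z W X et"
  proof (rule F_double[rotated 2])
    \<comment> \<open>Four cyclic identities, one for each choice of the last argument. After the
      two skew symmetries only twice the difference of the terms with exchanged pairs is
      left.\<close>
    have "0 = (S et Z X W + S Z X et W + S X et Z W) + (S Z X W et + S X W Z et + S W Z X et)
      + (S X W et Z + S W et X Z + S et X W Z) + (S W et Z X + S et Z W X + S Z W et X)"
      by (simp add: cyc)
    also have "\<dots> = (S X et Z W + S X et Z W) - (S Z W X et + S Z W X et)"
    proof -
      have "S et Z W X = - S et Z X W" "S Z X W et = - S Z X et W" "S X W Z et = - S X W et Z"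
        "S W et Z X = - S W et X Z"
        by (simp_all add: skew2[of et Z W X] skew2[of Z X W et] skew2[of X W Z et] skew2[of W et Z X])
      moreover have "S et X W Z = S X et Z W"
        using skew1[of et X W Z] skew2[of X et W Z] by simp
      moreover have "S W Z X et = - S Z W X et" "S Z W et X = - S Z W X et"
        using skew1[of W Z X et] skew2[of Z W et X] by simp_all
      ultimately show ?thesis by (simp add: algebra_simps)
    qed
    finally show "S X et Z W + S X et Z W = S Z W X et + S Z W X et" by simp
  qed (simp_all add: S_def)
  then have "S X et Z W = 0" using skew2[of Z W X et] et3[of Z W X] by simp
  then show "g (R (gam X) (gam et) Z) W = g 0 W" by (simp add: S_def)
qed auto

end

section \<open>Horizontal lifts, their brackets and the hv Bianchi identity\<close>

locale horizontal_conn = vertical_conn +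
  fixes bet :: "'b \<Rightarrow> 'a"
  assumes bet_closed [simp]: "X \<in> P \<Longrightarrow> bet X \<in> V"
    and bet_additive: "additive_on P bet"
    and rh_bet [simp]: "X \<in> P \<Longrightarrow> rh (bet X) = X"
    and D_bet_et [simp]: "X \<in> P \<Longrightarrow> D (bet X) et = 0"
    and Q_zero: "X \<in> P \<Longrightarrow> Y \<in> P \<Longrightarrow> D (bet X) Y - D (bet Y) X - rh (br (bet X) (bet Y)) = 0"
begin

lemmas bet_add [simp] = additive_onD[OF bet_additive]

definition Ph :: "'b \<Rightarrow> 'b \<Rightarrow> 'b" where
  "Ph X Y = R (bet X) (gam Y) et"

lemma Ph_closed [simp]: "X \<in> P \<Longrightarrow> Y \<in> P \<Longrightarrow> Ph X Y \<in> P"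
  by (simp add: Ph_def)

lemma Ph_add:
  "Y \<in> P \<Longrightarrow> additive_on P (\<lambda>X. Ph X Y)"
  "X \<in> P \<Longrightarrow> additive_on P (Ph X)"
  by (simp_all add: additive_on_def P Ph_def)

lemmas Ph_add' [simp] = additive_onD[OF Ph_add(1)] additive_onD[OF Ph_add(2)]

text \<open>\<open>A - bet (rh A)\<close> is killed by \<open>rh\<close>, so it equals some
  \<open>gam U\<close>; applying the connection to \<open>et\<close> identifies \<open>U\<close>,
  since horizontal fields annihilate \<open>et\<close>.\<close>

lemma decompose: "A \<in> V \<Longrightarrow> A = bet (rh A) + gam (D A et)"
proof -
  assume [simp]: "A \<in> V"
  obtain U where U: "U \<in> P" "A - bet (rh A) = gam U" using vertical[of "A - bet (rh A)"] by auto
  have "D (A - bet (rh A)) et = D A et" by simp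
  then have "U = D A et" using U by simp
  then show ?thesis using U by (simp add: algebra_simps)
qed

lemma K_br: "X \<in> P \<Longrightarrow> Y \<in> P \<Longrightarrow> D (br (bet X) (gam Y)) et = Ph X Y + D (bet X) Y"
  by (simp add: Ph_def R_def)

text \<open>The horizontal part is the projection of the bracket. The vertical part is read off from
  the curvature applied to \<open>et\<close>: of the two iterated derivatives one vanishes by
  \<open>D (bet X) et = 0\<close> and the other is \<open>D (bet X) Y\<close>.\<close>

lemma br_bet_gam:
  "X \<in> P \<Longrightarrow> Y \<in> P \<Longrightarrow> br (bet X) (gam Y) = gam (Ph X Y + D (bet X) Y) - bet (fl Y X)"
  using decompose[of "br (bet X) (gam Y)"] by (simp add: K_br algebra_simps)

lemma rh_br_bet: "X \<in> P \<Longrightarrow> Y \<in> P \<Longrightarrow> rh (br (bet X) (bet Y)) = D (bet X) Y - D (bet Y) X"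
  using Q_zero[of X Y] by (simp add: algebra_simps)

definition DT :: "'a \<Rightarrow> 'b \<Rightarrow> 'b \<Rightarrow> 'b" where
  "DT A X Y = D A (T X Y) - T (D A X) Y - T X (D A Y)"

lemma hv_bianchi:
  assumes [simp]: "X \<in> P" "Y \<in> P" "Z \<in> P"
  shows "R (bet X) (gam Y) Z - R (bet Z) (gam Y) X =
    DT (bet Z) Y X - DT (bet X) Y Z + T (Ph X Y) Z - T (Ph Z Y) X"
proof -
  define t where "t = (\<lambda>A B. D A (rh B) - D B (rh A) - rh (br A B))"
  have b: "R (bet X) (gam Y) Z - R (bet Z) (gam Y) X =
      t (br (bet X) (gam Y)) (bet Z) + t (br (gam Y) (bet Z)) (bet X) + t (br (bet Z) (bet X)) (gam Y)
      - (D (bet X) (t (gam Y) (bet Z)) + D (gam Y) (t (bet Z) (bet X)) + D (bet Z) (t (bet X) (gam Y)))"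
    using bianchi1[OF rh_additive rh_closed, of "bet X" "gam Y" "bet Z"] R_skew[of "gam Y" "bet Z" X]
    unfolding t_def by simp
  have hh: "t (bet A) (bet B) = 0" if "A \<in> P" "B \<in> P" for A B
    using Q_zero that by (simp add: t_def)
  have vh: "t (gam A) (bet B) = T A B" "t (bet B) (gam A) = - T A B" if "A \<in> P" "B \<in> P" for A B
    using that by (auto simp: t_def T_def rh_br_gam)
  have "additive_on V (\<lambda>A. t A B)" "additive_on V (t B)" if "B \<in> V" for B
    using that by (auto simp: additive_on_def V t_def algebra_simps)
  note [simp] = additive_onD[OF this(1)] additive_onD[OF this(2)]
  have hv: "t (br (bet A) (gam B)) (bet C) = T (Ph A B + D (bet A) B) C" if "A \<in> P" "B \<in> P" "C \<in> P" for A B C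
    using that by (simp add: br_bet_gam hh vh)
  have vh': "t (br (gam Y) (bet Z)) (bet X) = - T (Ph Z Y + D (bet Z) Y) X"
    using hv[of Z Y X] by (simp add: br_skew[of "gam Y"])
  \<comment> \<open>Only the horizontal part of this bracket contributes: two vertical fields have
    zero torsion, because they and their bracket are killed by \<open>rh\<close>. The h-curvature
    hidden in the vertical part therefore drops out.\<close>
  have "t (br (bet Z) (bet X)) (gam Y) = t (bet (D (bet Z) X - D (bet X) Z) + gam (D (br (bet Z) (bet X)) et)) (gam Y)"
    using decompose[of "br (bet Z) (bet X)"] by (simp add: rh_br_bet)
  also have "\<dots> = - T Y (D (bet Z) X - D (bet X) Z)"
  proof -
    have "t (gam A) (gam B) = 0" if "A \<in> P" "B \<in> P" for A B
      using that by (simp add: t_def br_gam)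
    then show ?thesis by (simp add: vh)
  qed
  finally have hh': "t (br (bet Z) (bet X)) (gam Y) = - T Y (D (bet Z) X - D (bet X) Z)" .
  show ?thesis
    unfolding b hv[OF assms] vh' hh' by (simp add: vh hh DT_def algebra_simps)
qed

text \<open>The spray \<open>bet et\<close> is the Euler--Lagrange field of \<open>E\<close>.\<close>

lemma spray:
  assumes cons: "\<And>X. X \<in> P \<Longrightarrow> act (bet X) E = 0" and Ph: "\<And>X. X \<in> P \<Longrightarrow> Ph et X = 0"
    and [simp]: "A \<in> V"
  shows "act (bet et) (act (gam (rh A)) E) + act (gam (rh (br A (bet et)))) E = act A E"
proof -
  define X where "X = rh A"
  define U where "U = D A et"
  have [simp]: "X \<in> P" "U \<in> P" by (simp_all add: X_def U_def)
  have A: "A = bet X + gam U" using decompose[of A] by (simp add: X_def U_def)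
  have "act (bet et) (act (gam X) E) = act (br (bet et) (gam X)) E"
    using act_br[of "bet et" "gam X" E] cons by simp
  also have "\<dots> = act (gam (D (bet et) X)) E"
    using cons by (simp add: br_bet_gam Ph)
  finally have 1: "act (bet et) (act (gam X) E) = act (gam (D (bet et) X)) E" .
  show ?thesis unfolding A by (simp add: 1 cons rh_br_bet rh_br_gam)
qed

text \<open>Here \<open>rh (br (bet et) (bet X))\<close> is \<open>D (bet et) X\<close>, because
  \<open>D (bet X) et = 0\<close>. In this form the conclusion no longer mentions \<open>D\<close>,
  so it can be compared between two connections with the same spray.\<close>

lemma br_spray:
  assumes Ph: "\<And>X. X \<in> P \<Longrightarrow> Ph et X = 0" and [simp]: "X \<in> P"
  shows "br (bet et) (gam X) = gam (rh (br (bet et) (bet X))) - bet X"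
  by (simp add: br_bet_gam Ph rh_br_bet)

end

section \<open>The Cartan connection: consequences of full metricity\<close>

locale cartan_conn = horizontal_conn +
  assumes metric: "A \<in> V \<Longrightarrow> Y \<in> P \<Longrightarrow> Z \<in> P \<Longrightarrow> act A (g Y Z) - g (D A Y) Z - g Y (D A Z) = 0"
begin

lemma act_g: "A \<in> V \<Longrightarrow> Y \<in> P \<Longrightarrow> Z \<in> P \<Longrightarrow> act A (g Y Z) = g (D A Y) Z + g Y (D A Z)"
  using metric[of A Y Z] by (simp add: algebra_simps)

lemma R_skew_metric:
  assumes [simp]: "A \<in> V" "B \<in> V" "Z \<in> P" "W \<in> P"
  shows "g (R A B Z) W = - g (R A B W) Z"
proof -
  have "G A Z W = 0" if "A \<in> V" "Z \<in> P" "W \<in> P" for A Z W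
    using metric that by (simp add: G_def)
  then show ?thesis
    using ricci_identity[of A B Z W] g_sym[of Z "R A B W"] by (simp add: eq_neg_iff_add_eq_0)
qed

text \<open>By homogeneity \<open>g et et\<close> is twice \<open>E\<close>, and \<open>et\<close>
  is parallel along horizontal fields.\<close>

lemma act_bet_E: "X \<in> P \<Longrightarrow> act (bet X) E = 0"
proof -
  assume [simp]: "X \<in> P"
  have "act (bet X) (g et et) = 0" by (simp add: act_g)
  then have "act (bet X) E + act (bet X) E = 0" by (simp add: g_et E_homogeneous)
  then show ?thesis by (rule F_torsion[rotated]) simp
qed

lemma DT_sym: "A \<in> V \<Longrightarrow> X \<in> P \<Longrightarrow> Y \<in> P \<Longrightarrow> DT A X Y = DT A Y X"
  using T_sym by (simp add: DT_def algebra_simps)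

lemma DT_closed [simp]: "A \<in> V \<Longrightarrow> X \<in> P \<Longrightarrow> Y \<in> P \<Longrightarrow> DT A X Y \<in> P"
  by (simp add: DT_def)

lemma DT_et [simp]: "X \<in> P \<Longrightarrow> Y \<in> P \<Longrightarrow> DT (bet X) Y et = 0"
  by (simp add: DT_def)

lemma DT_sym_metric:
  assumes [simp]: "A \<in> V" "X \<in> P" "Y \<in> P" "Z \<in> P"
  shows "g (DT A X Y) Z = g (DT A X Z) Y"
proof -
  have *: "g (DT A X Y) Z = act A (g (T X Y) Z) - g (T X Y) (D A Z) - g (T (D A X) Y) Z - g (T X (D A Y)) Z"
    if [simp]: "Y \<in> P" "Z \<in> P" for Y Z
    by (simp add: DT_def act_g)
  show ?thesis unfolding *[OF assms(3,4)] *[OF assms(4,3)]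
    using torsion_sym[of X Y Z] torsion_sym[of "D A X" Y Z] torsion_sym[of X "D A Y" Z]
      torsion_sym[of X "D A Z" Y] by (simp add: algebra_simps)
qed

text \<open>The situation is that of the Koszul formula: for fixed \<open>Y\<close>,
  \<open>hv_bianchi\<close> gives the part of the hv-curvature that is skew in its first and third
  arguments, and metricity makes the lowered curvature skew in its last two. Together these
  determine it; with \<open>et\<close> in the third slot most torsion terms vanish.\<close>

lemma Ph_et_left:
  assumes Y [simp]: "Y \<in> P"
  shows "X \<in> P \<Longrightarrow> Ph X Y = DT (bet et) Y X - T (Ph et Y) X"
proof (rule g_nondegenerate)
  fix W assume [simp]: "X \<in> P" "W \<in> P"
  define a where "a X Z W = g (R (bet X) (gam Y) Z) W" for X Z W
  define t where "t Z X W = g (DT (bet Z) Y X) W" for Z X W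
  define q where "q X Z W = g (T (Ph X Y) Z) W" for X Z W
  have ex: "a X Z W = a Z X W + t Z X W - t X Z W + q X Z W - q Z X W" if "X \<in> P" "Z \<in> P" "W \<in> P" for X Z W
    using arg_cong[OF hv_bianchi[of X Y Z], of "\<lambda>U. g U W"] that
    by (simp add: a_def t_def q_def algebra_simps)
  have sk: "a X Z W = - a X W Z" if "X \<in> P" "Z \<in> P" "W \<in> P" for X Z W
    unfolding a_def using that by (intro R_skew_metric) simp_all
  have ts: "t X Z W = t X W Z" if "X \<in> P" "Z \<in> P" "W \<in> P" for X Z W
    unfolding t_def using that by (intro DT_sym_metric) simp_all
  have qs: "q X Z W = q X W Z" if "X \<in> P" "Z \<in> P" "W \<in> P" for X Z W
    unfolding q_def using that by (intro torsion_sym) simp_all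
  have z: "t X et W = 0" "q X et W = 0" "t X W et = 0" "q X W et = 0" if "X \<in> P" "W \<in> P" for X W
    using that ts[of X et W] qs[of X et W] by (simp_all add: t_def q_def)
  have ex': "a X Z W - a Z X W = t Z X W - t X Z W + q X Z W - q Z X W" if "X \<in> P" "Z \<in> P" "W \<in> P" for X Z W
    by (subst ex[OF that]) simp
  \<comment> \<open>Each bracketed difference is given by \<open>ex'\<close>. The signs are chosen
    so that, after skewness in the last two arguments, all terms except the two copies of
    \<open>a X et W\<close> cancel.\<close>
  have "a X et W + a X et W = (a X et W - a et X W) - (a et W X - a W et X) + (a W X et - a X W et)"
    by (simp add: sk[of et W X] sk[of W X et] sk[of X W et])
  also have "\<dots> = (t et X W - q et X W) + (t et X W - q et X W)"
    unfolding ex'[OF \<open>X \<in> P\<close> et_closed \<open>W \<in> P\<close>] ex'[OF et_closed \<open>W \<in> P\<close> \<open>X \<in> P\<close>] ex'[OF \<open>W \<in> P\<close> \<open>X \<in> P\<close> et_closed]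
    by (simp add: z ts[of et W X] qs[of et W X] algebra_simps)
  finally have "a X et W + a X et W = (t et X W - q et X W) + (t et X W - q et X W)" .
  then have "a X et W = t et X W - q et X W"
    by (rule F_double[rotated 2]) (simp_all add: a_def t_def q_def)
  then show "g (Ph X Y) W = g (DT (bet et) Y X - T (Ph et Y) X) W"
    by (simp add: a_def t_def q_def Ph_def)
qed auto

text \<open>For \<open>X = et\<close> the right-hand side of \<open>Ph_et_left\<close> vanishes,
  since the torsion and its horizontal derivatives kill \<open>et\<close>. This in turn removes the
  correction term of \<open>Ph_et_left\<close> for general \<open>X\<close>.\<close>

lemma Ph_et [simp]: "Y \<in> P \<Longrightarrow> Ph et Y = 0"
  using Ph_et_left[of Y et] by simp

lemma Ph_eq: "X \<in> P \<Longrightarrow> Y \<in> P \<Longrightarrow> Ph X Y = DT (bet et) Y X"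
  using Ph_et_left[of Y X] by simp

lemma Ph_sym_metric: "X \<in> P \<Longrightarrow> Y \<in> P \<Longrightarrow> Z \<in> P \<Longrightarrow> g (Ph X Y) Z = g (Ph X Z) Y"
  using DT_sym_metric[of "bet et" X Y Z] DT_sym[of "bet et"] by (simp add: Ph_eq)

end

section \<open>Comparison of the Hashiguchi and Cartan connections\<close>

locale hashiguchi_conn = horizontal_conn +
  assumes Ph_zero: "X \<in> P \<Longrightarrow> Y \<in> P \<Longrightarrow> Ph X Y = 0"
    and conservative: "X \<in> P \<Longrightarrow> act (bet X) E = 0"

locale finsler_pair =
  C: cartan_conn V P F act br rh gam fl et E D bet + H: hashiguchi_conn V P F act br rh gam fl et E Ds bs
  for V :: "'a::ab_group_add set" and P :: "'b::ab_group_add set" and F :: "'c::ab_group_add set"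
    and act br rh gam fl et E D bet Ds bs
begin

lemma T_eq: "X \<in> P \<Longrightarrow> Y \<in> P \<Longrightarrow> H.T X Y = C.T X Y"
proof (rule C.g_nondegenerate)
  fix Z assume [simp]: "X \<in> P" "Y \<in> P" "Z \<in> P"
  have "C.g (H.T X Y) Z + C.g (H.T X Y) Z = C.g (C.T X Y) Z + C.g (C.T X Y) Z"
    using H.dg_eq[of X Y Z] C.dg_eq[of X Y Z] by simp
  then show "C.g (H.T X Y) Z = C.g (C.T X Y) Z" by (rule C.F_double[rotated 2]) simp_all
qed auto

lemma D_gam_eq: "X \<in> P \<Longrightarrow> Y \<in> P \<Longrightarrow> Ds (gam X) Y = D (gam X) Y"
  by (simp add: C.D_gam H.D_gam T_eq)

text \<open>Both sprays project to \<open>et\<close>, so they differ by some \<open>gam U\<close>.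
  Subtracting their Euler--Lagrange equations for the test field \<open>bet X\<close> leaves the
  Hessian \<open>g U X\<close>: the iterated derivative is its first term, and the bracket supplies
  the term with \<open>fl U X\<close>. Nondegeneracy then gives \<open>U = 0\<close>.\<close>

lemma spray_eq: "bs et = bet et"
proof -
  obtain U where [simp]: "U \<in> P" and U: "bs et - bet et = gam U"
    using C.vertical[of "bs et - bet et"] by auto
  have bs: "bs et = bet et + gam U" using U by (simp add: algebra_simps)
  have "C.g U X = 0" if [simp]: "X \<in> P" for X
  proof -
    have "act (bs et) (act (gam (rh (bet X))) E) + act (gam (rh (br (bet X) (bs et)))) E
        = act (bet et) (act (gam (rh (bet X))) E) + act (gam (rh (br (bet X) (bet et)))) E"
      using H.spray[OF H.conservative H.Ph_zero, of "bet X"] C.spray[OF C.act_bet_E C.Ph_et, of "bet X"] by simp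
    then show ?thesis by (simp add: bs C.g_def)
  qed
  then have "U = 0" by (intro C.g_nondegenerate[of U 0]) simp_all
  then show ?thesis using bs by simp
qed

text \<open>By \<open>br_spray\<close> the spray determines the lift. If the two lifts of
  \<open>X\<close> differ by \<open>gam U\<close>, the right-hand side of \<open>br_spray\<close>
  changes by \<open>- gam U\<close> through the bracket and by another \<open>- gam U\<close>
  through its last term, while the left-hand side stays the same.\<close>

lemma bet_eq: "X \<in> P \<Longrightarrow> bs X = bet X"
proof -
  assume [simp]: "X \<in> P"
  obtain U where [simp]: "U \<in> P" and U: "bs X - bet X = gam U"
    using C.vertical[of "bs X - bet X"] by auto
  have bs: "bs X = bet X + gam U" using U by (simp add: algebra_simps)
  have "gam (rh (br (bet et) (bet X))) - bet X = gam (rh (br (bet et) (bs X))) - bs X"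
    using C.br_spray[OF C.Ph_et, of X] H.br_spray[OF H.Ph_zero, of X] by (simp add: spray_eq)
  then have "gam (U + U) = 0" by (simp add: bs algebra_simps)
  then have "U + U = 0" by (rule C.gam_inj[rotated]) simp
  then have "U = 0" by (rule C.P_torsion[rotated]) simp
  then show ?thesis using bs by simp
qed

lemma D_et_eq: "A \<in> V \<Longrightarrow> Ds A et = D A et"
proof -
  assume [simp]: "A \<in> V"
  have "Ds (bet (rh A) + gam (D A et)) et = D A et"
    using H.D_bet_et[of "rh A"] by (simp add: bet_eq)
  then show ?thesis using C.decompose[of A] by simp
qed

text \<open>On vertical fields the connections agree because the torsions do. On horizontal ones,
  \<open>K_br\<close> computes the same vertical part of \<open>br (bet X) (gam Y)\<close> from
  either connection, and for \<open>Ds\<close> the curvature term is absent.\<close>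

lemma Ds_eq: "A \<in> V \<Longrightarrow> Y \<in> P \<Longrightarrow> Ds A Y = D A Y + C.Ph (rh A) Y"
proof -
  assume [simp]: "A \<in> V" "Y \<in> P"
  have "Ds (bet X) Y = D (bet X) Y + C.Ph X Y" if [simp]: "X \<in> P" for X
    using H.K_br[of X Y] C.K_br[of X Y] by (simp add: H.Ph_zero bet_eq D_et_eq add.commute)
  then have "Ds (bet (rh A) + gam (D A et)) Y = D (bet (rh A) + gam (D A et)) Y + C.Ph (rh A) Y"
    by (simp add: D_gam_eq add.assoc add.left_commute add.commute)
  then show ?thesis using C.decompose[of A] by simp
qed

text \<open>Metricity of \<open>D\<close> leaves only the two contributions of \<open>Ph\<close>
  from \<open>Ds_eq\<close>; they coincide by \<open>Ph_sym_metric\<close>, whence the factor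
  two.\<close>

lemma G_eq: "A \<in> V \<Longrightarrow> Z \<in> P \<Longrightarrow> W \<in> P \<Longrightarrow>
    H.G A Z W = - (C.g (C.Ph (rh A) Z) W + C.g (C.Ph (rh A) Z) W)"
  using C.Ph_sym_metric[of "rh A" W Z] C.g_sym[of Z "C.Ph (rh A) W"]
  by (simp add: H.G_def Ds_eq C.act_g)

text \<open>In the Ricci identity for \<open>bs X\<close> and \<open>gam Y\<close> the bracket
  contributes \<open>fl Y X\<close> as first argument of \<open>Ph\<close>, where the covariant
  derivative of the lowered \<open>Ph\<close> has \<open>Ds (gam Y) X\<close>. The discrepancy is
  \<open>T X Y\<close>, the source of the last summand.\<close>

lemma curvature_metric:
  assumes [simp]: "X \<in> P" "Y \<in> P" "Z \<in> P" "W \<in> P"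
  defines "S \<equiv> act (gam Y) (C.g (C.Ph X Z) W) - C.g (C.Ph (Ds (gam Y) X) Z) W
    - C.g (C.Ph X (Ds (gam Y) Z)) W - C.g (C.Ph X Z) (Ds (gam Y) W)"
  shows "C.g (H.R (bs X) (gam Y) Z) W + C.g (H.R (bs X) (gam Y) W) Z =
    S + S + (C.g (C.Ph (C.T X Y) Z) W + C.g (C.Ph (C.T X Y) Z) W)"
proof -
  have "Ds (gam Y) X = fl Y X + C.T X Y" by (simp add: H.D_gam T_eq C.T_sym[of X Y])
  then have "C.Ph (Ds (gam Y) X) Z = C.Ph (fl Y X) Z + C.Ph (C.T X Y) Z" by simp
  moreover have "C.g (H.R (bs X) (gam Y) W) Z = C.g Z (H.R (bs X) (gam Y) W)" by (simp add: C.g_sym)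
  ultimately show ?thesis
    using H.ricci_identity[of "bs X" "gam Y" Z W]
    by (simp add: S_def G_eq algebra_simps)
qed

lemma curvature_hv_bianchi:
  assumes "X \<in> P" "Y \<in> P" "Z \<in> P"
  shows "H.R (bs X) (gam Y) Z - H.R (bs Z) (gam Y) X =
    (Ds (bet Z) (C.T Y X) - C.T (Ds (bet Z) Y) X - C.T Y (Ds (bet Z) X)) -
    (Ds (bet X) (C.T Y Z) - C.T (Ds (bet X) Y) Z - C.T Y (Ds (bet X) Z))"
  using H.hv_bianchi[OF assms] assms by (simp add: H.Ph_zero H.DT_def T_eq bet_eq)

text \<open>The torsion \<open>t\<close> of the map sending \<open>A\<close> to
  \<open>Ds A et\<close> vanishes on vertical pairs, and on mixed pairs because the hv-curvature of
  \<open>Ds\<close> annihilates \<open>et\<close>. Every pair met in the cyclic sum is of one of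
  these kinds, so the values of \<open>t\<close> on horizontal pairs never enter. One of the three
  curvature terms is applied to \<open>Ds (bs X) et = 0\<close>.\<close>

lemma curvature_swap:
  assumes [simp]: "X \<in> P" "Y \<in> P" "Z \<in> P"
  shows "H.R (bs X) (gam Y) Z = H.R (bs X) (gam Z) Y"
proof -
  define t where "t = (\<lambda>A B. Ds A (Ds B et) - Ds B (Ds A et) - Ds (br A B) et)"
  have ad: "additive_on V (\<lambda>A. Ds A et)" "\<And>A. A \<in> V \<Longrightarrow> Ds A et \<in> P" by (auto simp: H.D_left)
  have "additive_on V (\<lambda>A. t A B)" "additive_on V (t B)" if "B \<in> V" for B
    using that by (auto simp: additive_on_def C.V t_def algebra_simps)
  note [simp] = additive_onD[OF this(1)] additive_onD[OF this(2)]
  have vv: "t (gam A) (gam B) = 0" if "A \<in> P" "B \<in> P" for A B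
    unfolding t_def using H.K_torsion_vv[OF that] that by (simp only: H.D_gam_et)
  have hv: "t (bs A) (gam B) = 0" "t (gam B) (bs A) = 0" if "A \<in> P" "B \<in> P" for A B
    using that by (simp_all add: t_def H.K_br H.Ph_zero C.br_skew[of "gam B"])
  have br1: "t (br (bs A) (gam B)) (gam C) = 0" "t (br (gam B) (bs A)) (gam C) = 0"
    if "A \<in> P" "B \<in> P" "C \<in> P" for A B C
    using that by (simp_all add: H.br_bet_gam H.Ph_zero vv hv C.br_skew[of "gam B"])
  have br2: "t (br (gam A) (gam B)) (bs C) = 0" if "A \<in> P" "B \<in> P" "C \<in> P" for A B C
    using that by (simp only: C.br_gam hv C.fl_closed C.closed)
  have "H.R (bs X) (gam Y) (Ds (gam Z) et) + H.R (gam Y) (gam Z) (Ds (bs X) et) + H.R (gam Z) (bs X) (Ds (gam Y) et) =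
    t (br (bs X) (gam Y)) (gam Z) + t (br (gam Y) (gam Z)) (bs X) + t (br (gam Z) (bs X)) (gam Y)
    - (Ds (bs X) (t (gam Y) (gam Z)) + Ds (gam Y) (t (gam Z) (bs X)) + Ds (gam Z) (t (bs X) (gam Y)))"
    unfolding t_def by (rule H.bianchi1[OF ad]) simp_all
  then show ?thesis using H.R_skew[of "gam Z" "bs X" Y] by (simp add: vv hv br1 br2)
qed

lemma curvature_et_right: "X \<in> P \<Longrightarrow> Y \<in> P \<Longrightarrow> H.R (bs X) (gam et) Y = 0"
  using curvature_swap[of X et Y] H.Ph_zero[of X Y] by (simp add: H.Ph_def)

lemma curvature_et_left:
  assumes [simp]: "X \<in> P" "Y \<in> P"
  shows "H.R (bs et) (gam X) Y = - (Ds (bet et) (C.T X Y) - C.T (Ds (bet et) X) Y - C.T X (Ds (bet et) Y))"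
proof -
  have "H.R (bs Y) (gam X) et = 0" using H.Ph_zero[of Y X] by (simp add: H.Ph_def)
  moreover have "Ds (bet Y) et = 0" using H.D_bet_et[of Y] by (simp add: bet_eq)
  ultimately show ?thesis using curvature_hv_bianchi[of et X Y] by simp
qed

text \<open>Take \<open>gam et\<close> as third field in the second Bianchi identity. Curvatures
  with \<open>gam et\<close> in a slot vanish by \<open>S_et\<close> and
  \<open>curvature_et_right\<close>. The degree -1 comes from the summand \<open>Y\<close> in
  \<open>b1\<close>; the bracket with \<open>bs X\<close> in \<open>b2\<close> has no such extra
  summand.\<close>

lemma curvature_homogeneous:
  assumes [simp]: "X \<in> P" "Y \<in> P" "Z \<in> P"
  shows "Ds (gam et) (H.R (bs X) (gam Y) Z) - H.R (bs (Ds (gam et) X)) (gam Y) Z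
    - H.R (bs X) (gam (Ds (gam et) Y)) Z - H.R (bs X) (gam Y) (Ds (gam et) Z) = - H.R (bs X) (gam Y) Z"
proof -
  have S: "H.R (gam A) (gam et) W = 0" if "A \<in> P" "W \<in> P" for A W
    using H.S_et that .
  have hv: "H.R (gam et) (bs A) W = 0" if "A \<in> P" "W \<in> P" for A W
    using curvature_et_right[OF that] H.R_skew[of "gam et" "bs A" W] that by simp
  have b1: "br (gam Y) (gam et) = gam (Y - Ds (gam et) Y)"
    by (simp add: C.br_gam H.D_gam)
  have b2: "br (gam et) (bs X) = bs (Ds (gam et) X)"
    using C.br_skew[of "gam et" "bs X"] by (simp add: H.br_bet_gam H.Ph_zero H.D_gam)
  have b3: "H.R (br (bs X) (gam Y)) (gam et) Z = 0"
    by (simp add: H.br_bet_gam H.Ph_zero S curvature_et_right)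
  have b4: "H.R (gam (Y - Ds (gam et) Y)) (bs X) Z = H.R (bs X) (gam (Ds (gam et) Y)) Z - H.R (bs X) (gam Y) Z"
    using H.R_skew[of "gam Y" "bs X" Z] H.R_skew[of "gam (Ds (gam et) Y)" "bs X" Z] by simp
  show ?thesis
    using H.bianchi2[of "bs X" "gam Y" "gam et" Z]
    unfolding b1 b2 b3 b4 by (simp add: S hv algebra_simps)
qed

end

section \<open>The calculus of fields on the slit tangent bundle\<close>

context base_atlas
begin

abbreviation TP where "TP \<equiv> points (\<T> A)"

lemma pi_tangent: "X \<in> pi_fields A \<Longrightarrow> u \<in> TP \<Longrightarrow> X u \<in> tangent_space A (fst u)"
  and pi_smooth: "X \<in> pi_fields A \<Longrightarrow> u \<in> TP \<Longrightarrow> smooth_at A f (fst u) \<Longrightarrow> smooth_at (\<T> A) (\<lambda>w. X w f) u"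
  by (auto simp: pi_fields_def)

lemma pi_fieldI:
  "(\<And>u. u \<in> TP \<Longrightarrow> X u \<in> tangent_space A (fst u)) \<Longrightarrow>
   (\<And>u f. u \<in> TP \<Longrightarrow> smooth_at A f (fst u) \<Longrightarrow> smooth_at (\<T> A) (\<lambda>w. X w f) u) \<Longrightarrow> X \<in> pi_fields A"
  by (auto simp: pi_fields_def)

lemma pi_fields_zero: "0 \<in> pi_fields A"
  and pi_fields_add: "X \<in> pi_fields A \<Longrightarrow> Y \<in> pi_fields A \<Longrightarrow> X + Y \<in> pi_fields A"
  and pi_fields_minus: "X \<in> pi_fields A \<Longrightarrow> - X \<in> pi_fields A"
  by (auto simp: pi_fields_def intro: tangent_space_add tangent_space_zero tangent_space_minus
      T.smooth_at_add T.smooth_at_minus T.smooth_at_const)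

lemma pi_fields_diff: "X \<in> pi_fields A \<Longrightarrow> Y \<in> pi_fields A \<Longrightarrow> X - Y \<in> pi_fields A"
  using pi_fields_add[OF _ pi_fields_minus] by fastforce

lemma pi_field_cong:
  assumes X: "X \<in> pi_fields A" and eq: "\<And>u. u \<in> TP \<Longrightarrow> X u = Y u"
  shows "Y \<in> pi_fields A"
proof (rule pi_fieldI)
  fix u assume u: "u \<in> TP"
  show "Y u \<in> tangent_space A (fst u)" using pi_tangent[OF X u] eq[OF u] by simp
  fix f assume f: "smooth_at A f (fst u)"
  show "smooth_at (\<T> A) (\<lambda>w. Y w f) u"
    by (rule T.smooth_at_cong[OF pi_smooth[OF X u f]])
      (use T.nearby_points[OF u] eq in \<open>auto elim: eventually_mono\<close>)
qed

lemma vector_field_cong: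
  assumes B: "B \<in> vector_fields (\<T> A)" and eq: "\<And>u. u \<in> TP \<Longrightarrow> B u = C u"
  shows "C \<in> vector_fields (\<T> A)"
proof (rule T.vector_fieldI)
  fix u assume u: "u \<in> TP"
  show "C u \<in> tangent_space (\<T> A) u" using T.vector_field_tangent[OF B u] eq[OF u] by simp
next
  fix u f assume f: "smooth_at (\<T> A) f u"
  then have u: "u \<in> TP" by (rule T.smooth_at_points)
  show "smooth_at (\<T> A) (\<lambda>w. C w f) u"
    by (rule T.smooth_at_cong[OF T.vector_field_smooth[OF B f]])
      (use T.nearby_points[OF u] eq in \<open>auto elim: eventually_mono\<close>)
qed

lemma eta_pi_field: "eta \<in> pi_fields A"
  by (rule pi_fieldI) (simp_all add: eta_def smooth_at_snd tpoints)

lemma rho_pi_field: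
  assumes B: "B \<in> vector_fields (\<T> A)"
  shows "rho_f A B \<in> pi_fields A"
proof (rule pi_fieldI)
  fix u assume u: "u \<in> TP"
  show "rho A u (B u) \<in> tangent_space A (fst u)" by (rule rho_tangent[OF T.vector_field_tangent[OF B u] u])
  fix f assume f: "smooth_at A f (fst u)"
  show "smooth_at (\<T> A) (\<lambda>w. rho A w (B w) f) u"
    by (rule T.smooth_at_cong[OF T.vector_field_smooth[OF B smooth_at_fst[OF u f]]])
      (use tnearby_fst[OF u smooth_at_nearby[OF f]] in \<open>auto simp: rho_apply elim: eventually_mono\<close>)
qed

lemma vlift_expand:
  assumes c: "(U, \<phi>) \<in> A" "fst u \<in> U" "(tdom A U, tchart \<phi>) \<in> \<T> A" "u \<in> tdom A U"
    and v: "v \<in> tangent_space A (fst u)" and f: "smooth_at (\<T> A) f u"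
  shows "vlift A u v f = (\<Sum>b\<in>Basis. v (\<lambda>q. \<phi> q \<bullet> b) * T.cvec (tdom A U) (tchart \<phi>) u (0, b) f)"
proof -
  interpret l: linear "\<lambda>y. T.cvec (tdom A U) (tchart \<phi>) u y f" by (rule T.cvec_linear[OF c(3,4) f])
  have "(0, comps \<phi> v) = (\<Sum>b\<in>Basis. v (\<lambda>q. \<phi> q \<bullet> b) *\<^sub>R (0::'e, b))"
    by (simp add: comps_def prod_eq_iff fst_sum snd_sum)
  then show ?thesis
    by (simp only: vlift_eq_tcvec[OF c v] l.sum l.scaleR real_scaleR_def)
qed

lemma vlift_vector_field:
  assumes X: "X \<in> pi_fields A"
  shows "vlift_f A X \<in> vector_fields (\<T> A)"
proof (rule T.vector_fieldI)
  fix u assume u: "u \<in> TP"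
  show "vlift A u (X u) \<in> tangent_space (\<T> A) u" by (rule vlift_tangent[OF u pi_tangent[OF X u]])
next
  fix u f assume f: "smooth_at (\<T> A) f u"
  then have u: "u \<in> TP" by (rule T.smooth_at_points)
  obtain U \<phi> where c: "(U, \<phi>) \<in> A" "fst u \<in> U" "(tdom A U, tchart \<phi>) \<in> \<T> A" "u \<in> tdom A U"
    using tpoint_chart[OF u] .
  have "smooth_at (\<T> A) (\<lambda>w. \<Sum>b\<in>Basis. X w (\<lambda>q. \<phi> q \<bullet> b) * T.cvec (tdom A U) (tchart \<phi>) w (0, b) f) u"
    by (intro T.smooth_at_sum u T.smooth_at_mult pi_smooth[OF X u] smooth_at_coordinate[OF c(1,2)] T.smooth_at_cvec[OF c(3,4) f])
  then show "smooth_at (\<T> A) (\<lambda>w. vlift A w (X w) f) u"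
  proof (rule T.smooth_at_cong)
    show "\<forall>\<^sub>F w in T.nearby u. (\<Sum>b\<in>Basis. X w (\<lambda>q. \<phi> q \<bullet> b) * T.cvec (tdom A U) (tchart \<phi>) w (0, b) f) = vlift A w (X w) f"
      using T.nearby_chart[OF c(3,4)] T.smooth_at_nearby[OF f]
    proof eventually_elim
      case (elim w)
      then have "fst w \<in> U" and w: "w \<in> TP" using T.chart_points[OF c(3)] by (auto simp: tdom_iff)
      then show ?case using vlift_expand[OF c(1) _ c(3) elim(1) pi_tangent[OF X w] elim(2)] by simp
    qed
  qed
qed

text \<open>The flat connection along the fibres: \<open>flat_d X Y\<close> differentiates the components of \<open>Y\<close>.\<close>

definition flat_d :: "('m tb \<Rightarrow> 'm tvec) \<Rightarrow> ('m tb \<Rightarrow> 'm tvec) \<Rightarrow> 'm tb \<Rightarrow> 'm tvec" where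
  "flat_d X Y u = (\<lambda>f. if smooth_at A f (fst u) then vlift A u (X u) (\<lambda>w. Y w f) else 0)"

lemma flat_d_pi_field:
  assumes X: "X \<in> pi_fields A" and Y: "Y \<in> pi_fields A"
  shows "flat_d X Y \<in> pi_fields A"
proof (rule pi_fieldI)
  fix u assume u: "u \<in> TP"
  note v = vlift_tangent[OF u pi_tangent[OF X u]]
  note ev = T.nearby_points[OF u]
  show "flat_d X Y u \<in> tangent_space A (fst u)"
  proof (rule tangentI)
    fix f g assume f: "smooth_at A f (fst u)" and g: "smooth_at A g (fst u)"
    note evf = tnearby_fst[OF u smooth_at_nearby[OF f]] and evg = tnearby_fst[OF u smooth_at_nearby[OF g]]
    have "\<forall>\<^sub>F w in T.nearby u. Y w (\<lambda>x. f x + g x) = Y w f + Y w g"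
      using ev evf evg by eventually_elim (rule tangent_add[OF pi_tangent[OF Y]])
    from T.tangent_cong[OF v this]
    show "flat_d X Y u (\<lambda>x. f x + g x) = flat_d X Y u f + flat_d X Y u g"
      using f g by (simp add: flat_d_def smooth_at_add T.tangent_add[OF v] pi_smooth[OF Y u])
    have "\<forall>\<^sub>F w in T.nearby u. Y w (\<lambda>x. f x * g x) = f (fst w) * Y w g + g (fst w) * Y w f"
      using ev evf evg by eventually_elim (rule tangent_mult[OF pi_tangent[OF Y]])
    from T.tangent_cong[OF v this]
    have *: "vlift A u (X u) (\<lambda>w. Y w (\<lambda>x. f x * g x))
        = vlift A u (X u) (\<lambda>w. f (fst w) * Y w g) + vlift A u (X u) (\<lambda>w. g (fst w) * Y w f)"
      using f g by (simp add: T.tangent_add[OF v] T.smooth_at_mult smooth_at_fst u pi_smooth[OF Y u])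
    have "vlift A u (X u) (\<lambda>w. h (fst w)) = 0" if "smooth_at A h (fst u)" for h
      using rho_vlift[OF u pi_tangent[OF X u]] rho_apply[OF that] by (metis zero_fun_apply)
    then show "flat_d X Y u (\<lambda>x. f x * g x) = f (fst u) * flat_d X Y u g + g (fst u) * flat_d X Y u f"
      using f g * by (simp add: flat_d_def smooth_at_mult T.tangent_mult[OF v] smooth_at_fst u pi_smooth[OF Y u])
  next
    fix k f assume f: "smooth_at A f (fst u)"
    have "\<forall>\<^sub>F w in T.nearby u. Y w (\<lambda>x. k * f x) = k * Y w f"
      using ev tnearby_fst[OF u smooth_at_nearby[OF f]] by eventually_elim (rule tangent_cmult[OF pi_tangent[OF Y]])
    from T.tangent_cong[OF v this]
    show "flat_d X Y u (\<lambda>x. k * f x) = k * flat_d X Y u f"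
      using f by (simp add: flat_d_def smooth_at_cmult T.tangent_cmult[OF v] pi_smooth[OF Y u])
  qed (simp add: flat_d_def)
  fix f assume f: "smooth_at A f (fst u)"
  show "smooth_at (\<T> A) (\<lambda>w. flat_d X Y w f) u"
    by (rule T.smooth_at_cong[OF T.vector_field_smooth[OF vlift_vector_field[OF X] pi_smooth[OF Y u f]]])
      (use tnearby_fst[OF u smooth_at_nearby[OF f]] in \<open>auto simp: flat_d_def elim: eventually_mono\<close>)
qed

lemma vlift_flat_d:
  assumes X: "X \<in> pi_fields A" and Y: "Y \<in> pi_fields A" and u: "u \<in> TP" and f: "smooth_at A f (fst u)"
    and a: "a \<in> tangent_space (\<T> A) u"
  shows "a (\<lambda>w. flat_d X Y w f) = a (\<lambda>w. vlift A w (X w) (\<lambda>w. Y w f))"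
  by (rule T.tangent_cong[OF a])
    (use tnearby_fst[OF u smooth_at_nearby[OF f]] in \<open>auto simp: flat_d_def elim: eventually_mono\<close>)

lemma flat_d_add:
  assumes "X \<in> pi_fields A" "Y \<in> pi_fields A" "Z \<in> pi_fields A" and u: "u \<in> TP"
  shows "flat_d (X + Y) Z u = flat_d X Z u + flat_d Y Z u"
    and "flat_d Z (X + Y) u = flat_d Z X u + flat_d Z Y u"
  using T.tangent_add[OF vlift_tangent[OF u pi_tangent[OF assms(3) u]]] pi_smooth[OF assms(1) u] pi_smooth[OF assms(2) u]
  by (auto simp: fun_eq_iff flat_d_def vlift_add[OF u] pi_tangent assms)

lemma flat_d_eta:
  assumes "X \<in> pi_fields A" and u: "u \<in> TP"
  shows "flat_d X eta u = X u"
proof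
  fix f
  show "flat_d X eta u f = X u f"
    using vlift_snd[OF u pi_tangent[OF assms]] tangent_undefined[OF pi_tangent[OF assms], of f]
    by (simp add: flat_d_def eta_def)
qed

text \<open>\<open>B\<close> is required to be tangent at \<open>u\<close> only, not smooth: on
  functions pulled back from the base it acts through its projection \<open>Y\<close>. This permits
  its use for horizontal lifts before their smoothness is known.\<close>

lemma rho_lie_bracket_vlift:
  assumes X: "X \<in> pi_fields A" and u: "u \<in> TP"
    and B: "B u \<in> tangent_space (\<T> A) u" and Y: "\<And>w. w \<in> TP \<Longrightarrow> rho A w (B w) = Y w"
  shows "rho A u (lie_bracket (\<T> A) (vlift_f A X) B u) = flat_d X Y u"
proof
  fix f
  show "rho A u (lie_bracket (\<T> A) (vlift_f A X) B u) f = flat_d X Y u f"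
  proof (cases "smooth_at A f (fst u)")
    case f: True
    have "B u (\<lambda>w. vlift A w (X w) (\<lambda>w. f (fst w))) = B u (\<lambda>w. 0)"
    proof (rule T.tangent_cong[OF B])
      show "\<forall>\<^sub>F w in T.nearby u. vlift A w (X w) (\<lambda>w. f (fst w)) = 0"
        using T.nearby_points[OF u] tnearby_fst[OF u smooth_at_nearby[OF f]]
      proof eventually_elim
        case (elim w)
        then show ?case using rho_vlift[OF elim(1) pi_tangent[OF X elim(1)]] rho_apply[OF elim(2)] by (metis zero_fun_apply)
      qed
    qed
    moreover have "vlift A u (X u) (\<lambda>w. B w (\<lambda>w. f (fst w))) = vlift A u (X u) (\<lambda>w. Y w f)"
    proof (rule T.tangent_cong[OF vlift_tangent[OF u pi_tangent[OF X u]]])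
      show "\<forall>\<^sub>F w in T.nearby u. B w (\<lambda>w. f (fst w)) = Y w f"
        using T.nearby_points[OF u] tnearby_fst[OF u smooth_at_nearby[OF f]]
        by eventually_elim (simp add: Y[symmetric] rho_apply)
    qed
    ultimately show ?thesis using f smooth_at_fst[OF u f] T.tangent_const[OF B]
      by (simp add: rho_apply lie_bracket_def flat_d_def)
  qed (simp add: rho_def flat_d_def)
qed

lemma vertical_eqI:
  assumes u: "u \<in> TP" and a: "a \<in> tangent_space (\<T> A) u" "rho A u a = 0" and v: "v \<in> tangent_space A (fst u)"
    and eq: "\<And>f. smooth_at A f (fst u) \<Longrightarrow> a (\<lambda>w. snd w f) = v f"
  shows "a = vlift A u v"
proof -
  obtain v' where v': "v' \<in> tangent_space A (fst u)" "a = vlift A u v'"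
    using vertical_eq_vlift[OF u a] .
  have "v' = v"
  proof (rule tangent_eqI[OF v'(1) v])
    show "v' f = v f" if "smooth_at A f (fst u)" for f
      using eq[OF that] vlift_snd[OF u v'(1) that] v'(2) by simp
  qed
  then show ?thesis using v' by simp
qed

lemma lie_bracket_vlift:
  assumes X: "X \<in> pi_fields A" and Y: "Y \<in> pi_fields A" and u: "u \<in> TP"
  shows "lie_bracket (\<T> A) (vlift_f A X) (vlift_f A Y) u = vlift A u ((flat_d X Y - flat_d Y X) u)"
proof (rule vertical_eqI[OF u])
  note VX = vlift_vector_field[OF X] and VY = vlift_vector_field[OF Y]
  show "lie_bracket (\<T> A) (vlift_f A X) (vlift_f A Y) u \<in> tangent_space (\<T> A) u"
    by (rule T.vector_field_tangent[OF T.lie_bracket_vector_fields[OF VX VY] u])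
  show "(flat_d X Y - flat_d Y X) u \<in> tangent_space A (fst u)"
    by (rule pi_tangent[OF pi_fields_diff[OF flat_d_pi_field[OF X Y] flat_d_pi_field[OF Y X]] u])
  have "rho A u (lie_bracket (\<T> A) (vlift_f A X) (vlift_f A Y) u) = flat_d X 0 u"
    by (rule rho_lie_bracket_vlift[OF X u, of "vlift_f A Y" 0])
      (simp_all add: vlift_tangent u rho_vlift pi_tangent[OF Y])
  then show "rho A u (lie_bracket (\<T> A) (vlift_f A X) (vlift_f A Y) u) = 0"
    using T.tangent_const[OF vlift_tangent[OF u pi_tangent[OF X u]], of 0] by (auto simp: flat_d_def fun_eq_iff)
  fix f assume f: "smooth_at A f (fst u)"
  have *: "vlift A u (Z u) (\<lambda>w. vlift A w (W w) (\<lambda>w. snd w f)) = flat_d Z W u f"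
    if Z: "Z \<in> pi_fields A" and W: "W \<in> pi_fields A" for Z W
  proof -
    have "vlift A u (Z u) (\<lambda>w. vlift A w (W w) (\<lambda>w. snd w f)) = vlift A u (Z u) (\<lambda>w. W w f)"
    proof (rule T.tangent_cong[OF vlift_tangent[OF u pi_tangent[OF Z u]]])
      show "\<forall>\<^sub>F w in T.nearby u. vlift A w (W w) (\<lambda>w. snd w f) = W w f"
        using T.nearby_points[OF u] tnearby_fst[OF u smooth_at_nearby[OF f]]
        by eventually_elim (rule vlift_snd[OF _ pi_tangent[OF W]])
    qed
    then show ?thesis using f by (simp add: flat_d_def)
  qed
  show "lie_bracket (\<T> A) (vlift_f A X) (vlift_f A Y) u (\<lambda>w. snd w f) = (flat_d X Y - flat_d Y X) u f"
    using smooth_at_snd[OF u f] *[OF X Y] *[OF Y X] by (simp add: lie_bracket_def)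
qed

text \<open>Flatness is the commutator formula \<open>lie_bracket_vlift\<close>, applied to the
  functions that send \<open>w\<close> to \<open>Z w f\<close>.\<close>

lemma flat_d_flat:
  assumes X: "X \<in> pi_fields A" and Y: "Y \<in> pi_fields A" and Z: "Z \<in> pi_fields A" and u: "u \<in> TP"
  shows "flat_d X (flat_d Y Z) u - flat_d Y (flat_d X Z) u = flat_d (flat_d X Y - flat_d Y X) Z u"
proof
  fix f
  show "(flat_d X (flat_d Y Z) u - flat_d Y (flat_d X Z) u) f = flat_d (flat_d X Y - flat_d Y X) Z u f"
  proof (cases "smooth_at A f (fst u)")
    case f: True
    note t = vlift_tangent[OF u pi_tangent[OF X u]] vlift_tangent[OF u pi_tangent[OF Y u]]
    have "vlift A u ((flat_d X Y - flat_d Y X) u) (\<lambda>w. Z w f) =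
      lie_bracket (\<T> A) (vlift_f A X) (vlift_f A Y) u (\<lambda>w. Z w f)"
      by (simp only: lie_bracket_vlift[OF X Y u])
    then show ?thesis
      using f pi_smooth[OF Z u f]
      by (simp add: flat_d_def[of "flat_d X Y - flat_d Y X"] lie_bracket_def)
        (simp add: flat_d_def[of _ "flat_d _ _"] vlift_flat_d[OF X Z u f t(2)] vlift_flat_d[OF Y Z u f t(1)])
  qed (simp add: flat_d_def)
qed

lemma vertical_field:
  assumes B: "B \<in> vector_fields (\<T> A)" and "\<And>u. u \<in> TP \<Longrightarrow> rho A u (B u) = 0"
  obtains X where "X \<in> pi_fields A" "\<And>u. u \<in> TP \<Longrightarrow> B u = vlift A u (X u)"
proof -
  \<comment> \<open>By \<open>vlift_snd\<close> this formula recovers the lifted vector; unlike a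
    pointwise choice of that vector, it is smooth in \<open>u\<close> because \<open>B\<close>
    is.\<close>
  define X where "X u = (\<lambda>f. if smooth_at A f (fst u) then B u (\<lambda>w. snd w f) else 0)" for u
  have X: "B u = vlift A u (X u) \<and> X u \<in> tangent_space A (fst u)" if u: "u \<in> TP" for u
  proof -
    obtain v where v: "v \<in> tangent_space A (fst u)" "B u = vlift A u v"
      using vertical_eq_vlift[OF u T.vector_field_tangent[OF B u] assms(2)[OF u]] .
    have "X u = v"
      using vlift_snd[OF u v(1)] v tangent_undefined[OF v(1)] by (auto simp: X_def fun_eq_iff)
    then show ?thesis using v by simp
  qed
  have "X \<in> pi_fields A"
  proof (rule pi_fieldI)
    fix u f assume u: "u \<in> TP" and f: "smooth_at A f (fst u)"
    show "smooth_at (\<T> A) (\<lambda>w. X w f) u"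
      by (rule T.smooth_at_cong[OF T.vector_field_smooth[OF B smooth_at_snd[OF u f]]])
        (use tnearby_fst[OF u smooth_at_nearby[OF f]] in \<open>auto simp: X_def elim: eventually_mono\<close>)
  qed (use X in auto)
  with X that show ?thesis by blast
qed

lemma vlift_inj:
  assumes u: "u \<in> TP" and v: "v \<in> tangent_space A (fst u)" and "vlift A u v = 0"
  shows "v = 0"
proof (rule tangent_eqI[OF v tangent_space_zero])
  show "v f = 0 f" if "smooth_at A f (fst u)" for f
    using vlift_snd[OF u v that] assms(3) by simp
qed

end

section \<open>Manifolds and Finsler structures as instances of the atlas calculus\<close>

lemma smooth_manifold_base_atlas:
  assumes "smooth_manifold X \<A>"
  shows "base_atlas \<A>"
proof unfold_locales
  have op: "openin X U" and im: "open (\<phi> ` U)"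
    and hm: "homeomorphic_map (subtopology X U) (top_of_set (\<phi> ` U)) \<phi>" if "(U, \<phi>) \<in> \<A>" for U \<phi>
    using assms that unfolding smooth_manifold_def by fast+
  have ts: "topspace (subtopology X U) = U" if "(U, \<phi>) \<in> \<A>" for U \<phi>
    using openin_subset[OF op[OF that]] by auto
  show "inj_on \<phi> U" if "(U, \<phi>) \<in> \<A>" for U \<phi>
    using homeomorphic_imp_injective_map[OF hm[OF that]] ts[OF that] by simp
  show "open (\<phi> ` (U \<inter> V))" if c: "(U, \<phi>) \<in> \<A>" and d: "(V, \<psi>) \<in> \<A>" for U \<phi> V \<psi>
  proof -
    have "openin (subtopology X U) (U \<inter> V)"
      using op[OF d] by (metis inf_commute openin_subtopology_Int)
    then have "openin (top_of_set (\<phi> ` U)) (\<phi> ` (U \<inter> V))"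
      using homeomorphic_imp_open_map[OF hm[OF c]] unfolding open_map_def by blast
    then show ?thesis using openin_open_trans[OF _ im[OF c]] by blast
  qed
  show "smooth_on (\<phi> ` (U \<inter> V)) (\<psi> \<circ> inv_into U \<phi>)" if "(U, \<phi>) \<in> \<A>" "(V, \<psi>) \<in> \<A>" for U \<phi> V \<psi>
    using assms that unfolding smooth_manifold_def by fast
qed

locale finsler_space =
  fixes M :: "'m topology" and A :: "('m, 'e::euclidean_space) chart set" and L :: "'m tb \<Rightarrow> real"
  assumes finsler: "finsler_manifold M A L"
begin

lemma smooth_manifold: "smooth_manifold M A"
  using finsler by (simp add: finsler_manifold_def)

sublocale base_atlas A
  by (rule smooth_manifold_base_atlas[OF smooth_manifold])

text \<open>The Hausdorff property enters here: the part of the chart over a closed coordinate ball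
  is compact, hence closed in \<open>M\<close>, so extending the local bump function by zero is
  smooth outside the chart too.\<close>

lemma bump_on_manifold:
  assumes c: "(U, \<phi>) \<in> A" "p \<in> U"
  obtains bmp :: "'m \<Rightarrow> real" where "\<And>q. q \<in> points A \<Longrightarrow> smooth_at A bmp q"
    "\<forall>\<^sub>F q in nearby p. bmp q = 1" "\<And>q. q \<in> points A \<Longrightarrow> q \<notin> U \<Longrightarrow> \<forall>\<^sub>F r in nearby q. bmp r = 0"
proof -
  have op: "openin M U" and hm: "homeomorphic_map (subtopology M U) (top_of_set (\<phi> ` U)) \<phi>" if "(U, \<phi>) \<in> A" for U \<phi>
    using smooth_manifold that unfolding smooth_manifold_def by fast+
  have haus: "Hausdorff_space M" and ptM: "points A = topspace M"
    using smooth_manifold unfolding smooth_manifold_def points_def by auto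
  obtain r where r: "r > 0" "cball (\<phi> p) r \<subseteq> \<phi> ` U"
    using open_chart[OF c(1)] c(2) open_contains_cball by blast
  obtain \<psi> r' where \<psi>: "smooth_on UNIV \<psi>" "0 < r'" "\<And>x. x \<in> ball (\<phi> p) r' \<Longrightarrow> \<psi> x = 1"
    "\<And>x. x \<notin> ball (\<phi> p) r \<Longrightarrow> \<psi> x = (0::real)"
    using bump_function[OF r(1), of "\<phi> p"] by blast
  define bmp where "bmp q = (if q \<in> U then \<psi> (\<phi> q) else 0)" for q
  define S where "S = {q \<in> U. \<phi> q \<in> cball (\<phi> p) r}"
  have "\<phi> ` S = cball (\<phi> p) r" using r(2) by (auto simp: S_def)
  then have "compactin (top_of_set (\<phi> ` U)) (\<phi> ` S)"
    using r(2) by (simp add: compactin_subtopology)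
  moreover have "S \<subseteq> topspace (subtopology M U)" using openin_subset[OF op[OF c(1)]] by (auto simp: S_def)
  ultimately have "compactin (subtopology M U) S"
    using homeomorphic_map_compactness[OF hm[OF c(1)]] by blast
  then have "compactin M S" by (simp add: compactin_subtopology)
  then have "closedin M S" by (rule compactin_imp_closedin[OF haus])
  then have opS: "openin M (topspace M - S)" by (simp add: openin_diff)
  have zero: "\<forall>\<^sub>F r in nearby q. bmp r = 0" if q: "q \<in> points A" "q \<notin> U" for q
  proof -
    obtain V \<phi>' where d: "(V, \<phi>') \<in> A" "q \<in> V" using points_chart[OF q(1)] by blast
    let ?W = "V \<inter> (topspace M - S)"
    have "openin (subtopology M V) ?W" using opS by (metis inf_commute openin_subtopology_Int)
    then have "openin (top_of_set (\<phi>' ` V)) (\<phi>' ` ?W)"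
      using homeomorphic_imp_open_map[OF hm[OF d(1)]] unfolding open_map_def by blast
    then have "open (\<phi>' ` ?W)" using openin_open_trans[OF _ open_chart[OF d(1)]] by blast
    moreover have "\<phi>' q \<in> \<phi>' ` ?W" using d q ptM by (auto simp: S_def)
    ultimately have "\<forall>\<^sub>F r in nearby q. r \<in> V \<and> \<phi>' r \<in> \<phi>' ` ?W" by (rule nearby_open[OF d])
    then show ?thesis
    proof eventually_elim
      case (elim r)
      then have "r \<notin> S" using inj_chart[OF d(1)] by (auto dest: inj_onD)
      then show ?case using \<psi>(4)[of "\<phi> r"] by (auto simp: S_def bmp_def)
    qed
  qed
  show ?thesis
  proof (rule that)
    fix q assume q: "q \<in> points A"
    show "smooth_at A bmp q"
    proof (cases "q \<in> U")
      case True
      have "smooth_at A (\<lambda>q. \<psi> (\<phi> q)) q" by (rule smooth_at_chart_compose[OF c(1) True open_UNIV _ \<psi>(1)]) simp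
      then show ?thesis
        by (rule smooth_at_cong) (use nearby_chart[OF c(1) True] in \<open>auto simp: bmp_def elim: eventually_mono\<close>)
    next
      case False
      show ?thesis
        by (rule smooth_at_cong[OF smooth_at_const[OF q, of 0]])
          (use zero[OF q False] in \<open>auto elim: eventually_mono\<close>)
    qed
  next
    show "\<forall>\<^sub>F q in nearby p. bmp q = 1"
      using nearby_open[OF c open_ball, of "\<phi> p" r'] \<psi>(2)
      by (auto simp: bmp_def \<psi>(3) elim: eventually_mono)
  qed (rule zero)
qed

subsection \<open>Energy and metric\<close>

definition energy :: "'m tb \<Rightarrow> real" where
  "energy u = 1/2 * (L u)\<^sup>2"

lemma L_smooth: "u \<in> TP \<Longrightarrow> smooth_at (\<T> A) L u"
  using finsler by (auto simp: finsler_manifold_def smooth_functions_def)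

lemma energy_smooth: "u \<in> TP \<Longrightarrow> smooth_at (\<T> A) energy u"
  using T.smooth_at_cmult[OF T.smooth_at_mult[OF L_smooth L_smooth], of u "1/2"]
  by (simp add: energy_def[abs_def] power2_eq_square)

lemma energy_homogeneous:
  assumes u: "u \<in> TP"
  shows "vlift A u (snd u) energy = energy u + energy u"
proof -
  have L: "L (fst u, k *\<^sub>t snd u) = k * L u" if "k > 0" for k
    using finsler u that unfolding finsler_manifold_def by (simp add: tpoints)
  have v: "snd u \<in> tangent_space A (fst u)" using u by (simp add: tpoints)
  have "((\<lambda>s. (1 + s)\<^sup>2 * energy u) has_real_derivative energy u + energy u) (at 0)"
    by (auto intro!: derivative_eq_intros)
  then have "((\<lambda>s. energy (fst u, snd u + s *\<^sub>t snd u)) has_real_derivative energy u + energy u) (at 0)"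
  \<comment> \<open>Homogeneity is positive only, so the factor \<open>1 + s\<close> has to stay
    positive.\<close>
  proof (rule has_field_derivative_transform_within_open[where S = "{-1<..}"])
    fix s :: real assume "s \<in> {-1<..}"
    moreover have "snd u + s *\<^sub>t snd u = (1 + s) *\<^sub>t snd u" by (simp add: fun_eq_iff scale_def algebra_simps)
    ultimately show "(1 + s)\<^sup>2 * energy u = energy (fst u, snd u + s *\<^sub>t snd u)"
      using L[of "1 + s"] by (simp add: energy_def power_mult_distrib)
  qed auto
  then show ?thesis using vlift_has_derivative[OF u v energy_smooth[OF u]] DERIV_unique by blast
qed

lemma eventually_fibre:
  assumes u: "u \<in> TP" and v: "v \<in> tangent_space A (fst u)"
  shows "\<forall>\<^sub>F s in nhds 0. (fst u, snd u + s *\<^sub>t v) \<in> TP"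
proof -
  obtain U \<phi> where c: "(U, \<phi>) \<in> A" "fst u \<in> U" "(tdom A U, tchart \<phi>) \<in> \<T> A" "u \<in> tdom A U"
    using tpoint_chart[OF u] .
  have u': "fst u \<in> points A" "snd u \<in> tangent_space A (fst u)" "snd u \<noteq> 0" using u by (simp_all add: tpoints)
  have "continuous_on UNIV (\<lambda>s. comps \<phi> (snd u) + s *\<^sub>R comps \<phi> v)"
    by (intro continuous_intros)
  then have "open ((\<lambda>s. comps \<phi> (snd u) + s *\<^sub>R comps \<phi> v) -` (- {0}))"
    by (intro open_vimage) auto
  moreover have "0 \<in> (\<lambda>s. comps \<phi> (snd u) + s *\<^sub>R comps \<phi> v) -` (- {0})"
    using u' comps_eq_zero_iff[OF c(1,2)] by simp
  ultimately have "\<forall>\<^sub>F s in nhds 0. s \<in> (\<lambda>s. comps \<phi> (snd u) + s *\<^sub>R comps \<phi> v) -` (- {0})"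
    by (rule eventually_nhds_in_open)
  then show ?thesis
  proof eventually_elim
    case (elim s)
    have "snd u + s *\<^sub>t v \<in> tangent_space A (fst u)"
      by (intro tangent_space_add tangent_space_scale u' v)
    moreover have "snd u + s *\<^sub>t v \<noteq> 0"
      using elim comps_zero[OF c(1,2)] by (auto simp flip: comps_scale[OF c(1,2)] comps_add[OF c(1,2)])
    ultimately show ?case using u' by (simp add: tpoints)
  qed
qed

text \<open>\<open>finsler_metric\<close> differentiates with its last argument frozen at
  \<open>Z u\<close>. Letting \<open>Z\<close> vary along the fibre adds, by the product rule, the
  derivative of the components of \<open>Z\<close>, and this is the term with
  \<open>flat_d\<close>.\<close>

lemma metric_eq:
  assumes X: "X \<in> pi_fields A" and Z: "Z \<in> pi_fields A" and u: "u \<in> TP"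
  shows "metric_f L X Z u = vlift A u (X u) (\<lambda>w. vlift A w (Z w) energy) - vlift A u (flat_d X Z u) energy"
proof -
  obtain U \<phi> where c: "(U, \<phi>) \<in> A" "fst u \<in> U" "(tdom A U, tchart \<phi>) \<in> \<T> A" "u \<in> tdom A U"
    using tpoint_chart[OF u] .
  let ?v = "X u" and ?z = "\<lambda>w b. Z w (\<lambda>q. \<phi> q \<bullet> b)"
  let ?G = "\<lambda>b w. T.cvec (tdom A U) (tchart \<phi>) w (0, b) energy"
  note v = pi_tangent[OF X u]
  note t = vlift_tangent[OF u v]
  have G: "smooth_at (\<T> A) (?G b) u" for b by (rule T.smooth_at_cvec[OF c(3,4) energy_smooth[OF u]])
  have z: "smooth_at (\<T> A) (\<lambda>w. ?z w b) u" for b by (rule pi_smooth[OF Z u smooth_at_coordinate[OF c(1,2)]])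
  have "vlift A u ?v (\<lambda>w. vlift A w (Z w) energy) = vlift A u ?v (\<lambda>w. \<Sum>b\<in>Basis. ?z w b * ?G b w)"
  proof (rule T.tangent_cong[OF t])
    show "\<forall>\<^sub>F w in T.nearby u. vlift A w (Z w) energy = (\<Sum>b\<in>Basis. ?z w b * ?G b w)"
      using T.nearby_chart[OF c(3,4)]
    proof eventually_elim
      case (elim w)
      then have w: "w \<in> TP" "fst w \<in> U" using T.chart_points[OF c(3)] by (auto simp: tdom_iff)
      show ?case by (rule vlift_expand[OF c(1) w(2) c(3) elim pi_tangent[OF Z w(1)] energy_smooth[OF w(1)]])
    qed
  qed
  also have "\<dots> = (\<Sum>b\<in>Basis. vlift A u ?v (\<lambda>w. ?z w b * ?G b w))"
    by (intro T.tangent_sum[OF t u] T.smooth_at_mult z G)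
  also have "\<dots> = (\<Sum>b\<in>Basis. ?z u b * vlift A u ?v (?G b) + ?G b u * vlift A u ?v (\<lambda>w. ?z w b))"
    by (intro sum.cong refl T.tangent_mult[OF t] z G)
  finally have 1: "vlift A u ?v (\<lambda>w. vlift A w (Z w) energy) =
    (\<Sum>b\<in>Basis. ?z u b * vlift A u ?v (?G b)) + (\<Sum>b\<in>Basis. ?G b u * vlift A u ?v (\<lambda>w. ?z w b))"
    by (simp add: sum.distrib)
  have 2: "vlift A u (flat_d X Z u) energy = (\<Sum>b\<in>Basis. ?G b u * vlift A u ?v (\<lambda>w. ?z w b))"
    using vlift_expand[OF c pi_tangent[OF flat_d_pi_field[OF X Z] u] energy_smooth[OF u]]
    by (simp add: flat_d_def smooth_at_coordinate[OF c(1,2)] mult.commute)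
  \<comment> \<open>The derivative of the energy along the fibre vector whose components are frozen
    at those of \<open>Z u\<close>.\<close>
  let ?H = "\<lambda>w. \<Sum>b\<in>Basis. ?z u b * ?G b w"
  have H: "smooth_at (\<T> A) ?H u" by (intro T.smooth_at_sum u T.smooth_at_cmult G)
  have "vlift A u ?v ?H = (\<Sum>b\<in>Basis. ?z u b * vlift A u ?v (?G b))"
    by (simp add: T.tangent_sum[OF t u] T.smooth_at_cmult G T.tangent_cmult[OF t])
  moreover have "metric_f L X Z u = vlift A u ?v ?H"
  proof -
    let ?w = "\<lambda>s. (fst u, snd u + s *\<^sub>t ?v)"
    have inner: "\<forall>\<^sub>F s in nhds 0. deriv (\<lambda>t. (1/2) * (L (fst u, snd u + s *\<^sub>t ?v + t *\<^sub>t Z u))\<^sup>2) 0 = ?H (?w s)"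
      using eventually_fibre[OF u v]
    proof eventually_elim
      case (elim s)
      have Zu: "Z u \<in> tangent_space A (fst (?w s))" using pi_tangent[OF Z u] by simp
      have "?w s \<in> tdom A U" using elim c(2) by (simp add: tpoints tdom_iff)
      then have "vlift A (?w s) (Z u) energy = ?H (?w s)"
        using vlift_expand[OF c(1) _ c(3) _ Zu energy_smooth[OF elim]] c(2) by simp
      moreover have "deriv (\<lambda>t. energy (fst (?w s), snd (?w s) + t *\<^sub>t Z u)) 0 = vlift A (?w s) (Z u) energy"
        by (rule DERIV_imp_deriv[OF vlift_has_derivative[OF elim Zu energy_smooth[OF elim]]])
      ultimately show ?case by (simp add: energy_def)
    qed
    have "((\<lambda>s. ?H (?w s)) has_real_derivative vlift A u ?v ?H) (at 0)"
      by (rule vlift_has_derivative[OF u v H])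
    then have "((\<lambda>s. deriv (\<lambda>t. (1/2) * (L (fst u, snd u + s *\<^sub>t ?v + t *\<^sub>t Z u))\<^sup>2) 0)
        has_real_derivative vlift A u ?v ?H) (at 0)"
      by (subst DERIV_cong_ev[OF refl inner refl])
    then show ?thesis
      unfolding metric_f_def finsler_metric_def by (rule DERIV_imp_deriv)
  qed
  ultimately show ?thesis using 1 2 by simp
qed

end

context finsler_space
begin

text \<open>Fields are cut off to zero outside the slit tangent bundle, so that equality on it becomes
  equality of functions and the algebraic model applies.\<close>

definition zext :: "('m tb \<Rightarrow> 'z::zero) \<Rightarrow> 'm tb \<Rightarrow> 'z" where
  "zext h u = (if u \<in> TP then h u else 0)"

definition VV where "VV = {B \<in> vector_fields (\<T> A). \<forall>u. u \<notin> TP \<longrightarrow> B u = 0}"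
definition PP where "PP = {X \<in> pi_fields A. \<forall>u. u \<notin> TP \<longrightarrow> X u = 0}"
definition FF where "FF = {f \<in> smooth_functions (\<T> A). \<forall>u. u \<notin> TP \<longrightarrow> f u = 0}"

definition nact :: "('m tb \<Rightarrow> 'm tb tvec) \<Rightarrow> ('m tb \<Rightarrow> real) \<Rightarrow> 'm tb \<Rightarrow> real" where "nact B f = zext (dir B f)"
definition nbr where "nbr B C = zext (lie_bracket (\<T> A) B C)"
definition nrh where "nrh B = zext (rho_f A B)"
definition ngam where "ngam X = zext (vlift_f A X)"
definition nfl where "nfl X Y = zext (flat_d X Y)"
definition ncov where "ncov D B Y = zext (cov D B Y)"
definition nbet where "nbet D X = zext (hlift_f A D X)"

lemma zext_in [simp]: "u \<in> TP \<Longrightarrow> zext h u = h u"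
  and zext_out [simp]: "u \<notin> TP \<Longrightarrow> zext h u = 0"
  by (simp_all add: zext_def)

lemma zext_eqI: "(\<And>u. u \<in> TP \<Longrightarrow> h u = k u) \<Longrightarrow> zext h = zext k"
  by (auto simp: zext_def fun_eq_iff)

lemma zext_ext: "(\<And>u. u \<notin> TP \<Longrightarrow> k u = 0) \<Longrightarrow> (\<And>u. u \<in> TP \<Longrightarrow> h u = k u) \<Longrightarrow> zext h = k"
  by (auto simp: zext_def fun_eq_iff)

lemma zext_add: "zext (h + k) = zext h + zext (k :: _ \<Rightarrow> 'z::ab_group_add)"
  and zext_diff: "zext (h - k) = zext h - zext (k :: _ \<Rightarrow> 'z::ab_group_add)"
  and zext_minus: "zext (- h) = - zext (h :: _ \<Rightarrow> 'z::ab_group_add)"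
  by (auto simp: zext_def fun_eq_iff)

lemma zext_VV: "B \<in> vector_fields (\<T> A) \<Longrightarrow> zext B \<in> VV"
  by (auto simp: VV_def intro: vector_field_cong)

lemma zext_PP: "X \<in> pi_fields A \<Longrightarrow> zext X \<in> PP"
  by (auto simp: PP_def intro: pi_field_cong)

lemma VV_D: "B \<in> VV \<Longrightarrow> B \<in> vector_fields (\<T> A)" "B \<in> VV \<Longrightarrow> zext B = B"
  and PP_D: "X \<in> PP \<Longrightarrow> X \<in> pi_fields A" "X \<in> PP \<Longrightarrow> zext X = X"
  by (auto simp: VV_def PP_def intro: zext_ext)

lemma nearby_zext: "u \<in> TP \<Longrightarrow> \<forall>\<^sub>F w in T.nearby u. zext h w = h w"
  using T.nearby_points[of u] by (rule eventually_mono) simp_all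

lemma smooth_at_zext: "u \<in> TP \<Longrightarrow> smooth_at (\<T> A) (zext h) u \<longleftrightarrow> smooth_at (\<T> A) h u"
  by (rule T.smooth_at_cong_iff[OF nearby_zext])

lemma tangent_zext: "u \<in> TP \<Longrightarrow> a \<in> tangent_space (\<T> A) u \<Longrightarrow> a (zext h) = a h"
  by (rule T.tangent_cong[OF _ nearby_zext])

lemma zext_FF: "(\<And>u. u \<in> TP \<Longrightarrow> smooth_at (\<T> A) h u) \<Longrightarrow> zext h \<in> FF"
  by (simp add: FF_def smooth_functions_def smooth_at_zext)

lemma FF_D: "f \<in> FF \<Longrightarrow> u \<in> TP \<Longrightarrow> smooth_at (\<T> A) f u" "f \<in> FF \<Longrightarrow> u \<notin> TP \<Longrightarrow> f u = 0"
  by (simp_all add: FF_def smooth_functions_def del: split_paired_All)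

text \<open>Tangent vectors see germs only, and points of the slit bundle are interior, so cutting
  off the arguments changes nothing there. Read from left to right, such laws translate geometric
  expressions into the model.\<close>

lemma zext_dir: "B \<in> vector_fields (\<T> A) \<Longrightarrow> zext (dir B f) = nact (zext B) (zext f)"
  unfolding nact_def dir_def by (rule zext_eqI) (simp add: tangent_zext[OF _ T.vector_field_tangent])

lemma zext_lie_bracket: "B \<in> vector_fields (\<T> A) \<Longrightarrow> C \<in> vector_fields (\<T> A) \<Longrightarrow>
    zext (lie_bracket (\<T> A) B C) = nbr (zext B) (zext C)"
  unfolding nbr_def by (rule zext_eqI) (rule T.lie_bracket_cong, auto)

lemma zext_rho: "zext (rho_f A B) = nrh (zext B)"
  and zext_vlift: "zext (vlift_f A X) = ngam (zext X)"
  and zext_hlift: "zext (hlift_f A D X) = nbet D (zext X)"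
  unfolding nrh_def ngam_def nbet_def by (rule zext_eqI, simp)+

lemma zext_flat_d: "X \<in> pi_fields A \<Longrightarrow> zext (flat_d X Y) = nfl (zext X) (zext Y)"
proof -
  assume X: "X \<in> pi_fields A"
  have *: "(\<lambda>w. zext Y w f) = zext (\<lambda>w. Y w f)" for f by (auto simp: zext_def fun_eq_iff)
  show ?thesis unfolding nfl_def
  proof (rule zext_eqI, rule ext)
    fix u f assume u: "u \<in> TP"
    show "flat_d X Y u f = flat_d (zext X) (zext Y) u f"
      using tangent_zext[OF u vlift_tangent[OF u pi_tangent[OF X u]], of "\<lambda>w. Y w f"] u
      by (simp add: flat_d_def *)
  qed
qed

lemma VV_subgroup: "additive_subgroup VV"
  and PP_subgroup: "additive_subgroup PP"
  by (simp_all add: additive_subgroup_def VV_def PP_def T.vector_fields_zero T.vector_fields_add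
      T.vector_fields_minus pi_fields_zero pi_fields_add pi_fields_minus del: split_paired_All)

lemma FF_subgroup: "additive_subgroup FF"
  by (simp add: additive_subgroup_def FF_def smooth_functions_def func_zero func_plus fun_Compl_def
      T.smooth_at_const T.smooth_at_add T.smooth_at_minus del: split_paired_All)

section \<open>The fields on the slit tangent bundle as a model\<close>

sublocale calc: vertical_calculus VV PP FF nact nbr nrh ngam nfl "zext eta" "zext energy"
proof
  note V = VV_D(1) and P = PP_D(1)
  note vt = T.vector_field_tangent[OF V] and pt = pi_tangent[OF P]
  show "additive_subgroup VV" "additive_subgroup PP" "additive_subgroup FF"
    by (rule VV_subgroup PP_subgroup FF_subgroup)+
  fix B C E :: "'m tb \<Rightarrow> 'm tb tvec" and X Y Z :: "'m tb \<Rightarrow> 'm tvec" and f :: "'m tb \<Rightarrow> real"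
  show "nact B f \<in> FF" if "B \<in> VV" "f \<in> FF"
    unfolding nact_def dir_def by (rule zext_FF) (use that in \<open>auto intro: T.vector_field_smooth V FF_D\<close>)
  show "additive_on VV (\<lambda>A. nact A f)" if "f \<in> FF"
    by (auto simp: additive_on_def VV_subgroup nact_def dir_def zext_def fun_eq_iff)
  show "additive_on FF (nact B)" if "B \<in> VV"
    using T.tangent_add[OF vt[OF that]]
    by (auto simp: additive_on_def FF_subgroup nact_def dir_def zext_def fun_eq_iff plus_fun_def FF_D)
  show "nbr B C \<in> VV" if "B \<in> VV" "C \<in> VV"
    unfolding nbr_def by (intro zext_VV T.lie_bracket_vector_fields V that)
  show "additive_on VV (nbr B)" if "B \<in> VV"
    using T.lie_bracket_add(2) that V by (auto simp: additive_on_def VV_subgroup nbr_def simp flip: zext_add intro!: zext_eqI)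
  show "additive_on VV (\<lambda>C. nbr C B)" if "B \<in> VV"
    using T.lie_bracket_add(1) that V by (auto simp: additive_on_def VV_subgroup nbr_def simp flip: zext_add intro!: zext_eqI)
  show "nbr B C = - nbr C B" if "B \<in> VV" "C \<in> VV"
    unfolding nbr_def zext_minus[symmetric] by (rule zext_eqI) (auto simp: lie_bracket_def)
  show "nbr B (nbr C E) = nbr (nbr B C) E + nbr C (nbr B E)" if BCE: "B \<in> VV" "C \<in> VV" "E \<in> VV"
  proof -
    have z: "nbr Q R = zext (lie_bracket (\<T> A) Q R)" "lie_bracket (\<T> A) Q R \<in> vector_fields (\<T> A)" if "Q \<in> VV" "R \<in> VV" for Q R
      using that by (auto simp: nbr_def intro: T.lie_bracket_vector_fields V)
    have e: "nbr Q (nbr R S) = zext (lie_bracket (\<T> A) Q (lie_bracket (\<T> A) R S))"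
      "nbr (nbr R S) Q = zext (lie_bracket (\<T> A) (lie_bracket (\<T> A) R S) Q)" if "Q \<in> VV" "R \<in> VV" "S \<in> VV" for Q R S
      using that zext_lie_bracket[OF V[OF that(1)] z(2)[OF that(2,3)]] zext_lie_bracket[OF z(2)[OF that(2,3)] V[OF that(1)]]
      by (simp_all add: VV_D(2) z(1))
    show ?thesis
      unfolding e[OF BCE] e(1)[OF BCE(2,1,3)] e(2)[OF BCE(3,1,2)] zext_add[symmetric]
      using T.jacobi[OF V[OF BCE(1)] V[OF BCE(2)] V[OF BCE(3)]] by (intro zext_eqI) simp
  qed
  show "nact (nbr B C) f = nact B (nact C f) - nact C (nact B f)" if BC: "B \<in> VV" "C \<in> VV" and f: "f \<in> FF"
  proof -
    have e: "nact B (nact C f) = zext (dir B (dir C f))" "nact C (nact B f) = zext (dir C (dir B f))"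
      using zext_dir[OF V[OF BC(1)], of "dir C f"] zext_dir[OF V[OF BC(2)], of "dir B f"]
      by (simp_all add: VV_D(2)[OF BC(1)] VV_D(2)[OF BC(2)] nact_def)
    have e': "nact (nbr B C) f = zext (dir (lie_bracket (\<T> A) B C) f)"
      unfolding nact_def nbr_def by (rule zext_eqI) (simp add: dir_def)
    show ?thesis unfolding e e' zext_diff[symmetric]
      by (rule zext_eqI) (simp add: dir_def[abs_def] lie_bracket_def FF_D[OF f])
  qed
  show "nrh B \<in> PP" if "B \<in> VV" unfolding nrh_def by (intro zext_PP rho_pi_field V that)
  show "additive_on VV nrh"
    by (auto simp: additive_on_def VV_subgroup nrh_def rho_add zext_def fun_eq_iff)
  show "ngam X \<in> VV" if "X \<in> PP" unfolding ngam_def by (intro zext_VV vlift_vector_field P that)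
  show "additive_on PP ngam"
    by (auto simp: additive_on_def PP_subgroup ngam_def simp flip: zext_add intro!: zext_eqI vlift_add pt)
  show "nrh (ngam X) = 0" if "X \<in> PP"
    unfolding nrh_def by (rule zext_ext) (simp_all add: ngam_def rho_vlift pt[OF that])
  show "\<exists>X\<in>PP. B = ngam X" if B: "B \<in> VV" "nrh B = 0"
  proof -
    have "rho A u (B u) = 0" if "u \<in> TP" for u
      using fun_cong[OF B(2), of u] that by (simp add: nrh_def)
    then obtain X where X: "X \<in> pi_fields A" "\<And>u. u \<in> TP \<Longrightarrow> B u = vlift A u (X u)"
      using vertical_field[OF V[OF B(1)]] by metis
    have "zext B = zext (vlift_f A X)" by (rule zext_eqI) (simp add: X)
    then have "B = ngam (zext X)" by (simp only: VV_D(2)[OF B(1)] zext_vlift)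
    then show ?thesis using zext_PP[OF X(1)] by blast
  qed
  show "X = 0" if X: "X \<in> PP" "ngam X = 0"
  proof -
    have "vlift A u (X u) = 0" if "u \<in> TP" for u using fun_cong[OF X(2), of u] that by (simp add: ngam_def)
    then have "X u = 0" if "u \<in> TP" for u using vlift_inj[OF that pt[OF X(1) that]] that by simp
    then have "zext X = 0" by (intro zext_ext) auto
    then show ?thesis using PP_D(2)[OF X(1)] by simp
  qed
  show "nfl X Y \<in> PP" if "X \<in> PP" "Y \<in> PP" unfolding nfl_def by (intro zext_PP flat_d_pi_field P that)
  show "additive_on PP (\<lambda>X. nfl X Y)" if "Y \<in> PP"
    using flat_d_add(1) that P by (auto simp: additive_on_def PP_subgroup nfl_def simp flip: zext_add intro!: zext_eqI)
  show "additive_on PP (nfl X)" if "X \<in> PP"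
    using flat_d_add(2) that P by (auto simp: additive_on_def PP_subgroup nfl_def simp flip: zext_add intro!: zext_eqI)
  show "nrh (nbr (ngam X) B) = nfl X (nrh B)" if X: "X \<in> PP" and B: "B \<in> VV"
  proof -
    have e: "nbr (ngam X) B = zext (lie_bracket (\<T> A) (vlift_f A X) B)"
      using zext_lie_bracket[OF vlift_vector_field[OF P[OF X]] V[OF B]]
      by (simp add: VV_D(2)[OF B] PP_D(2)[OF X] zext_vlift)
    have e': "nfl X (nrh B) = zext (flat_d X (rho_f A B))"
      using zext_flat_d[OF P[OF X], of "rho_f A B"] by (simp add: nrh_def PP_D(2)[OF X])
    show ?thesis unfolding e' e zext_rho[symmetric]
      by (rule zext_eqI, rule rho_lie_bracket_vlift[OF P[OF X]]) (simp_all add: vt[OF B])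
  qed
  show "nbr (ngam X) (ngam Y) = ngam (nfl X Y - nfl Y X)" if X: "X \<in> PP" and Y: "Y \<in> PP"
  proof -
    have "nbr (ngam X) (ngam Y) = zext (lie_bracket (\<T> A) (vlift_f A X) (vlift_f A Y))"
      using zext_lie_bracket[OF vlift_vector_field[OF P[OF X]] vlift_vector_field[OF P[OF Y]]]
      by (simp add: ngam_def)
    also have "\<dots> = zext (vlift_f A (flat_d X Y - flat_d Y X))"
      by (rule zext_eqI) (rule lie_bracket_vlift[OF P[OF X] P[OF Y]])
    finally show ?thesis by (simp only: zext_vlift zext_diff nfl_def)
  qed
  show "nfl X (nfl Y Z) - nfl Y (nfl X Z) = nfl (nfl X Y - nfl Y X) Z" if X: "X \<in> PP" and Y: "Y \<in> PP" and Z: "Z \<in> PP"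
  proof -
    have e: "nfl X (nfl Y Z) = zext (flat_d X (flat_d Y Z))" "nfl Y (nfl X Z) = zext (flat_d Y (flat_d X Z))"
      using zext_flat_d[OF P[OF X], of "flat_d Y Z"] zext_flat_d[OF P[OF Y], of "flat_d X Z"]
      by (simp_all add: PP_D(2)[OF X] PP_D(2)[OF Y] nfl_def)
    have e': "nfl (nfl X Y - nfl Y X) Z = zext (flat_d (flat_d X Y - flat_d Y X) Z)"
      using zext_flat_d[OF pi_fields_diff[OF flat_d_pi_field[OF P[OF X] P[OF Y]] flat_d_pi_field[OF P[OF Y] P[OF X]]], of Z]
      by (simp add: PP_D(2)[OF Z] zext_diff nfl_def)
    show ?thesis unfolding e e' zext_diff[symmetric]
      by (rule zext_eqI) (simp add: flat_d_flat P X Y Z)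
  qed
  show "zext eta \<in> PP" by (rule zext_PP[OF eta_pi_field])
  show "nfl X (zext eta) = X" if X: "X \<in> PP"
  proof -
    have "nfl X (zext eta) = zext (flat_d X eta)"
      using zext_flat_d[OF P[OF X], of eta] by (simp add: PP_D(2)[OF X])
    also have "\<dots> = zext X" by (rule zext_eqI) (rule flat_d_eta[OF P[OF X]])
    finally show ?thesis using PP_D(2)[OF X] by simp
  qed
  show "zext energy \<in> FF" by (rule zext_FF[OF energy_smooth])
  have "nact (ngam (zext eta)) (zext energy) = zext (dir (vlift_f A eta) energy)"
    by (simp add: zext_dir[OF vlift_vector_field[OF eta_pi_field]] zext_vlift)
  also have "\<dots> = zext (energy + energy)"
    by (rule zext_eqI) (simp add: dir_def eta_def energy_homogeneous)
  finally show "nact (ngam (zext eta)) (zext energy) = zext energy + zext energy" by (simp only: zext_add)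
  show "f = 0" if "f \<in> FF" "f + f = 0"
  proof
    fix u show "f u = 0 u" using fun_cong[OF that(2), of u] by simp
  qed
  show "X = 0" if "X \<in> PP" "X + X = 0"
  proof (intro ext)
    fix u h show "X u h = 0 u h" using fun_cong[OF fun_cong[OF that(2), of u], of h] by simp
  qed
  show "X = 0" if X: "X \<in> PP" and z: "nact (ngam X) (nact (ngam X) (zext energy)) - nact (ngam (nfl X X)) (zext energy) = 0"
  proof -
    have "X u = 0" if u: "u \<in> TP" for u
    proof -
      have "nact (ngam X) (nact (ngam X) (zext energy)) = zext (dir (vlift_f A X) (dir (vlift_f A X) energy))"
        by (simp add: zext_dir[OF vlift_vector_field[OF P[OF X]]] zext_vlift PP_D(2)[OF X])
      moreover have "nact (ngam (nfl X X)) (zext energy) = zext (dir (vlift_f A (flat_d X X)) energy)"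
        by (simp add: zext_dir[OF vlift_vector_field[OF flat_d_pi_field[OF P[OF X] P[OF X]]]] zext_vlift nfl_def)
      ultimately have "metric_f L X X u = 0"
        using fun_cong[OF z, of u] u by (simp add: metric_eq[OF P[OF X] P[OF X] u] dir_def[abs_def])
      then show ?thesis
        using finsler u pt[OF X u] unfolding finsler_manifold_def metric_f_def by force
    qed
    then have "zext X = 0" by (intro zext_ext) auto
    then show ?thesis using PP_D(2)[OF X] by simp
  qed
qed

lemma zext_metric: "X \<in> pi_fields A \<Longrightarrow> Z \<in> pi_fields A \<Longrightarrow> zext (metric_f L X Z) = calc.g (zext X) (zext Z)"
proof -
  assume X: "X \<in> pi_fields A" and Z: "Z \<in> pi_fields A"
  have e: "calc.g (zext X) (zext Z) = zext (dir (vlift_f A X) (dir (vlift_f A Z) energy)) - zext (dir (vlift_f A (flat_d X Z)) energy)"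
    by (simp add: calc.g_def zext_dir vlift_vector_field flat_d_pi_field X Z zext_vlift zext_flat_d)
  show ?thesis unfolding e zext_diff[symmetric]
    by (rule zext_eqI) (simp add: metric_eq X Z dir_def[abs_def])
qed

end

subsection \<open>Connections\<close>

text \<open>The vertical properties shared by both connections; the smoothness of horizontal lifts
  is derived from them.\<close>

locale finsler_conn = finsler_space M A L
  for M :: "'m topology" and A :: "('m, 'e::euclidean_space) chart set" and L :: "'m tb \<Rightarrow> real" +
  fixes D :: "'m connection"
  assumes regular: "regular_connection A D"
    and metric_vertical: "X \<in> pi_fields A \<Longrightarrow> Y \<in> pi_fields A \<Longrightarrow> Z \<in> pi_fields A \<Longrightarrow> u \<in> points (\<T> A) \<Longrightarrow>
        cov_s2 D (vlift_f A X) (metric_f L) Y Z u = 0"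
    and T_symmetric: "T_symmetric A L D"
begin

lemma linear: "linear_connection A D"
  using regular by (simp add: regular_connection_def)

lemma D_closed: "B \<in> vector_fields (\<T> A) \<Longrightarrow> Y \<in> pi_fields A \<Longrightarrow> cov D B Y \<in> pi_fields A"
  using linear by (simp add: linear_connection_def)

context
  fixes u
  assumes u: "u \<in> TP"
begin

lemma D_add_left: "Y \<in> pi_fields A \<Longrightarrow> a \<in> tangent_space (\<T> A) u \<Longrightarrow> b \<in> tangent_space (\<T> A) u \<Longrightarrow>
    D u (a + b) Y = D u a Y + D u b Y"
  and D_scale_left: "Y \<in> pi_fields A \<Longrightarrow> a \<in> tangent_space (\<T> A) u \<Longrightarrow> D u (k *\<^sub>t a) Y = k *\<^sub>t D u a Y"
  and D_add_right: "Y \<in> pi_fields A \<Longrightarrow> Z \<in> pi_fields A \<Longrightarrow> a \<in> tangent_space (\<T> A) u \<Longrightarrow>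
    D u a (Y + Z) = D u a Y + D u a Z"
  and D_leibniz: "Y \<in> pi_fields A \<Longrightarrow> a \<in> tangent_space (\<T> A) u \<Longrightarrow> f \<in> smooth_functions (\<T> A) \<Longrightarrow>
    D u a (\<lambda>w. f w *\<^sub>t Y w) = a f *\<^sub>t Y u + f u *\<^sub>t D u a Y"
  using linear u unfolding linear_connection_def by blast+

text \<open>The indicator of the complement of the slit bundle is smooth, being zero near each point
  of the bundle, and multiplying \<open>Y - Z\<close> by it changes nothing. The Leibniz rule then
  gives zero.\<close>

lemma D_cong:
  assumes Y: "Y \<in> pi_fields A" and Z: "Z \<in> pi_fields A" and eq: "\<And>w. w \<in> TP \<Longrightarrow> Y w = Z w"
    and a: "a \<in> tangent_space (\<T> A) u"
  shows "D u a Y = D u a Z"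
proof -
  let ?f = "\<lambda>w. if w \<in> TP then 0 else 1 :: real"
  have YZ: "Y - Z \<in> pi_fields A" by (rule pi_fields_diff[OF Y Z])
  have "smooth_at (\<T> A) ?f w" if "w \<in> TP" for w
    by (rule T.smooth_at_cong[OF T.smooth_at_const[OF that, of 0]])
      (rule eventually_mono[OF T.nearby_points[OF that]], simp)
  then have "?f \<in> smooth_functions (\<T> A)" by (simp add: smooth_functions_def)
  from D_leibniz[OF YZ a this] have "D u a (\<lambda>w. ?f w *\<^sub>t (Y - Z) w) = 0"
    using u eq by (simp add: scale_def fun_eq_iff)
  moreover have "(\<lambda>w. ?f w *\<^sub>t (Y - Z) w) = Y - Z" using eq by (auto simp: scale_def fun_eq_iff)
  ultimately have "D u a (Y - Z) = 0" by simp
  moreover have "D u a Y = D u a (Y - Z) + D u a Z" using D_add_right[OF YZ Z a] by simp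
  ultimately show ?thesis by simp
qed

lemma D_zero_right: "a \<in> tangent_space (\<T> A) u \<Longrightarrow> D u a 0 = 0"
  using D_add_right[OF pi_fields_zero pi_fields_zero, of a] by simp

lemma D_diff_left: "Y \<in> pi_fields A \<Longrightarrow> a \<in> tangent_space (\<T> A) u \<Longrightarrow> b \<in> tangent_space (\<T> A) u \<Longrightarrow>
    D u (a - b) Y = D u a Y - D u b Y"
  using D_add_left[of Y "a - b" b] T.tangent_space_diff[of a u b] by (simp add: algebra_simps)

lemma D_sum_left: "Y \<in> pi_fields A \<Longrightarrow> (\<And>i. i \<in> I \<Longrightarrow> a i \<in> tangent_space (\<T> A) u) \<Longrightarrow>
    D u (\<Sum>i\<in>I. a i) Y = (\<Sum>i\<in>I. D u (a i) Y)"
proof (induction I rule: infinite_finite_induct)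
  case (insert i I)
  have "D u (a i + (\<Sum>i\<in>I. a i)) Y = D u (a i) Y + D u (\<Sum>i\<in>I. a i) Y"
    using insert.prems by (intro D_add_left T.tangent_space_sum) auto
  moreover have "D u (\<Sum>i\<in>I. a i) Y = (\<Sum>i\<in>I. D u (a i) Y)"
    using insert.prems by (intro insert.IH) auto
  ultimately show ?case by (simp only: sum.insert[OF insert.hyps])
qed (use D_diff_left[of Y 0 0] T.tangent_space_zero in auto)

text \<open>\<open>hlift\<close> is an \<open>inv_into\<close>, meaningful only on the image of the
  horizontal space. \<open>rho\<close> is onto and kills the vertical summand of the regular
  splitting, so this image is the whole tangent space of the base.\<close>

lemma hlift_props:
  assumes v: "v \<in> tangent_space A (fst u)"
  shows "hlift A D u v \<in> tangent_space (\<T> A) u" "D u (hlift A D u v) eta = 0" "rho A u (hlift A D u v) = v"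
proof -
  obtain a where a: "a \<in> tangent_space (\<T> A) u" "rho A u a = v" using rho_surj[OF u v] .
  have "tangent_space (\<T> A) u = {a + b |a b. a \<in> vertical A u \<and> b \<in> horizontal A D u}"
    using regular u by (simp add: regular_connection_def)
  then obtain b c where bc: "a = b + c" "b \<in> vertical A u" "c \<in> horizontal A D u" using a by blast
  then have "rho A u c = v" using a by (simp add: rho_add vertical_def)
  then have im: "v \<in> rho A u ` horizontal A D u" using bc by blast
  show "hlift A D u v \<in> tangent_space (\<T> A) u" "D u (hlift A D u v) eta = 0"
    using inv_into_into[OF im] by (simp_all add: hlift_def horizontal_def conn_map_def)
  show "rho A u (hlift A D u v) = v"
    using f_inv_into_f[OF im] by (simp add: hlift_def)
qed

lemma hlift_unique:
  assumes a: "a \<in> tangent_space (\<T> A) u" "D u a eta = 0"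
  shows "hlift A D u (rho A u a) = a"
proof -
  note h = hlift_props[OF rho_tangent[OF a(1) u]]
  let ?c = "hlift A D u (rho A u a) - a"
  have c: "?c \<in> tangent_space (\<T> A) u" by (intro T.tangent_space_diff h a)
  have "rho A u ?c = 0"
    using rho_add[of u ?c a] h(3) by simp
  moreover have "D u ?c eta = 0" using D_diff_left[OF eta_pi_field h(1) a(1)] h(2) a(2) by simp
  ultimately have "?c \<in> vertical A u \<inter> horizontal A D u"
    using c by (simp add: vertical_def horizontal_def conn_map_def)
  moreover have "vertical A u \<inter> horizontal A D u = {0}" using regular u by (simp add: regular_connection_def)
  ultimately have "?c = 0" by blast
  then show ?thesis by (simp only: right_minus_eq)
qed

lemma hlift_add:
  assumes v: "v \<in> tangent_space A (fst u)" and w: "w \<in> tangent_space A (fst u)"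
  shows "hlift A D u (v + w) = hlift A D u v + hlift A D u w"
proof -
  note hv = hlift_props[OF v] and hw = hlift_props[OF w]
  show ?thesis
    using hlift_unique[OF T.tangent_space_add[OF hv(1) hw(1)]] hv hw
    by (simp add: rho_add D_add_left[OF eta_pi_field])
qed

text \<open>Only the pointwise properties of the lift are used. Its projection is \<open>Y\<close>
  again, so the derivative along \<open>vlift\<close> applies to a smooth section even while the
  lift itself may not be smooth.\<close>

lemma T_torsion_eq:
  assumes X: "X \<in> pi_fields A" and Y: "Y \<in> pi_fields A"
  shows "T_torsion A D X Y u = D u (vlift A u (X u)) Y - flat_d X Y u"
proof -
  note h = hlift_props[OF pi_tangent[OF Y u]] and v = vlift_tangent[OF u pi_tangent[OF X u]]
  have rh: "rho A w (hlift A D w (Y w)) = Y w" if "w \<in> TP" for w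
    using finsler_conn.hlift_props(3)[OF finsler_conn_axioms that pi_tangent[OF Y that]] .
  have "D u (vlift A u (X u)) (rho_f A (hlift_f A D Y)) = D u (vlift A u (X u)) Y"
    by (rule D_cong[OF _ Y _ v]) (use rh pi_field_cong[OF Y, of "rho_f A (hlift_f A D Y)"] in auto)
  moreover have "D u (hlift A D u (Y u)) (rho_f A (vlift_f A X)) = D u (hlift A D u (Y u)) 0"
    by (rule D_cong[OF rho_pi_field[OF vlift_vector_field[OF X]] pi_fields_zero _ h(1)])
      (simp add: rho_vlift pi_tangent[OF X])
  moreover have "rho A u (lie_bracket (\<T> A) (vlift_f A X) (hlift_f A D Y) u) = flat_d X Y u"
    by (rule rho_lie_bracket_vlift[OF X u, of "hlift_f A D Y" Y]) (use h rh in auto)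
  ultimately show ?thesis
    by (simp add: T_torsion_def torsion_def cov_def D_zero_right[OF h(1)])
qed

end

lemma ncov_closed: "B \<in> VV \<Longrightarrow> Y \<in> PP \<Longrightarrow> ncov D B Y \<in> PP"
  unfolding ncov_def by (intro zext_PP D_closed VV_D PP_D)

sublocale lin: linear_conn VV PP FF nact nbr nrh ngam nfl "zext eta" "zext energy" "ncov D"
proof
  show "additive_on VV (\<lambda>B. ncov D B Y)" if "Y \<in> PP" for Y
    unfolding additive_on_def ncov_def zext_add[symmetric]
    using VV_subgroup by (auto intro!: zext_eqI simp: cov_def D_add_left PP_D[OF that] T.vector_field_tangent VV_D)
  show "additive_on PP (ncov D B)" if "B \<in> VV" for B
    unfolding additive_on_def ncov_def zext_add[symmetric]
    using PP_subgroup by (auto intro!: zext_eqI simp: cov_def D_add_right PP_D T.vector_field_tangent VV_D[OF that])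
qed (rule ncov_closed)

lemma zext_cov: "B \<in> vector_fields (\<T> A) \<Longrightarrow> Y \<in> pi_fields A \<Longrightarrow> zext (cov D B Y) = ncov D (zext B) (zext Y)"
  unfolding ncov_def cov_def
  by (rule zext_eqI) (auto intro!: D_cong T.vector_field_tangent PP_D zext_PP)

lemma zext_T_torsion: "X \<in> pi_fields A \<Longrightarrow> Y \<in> pi_fields A \<Longrightarrow> zext (T_torsion A D X Y) = lin.T (zext X) (zext Y)"
proof -
  assume X: "X \<in> pi_fields A" and Y: "Y \<in> pi_fields A"
  have e: "lin.T (zext X) (zext Y) = zext (cov D (vlift_f A X) Y - flat_d X Y)"
    by (simp only: lin.T_def zext_diff zext_cov vlift_vector_field X Y zext_flat_d zext_vlift)
  show ?thesis unfolding e by (rule zext_eqI) (simp add: T_torsion_eq X Y cov_def)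
qed

lemma T_torsion_pi_field: "X \<in> pi_fields A \<Longrightarrow> Y \<in> pi_fields A \<Longrightarrow> T_torsion A D X Y \<in> pi_fields A"
  by (rule pi_field_cong[of "cov D (vlift_f A X) Y - flat_d X Y"])
    (simp_all add: T_torsion_eq cov_def pi_fields_diff flat_d_pi_field D_closed[unfolded cov_def] vlift_vector_field)

sublocale vert: vertical_conn VV PP FF nact nbr nrh ngam nfl "zext eta" "zext energy" "ncov D"
proof
  fix X Y Z assume "X \<in> PP" "Y \<in> PP" "Z \<in> PP"
  note XYZ = PP_D(1)[OF \<open>X \<in> PP\<close>] PP_D(1)[OF \<open>Y \<in> PP\<close>] PP_D(1)[OF \<open>Z \<in> PP\<close>]
  note z = PP_D(2)[OF \<open>X \<in> PP\<close>] PP_D(2)[OF \<open>Y \<in> PP\<close>] PP_D(2)[OF \<open>Z \<in> PP\<close>]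
  note V = vlift_vector_field[OF XYZ(1)]
  have "zext (cov_s2 D (vlift_f A X) (metric_f L) Y Z) = 0"
    by (rule zext_ext) (simp_all add: metric_vertical XYZ)
  then show "nact (ngam X) (calc.g Y Z) - calc.g (ncov D (ngam X) Y) Z - calc.g Y (ncov D (ngam X) Z) = 0"
    by (simp only: cov_s2_def zext_diff zext_dir V zext_metric XYZ D_closed zext_cov zext_vlift z)
  have "zext (metric_f L (T_torsion A D X Y) Z) = zext (metric_f L (T_torsion A D X Z) Y)"
    by (rule zext_eqI) (use T_symmetric XYZ in \<open>simp add: T_symmetric_def\<close>)
  then show "calc.g (lin.T X Y) Z = calc.g (lin.T X Z) Y"
    by (simp only: zext_metric XYZ T_torsion_pi_field zext_T_torsion z)
qed

lemma D_vlift_eta: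
  assumes X: "X \<in> pi_fields A" and u: "u \<in> TP"
  shows "D u (vlift A u (X u)) eta = X u"
proof -
  have "zext (cov D (vlift_f A X) eta) = zext X"
    by (simp only: zext_cov vlift_vector_field X eta_pi_field zext_vlift vert.D_gam_et[OF zext_PP[OF X]])
  from fun_cong[OF this, of u] show ?thesis using u by (simp add: cov_def)
qed

text \<open>Global vector fields that restrict to the coordinate frame near a given point become
  horizontal after subtracting the vertical lift of their image under the connection map.\<close>

lemma horizontal_frame:
  assumes c: "(U, \<phi>) \<in> A" "fst u \<in> U"
  obtains C where "\<And>b. C b \<in> vector_fields (\<T> A)" "\<And>b w. w \<in> TP \<Longrightarrow> D w (C b w) eta = 0"
    "\<forall>\<^sub>F q in nearby (fst u). \<forall>w\<in>TP. fst w = q \<longrightarrow> (\<forall>b. rho A w (C b w) = cvec U \<phi> q b)"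
proof -
  obtain bmp :: "'m \<Rightarrow> real" where bmp: "\<And>q. q \<in> points A \<Longrightarrow> smooth_at A bmp q"
    "\<forall>\<^sub>F q in nearby (fst u). bmp q = 1" "\<And>q. q \<in> points A \<Longrightarrow> q \<notin> U \<Longrightarrow> \<forall>\<^sub>F r in nearby q. bmp r = 0"
    using bump_on_manifold[OF c] by blast
  let ?t = "\<lambda>w b. T.cvec (tdom A U) (tchart \<phi>) w (b, 0)"
  define B where "B b w = (if w \<in> tdom A U then bmp (fst w) *\<^sub>t ?t w b else 0)" for b w
  note t = tcharts[OF c(1)]
  have B: "B b \<in> vector_fields (\<T> A)" for b
  proof (rule T.vector_fieldI)
    show "B b w \<in> tangent_space (\<T> A) w" for w
      by (auto simp: B_def intro: T.tangent_space_scale T.cvec_tangent[OF t] T.tangent_space_zero)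
  next
    fix w f assume f: "smooth_at (\<T> A) f w"
    then have w: "w \<in> TP" by (rule T.smooth_at_points)
    then have w': "fst w \<in> points A" by (simp add: tpoints)
    show "smooth_at (\<T> A) (\<lambda>w. B b w f) w"
    proof (cases "w \<in> tdom A U")
      case True
      have "smooth_at (\<T> A) (\<lambda>w. bmp (fst w) * ?t w b f) w"
        by (intro T.smooth_at_mult smooth_at_fst w bmp w' T.smooth_at_cvec[OF t True f])
      then show ?thesis
        by (rule T.smooth_at_cong)
          (rule eventually_mono[OF T.nearby_chart[OF t True]], simp add: B_def scale_def)
    next
      case False
      then have "fst w \<notin> U" using w by (simp add: tpoints tdom_iff)
      then have "\<forall>\<^sub>F r in T.nearby w. bmp (fst r) = 0" by (rule tnearby_fst[OF w bmp(3)[OF w']])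
      then show ?thesis
        by (intro T.smooth_at_cong[OF T.smooth_at_const[OF w, of 0]]) (auto simp: B_def scale_def elim!: eventually_mono)
    qed
  qed
  define K where "K b = cov D (B b) eta" for b
  have K: "K b \<in> pi_fields A" for b unfolding K_def by (rule D_closed[OF B eta_pi_field])
  note VK = vlift_vector_field[OF K]
  define C where "C b = B b - vlift_f A (K b)" for b
  have C: "C b \<in> vector_fields (\<T> A)" for b unfolding C_def by (intro T.vector_fields_diff B VK)
  have hor: "D w (C b w) eta = 0" if w: "w \<in> TP" for b w
    using D_diff_left[OF w eta_pi_field T.vector_field_tangent[OF B w] vlift_tangent[OF w pi_tangent[OF K w]]]
      D_vlift_eta[OF K w] by (simp add: C_def) (simp add: K_def cov_def)
  have "\<forall>\<^sub>F q in nearby (fst u). \<forall>w\<in>TP. fst w = q \<longrightarrow> (\<forall>b. rho A w (C b w) = cvec U \<phi> q b)"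
    using bmp(2) nearby_chart[OF c]
  proof eventually_elim
    case (elim q)
    show ?case
    proof (intro ballI impI allI)
      fix w b assume w: "w \<in> TP" and q: "fst w = q"
      have wU: "w \<in> tdom A U" "fst w \<in> U" using w elim q by (auto simp: tdom_iff tpoints)
      have "rho A w (C b w + vlift A w (K b w)) = rho A w (?t w b)"
        using wU q elim by (simp add: C_def B_def scale_def)
      then show "rho A w (C b w) = cvec U \<phi> q b"
        using rho_tcvec[OF c(1) wU(2) t wU(1), of "(b, 0)"] q
        by (simp add: rho_add rho_vlift[OF w pi_tangent[OF K w]])
    qed
  qed
  then show ?thesis using that C hor by blast
qed

text \<open>Near \<open>u\<close> the lift is the combination of the smooth horizontal frame
  \<open>C\<close> with the coordinates of \<open>X\<close> as coefficients: both are horizontal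
  with the same projection, and \<open>hlift_unique\<close> leaves one such vector.\<close>

lemma hlift_vector_field:
  assumes X: "X \<in> pi_fields A"
  shows "hlift_f A D X \<in> vector_fields (\<T> A)"
proof (rule T.vector_fieldI)
  fix u assume u: "u \<in> TP"
  show "hlift A D u (X u) \<in> tangent_space (\<T> A) u" by (rule hlift_props(1)[OF u pi_tangent[OF X u]])
next
  fix u f assume f: "smooth_at (\<T> A) f u"
  then have u: "u \<in> TP" by (rule T.smooth_at_points)
  obtain U \<phi> where c: "(U, \<phi>) \<in> A" "fst u \<in> U" "(tdom A U, tchart \<phi>) \<in> \<T> A" "u \<in> tdom A U"
    using tpoint_chart[OF u] .
  obtain C where C: "\<And>b. C b \<in> vector_fields (\<T> A)" "\<And>b w. w \<in> TP \<Longrightarrow> D w (C b w) eta = 0"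
    "\<forall>\<^sub>F q in nearby (fst u). \<forall>w\<in>TP. fst w = q \<longrightarrow> (\<forall>b. rho A w (C b w) = cvec U \<phi> q b)"
    using horizontal_frame[OF c(1,2)] by blast
  let ?x = "\<lambda>w b. X w (\<lambda>q. \<phi> q \<bullet> b)"
  have "smooth_at (\<T> A) (\<lambda>w. \<Sum>b\<in>Basis. ?x w b * C b w f) u"
    by (intro T.smooth_at_sum u T.smooth_at_mult pi_smooth[OF X u] smooth_at_coordinate[OF c(1,2)]
        T.vector_field_smooth[OF C(1) f])
  then show "smooth_at (\<T> A) (\<lambda>w. hlift A D w (X w) f) u"
  proof (rule T.smooth_at_cong)
    show "\<forall>\<^sub>F w in T.nearby u. (\<Sum>b\<in>Basis. ?x w b * C b w f) = hlift A D w (X w) f"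
      using T.nearby_chart[OF c(3,4)] tnearby_fst[OF u C(3)]
    proof eventually_elim
      case (elim w)
      then have w: "w \<in> TP" "fst w \<in> U" using T.chart_points[OF c(3)] by (auto simp: tdom_iff)
      let ?a = "\<Sum>b\<in>Basis. ?x w b *\<^sub>t C b w"
      have t: "?x w b *\<^sub>t C b w \<in> tangent_space (\<T> A) w" for b
        by (intro T.tangent_space_scale T.vector_field_tangent[OF C(1) w(1)])
      have a: "?a \<in> tangent_space (\<T> A) w" by (intro T.tangent_space_sum t)
      have "D w ?a eta = 0"
        by (simp add: D_sum_left[OF w(1) eta_pi_field t] D_scale_left[OF w(1) eta_pi_field T.vector_field_tangent[OF C(1) w(1)]] C(2)[OF w(1)])
          (simp add: scale_def fun_eq_iff)
      note h = hlift_unique[OF w(1) a this]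
      have rs: "rho A w (\<Sum>i\<in>I. a i) = (\<Sum>i\<in>I. rho A w (a i))" for I and a :: "'e \<Rightarrow> _"
        by (induction I rule: infinite_finite_induct) (simp_all only: sum.infinite sum.empty sum.insert rho_add rho_zero not_False_eq_True)
      have "rho A w ?a = (\<Sum>b\<in>Basis. ?x w b *\<^sub>t cvec U \<phi> (fst w) b)"
        using elim(2) w(1) by (simp add: rs rho_scale)
      also have "\<dots> = X w"
      proof (rule tangent_eqI)
        show "(\<Sum>b\<in>Basis. ?x w b *\<^sub>t cvec U \<phi> (fst w) b) \<in> tangent_space A (fst w)"
          by (intro tangent_space_sum tangent_space_scale cvec_tangent[OF c(1) w(2)])
        show "X w \<in> tangent_space A (fst w)" by (rule pi_tangent[OF X w(1)])
        show "(\<Sum>b\<in>Basis. ?x w b *\<^sub>t cvec U \<phi> (fst w) b) h = X w h" if "smooth_at A h (fst w)" for h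
        proof -
          have ap: "(\<Sum>b\<in>I. a b) h = (\<Sum>b\<in>I. a b h)" for I and a :: "'e \<Rightarrow> 'm tvec"
            by (induction I rule: infinite_finite_induct) simp_all
          show ?thesis
            using tangent_expand[OF c(1) w(2) pi_tangent[OF X w(1)] that] by (simp add: ap scale_def)
        qed
      qed
      finally have e: "hlift A D w (X w) = ?a" using h by simp
      have ap: "(\<Sum>b\<in>I. a b) f = (\<Sum>b\<in>I. a b f)" for I and a :: "'e \<Rightarrow> 'm tb tvec"
        by (induction I rule: infinite_finite_induct) simp_all
      show ?case unfolding e by (simp add: ap scale_def)
    qed
  qed
qed

lemma curvature_pi_field: "B \<in> vector_fields (\<T> A) \<Longrightarrow> C \<in> vector_fields (\<T> A) \<Longrightarrow> Z \<in> pi_fields A \<Longrightarrow>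
    curvature A D B C Z \<in> pi_fields A"
  unfolding curvature_def
  by (intro pi_fields_add pi_fields_minus D_closed T.lie_bracket_vector_fields)

lemma zext_curvature: "B \<in> vector_fields (\<T> A) \<Longrightarrow> C \<in> vector_fields (\<T> A) \<Longrightarrow> Z \<in> pi_fields A \<Longrightarrow>
    zext (curvature A D B C Z) = lin.R (zext B) (zext C) (zext Z)"
  by (simp only: curvature_def lin.R_def zext_add zext_minus zext_cov D_closed T.lie_bracket_vector_fields zext_lie_bracket)

lemma P_curvature_pi_field: "X \<in> pi_fields A \<Longrightarrow> Y \<in> pi_fields A \<Longrightarrow> Z \<in> pi_fields A \<Longrightarrow> P_curvature A D X Y Z \<in> pi_fields A"
  unfolding P_curvature_def by (intro curvature_pi_field hlift_vector_field vlift_vector_field)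

lemma zext_P_curvature: "X \<in> pi_fields A \<Longrightarrow> Y \<in> pi_fields A \<Longrightarrow> Z \<in> pi_fields A \<Longrightarrow>
    zext (P_curvature A D X Y Z) = lin.R (nbet D (zext X)) (ngam (zext Y)) (zext Z)"
  by (simp only: P_curvature_def zext_curvature hlift_vector_field vlift_vector_field zext_hlift zext_vlift)

end

section \<open>Connections without (h)h-torsion and the transfer of their horizontal
  structure\<close>

locale finsler_hconn = finsler_conn M A L D
  for M :: "'m topology" and A :: "('m, 'e::euclidean_space) chart set" and L :: "'m tb \<Rightarrow> real" and D +
  assumes Q_torsion_zero: "X \<in> pi_fields A \<Longrightarrow> Y \<in> pi_fields A \<Longrightarrow> u \<in> points (\<T> A) \<Longrightarrow> Q_torsion A D X Y u = 0"
begin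

sublocale hor: horizontal_conn VV PP FF nact nbr nrh ngam nfl "zext eta" "zext energy" "ncov D" "nbet D"
proof
  fix X Y assume X: "X \<in> PP"
  note X' = PP_D(1)[OF X] and hX = hlift_vector_field[OF PP_D(1)[OF X]]
  have b: "nbet D Z = zext (hlift_f A D Z)" for Z by (simp add: nbet_def)
  show "nbet D X \<in> VV" unfolding b by (rule zext_VV[OF hX])
  have "nrh (zext (hlift_f A D X)) = zext X"
    unfolding zext_rho[symmetric] by (rule zext_eqI) (rule hlift_props(3)[OF _ pi_tangent[OF X']])
  then show rh: "nrh (nbet D X) = X" by (simp only: b PP_D(2)[OF X])
  have "zext (cov D (hlift_f A D X) eta) = 0"
    by (rule zext_ext) (simp_all add: cov_def hlift_props(2) pi_tangent[OF X'])
  then show "ncov D (nbet D X) (zext eta) = 0" by (simp only: b zext_cov hX eta_pi_field)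
  assume Y: "Y \<in> PP"
  note Y' = PP_D(1)[OF Y] and hY = hlift_vector_field[OF PP_D(1)[OF Y]]
  have "zext (Q_torsion A D X Y) = 0" by (rule zext_ext) (simp_all add: Q_torsion_zero X' Y')
  then have "ncov D (nbet D X) (nrh (nbet D Y)) - ncov D (nbet D Y) (nrh (nbet D X)) - nrh (nbr (nbet D X) (nbet D Y)) = 0"
    by (simp only: Q_torsion_def torsion_def zext_diff zext_cov hX hY rho_pi_field zext_rho zext_lie_bracket b)
  moreover have "nrh (nbet D Y) = Y"
  proof -
    have "nrh (zext (hlift_f A D Y)) = zext Y"
      unfolding zext_rho[symmetric] by (rule zext_eqI) (rule hlift_props(3)[OF _ pi_tangent[OF Y']])
    then show ?thesis by (simp only: b PP_D(2)[OF Y])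
  qed
  ultimately show "ncov D (nbet D X) Y - ncov D (nbet D Y) X - nrh (nbr (nbet D X) (nbet D Y)) = 0"
    by (simp only: rh)
next
  show "additive_on PP (nbet D)"
    unfolding additive_on_def nbet_def zext_add[symmetric]
  proof (intro conjI ballI PP_subgroup zext_eqI)
    fix X Y u assume "X \<in> PP" "Y \<in> PP" and u: "u \<in> TP"
    then show "hlift A D u ((X + Y) u) = (hlift_f A D X + hlift_f A D Y) u"
      using hlift_add[OF u pi_tangent[OF PP_D(1) u] pi_tangent[OF PP_D(1) u]] by simp
  qed
qed

lemma P_hat_pi_field: "X \<in> pi_fields A \<Longrightarrow> Y \<in> pi_fields A \<Longrightarrow> P_hat A D X Y \<in> pi_fields A"
  unfolding P_hat_def by (intro P_curvature_pi_field eta_pi_field)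

lemma zext_P_hat: "X \<in> pi_fields A \<Longrightarrow> Y \<in> pi_fields A \<Longrightarrow> zext (P_hat A D X Y) = hor.Ph (zext X) (zext Y)"
  by (simp only: P_hat_def zext_P_curvature eta_pi_field hor.Ph_def)

end

theorem theorem6p6:
  fixes M :: "'m topology"
    and \<A> :: "('m, 'e::euclidean_space) chart set"
    and L :: "'m tb \<Rightarrow> real"
    and D Ds :: "'m connection"
    and X Y Z W :: "'m tb \<Rightarrow> 'm tvec"
    and u :: "'m tb"
  assumes "finsler_manifold M \<A> L"
    and "cartan_connection \<A> L D"
    and "hashiguchi_connection \<A> L Ds"
    and "X \<in> pi_fields \<A>" "Y \<in> pi_fields \<A>" "Z \<in> pi_fields \<A>" "W \<in> pi_fields \<A>"
    and "u \<in> points (\<T> \<A>)"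
  defines "T \<equiv> T_torsion \<A> D"
    and "Ph \<equiv> (\<lambda>X Y Z. metric_f L (P_hat \<A> D X Y) Z)"
    and "Ps \<equiv> P_curvature \<A> Ds"
  shows
    "metric_f L (Ps X Y Z) W u + metric_f L (Ps X Y W) Z u
       = 2 * cov_s3 Ds (vlift_f \<A> Y) Ph X Z W u + 2 * Ph (T X Y) Z W u
     \<and> P_hat \<A> Ds X Y u = 0
     \<and> Ps X Y Z u - Ps Z Y X u
       = cov_v2 Ds (hlift_f \<A> D Z) T Y X u - cov_v2 Ds (hlift_f \<A> D X) T Y Z u
     \<and> Ps X Y Z u = Ps X Z Y u
     \<and> Ps eta X Y u = - cov_v2 Ds (hlift_f \<A> D eta) T X Y u
     \<and> Ps X eta Y u = 0
     \<and> cov_v3 Ds (vlift_f \<A> eta) Ps X Y Z u = - Ps X Y Z u"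
proof -
  note cartan = assms(2)[unfolded cartan_connection_def] and hashiguchi = assms(3)[unfolded hashiguchi_connection_def]
  interpret S: finsler_space M \<A> L by unfold_locales (rule assms(1))
  interpret C: finsler_hconn M \<A> L D
    by unfold_locales (use cartan S.vlift_vector_field in blast)+
  interpret H: finsler_hconn M \<A> L Ds
    by unfold_locales (use hashiguchi in blast)+
  have conservative: "\<forall>A\<in>vector_fields (\<T> \<A>). \<forall>u\<in>points (\<T> \<A>). dir (hlift_f \<A> Ds (rho_f \<A> A)) L u = 0"
    using hashiguchi by blast
  note u = assms(8)
  interpret pair: finsler_pair S.VV S.PP S.FF S.nact S.nbr S.nrh S.ngam S.nfl "S.zext eta" "S.zext S.energy"
    "S.ncov D" "S.nbet D" "S.ncov Ds" "S.nbet Ds"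
  proof unfold_locales
    fix A Y Z assume "A \<in> S.VV" "Y \<in> S.PP" "Z \<in> S.PP"
    note AYZ = S.VV_D(1)[OF \<open>A \<in> S.VV\<close>] S.PP_D(1)[OF \<open>Y \<in> S.PP\<close>] S.PP_D(1)[OF \<open>Z \<in> S.PP\<close>]
    note z = S.VV_D(2)[OF \<open>A \<in> S.VV\<close>] S.PP_D(2)[OF \<open>Y \<in> S.PP\<close>] S.PP_D(2)[OF \<open>Z \<in> S.PP\<close>]
    have "S.zext (cov_s2 D A (metric_f L) Y Z) = 0"
      by (rule S.zext_ext) (use cartan AYZ in auto)
    then show "S.nact A (S.calc.g Y Z) - S.calc.g (S.ncov D A Y) Z - S.calc.g Y (S.ncov D A Z) = 0"
      by (simp only: cov_s2_def S.zext_diff S.zext_dir AYZ S.zext_metric C.D_closed C.zext_cov z)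
  next
    fix X Y assume "X \<in> S.PP" "Y \<in> S.PP"
    note XY = S.PP_D(1)[OF \<open>X \<in> S.PP\<close>] S.PP_D(1)[OF \<open>Y \<in> S.PP\<close>]
    note z = S.PP_D(2)[OF \<open>X \<in> S.PP\<close>] S.PP_D(2)[OF \<open>Y \<in> S.PP\<close>]
    have "S.zext (P_hat \<A> Ds X Y) = 0"
      by (rule S.zext_ext) (use hashiguchi XY in auto)
    then show "H.hor.Ph X Y = 0" by (simp only: H.zext_P_hat XY z)
  next
    fix X assume "X \<in> S.PP"
    note X = S.PP_D(1)[OF \<open>X \<in> S.PP\<close>]
    note h = H.hlift_vector_field[OF X]
    \<comment> \<open>The hypothesis concerns the horizontal part of an arbitrary field. Taking the
      lift of \<open>X\<close> as that field, with projection \<open>X\<close>, yields the claim for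
      \<open>L\<close>, and the Leibniz rule passes it on to the energy.\<close>
    have "dir (hlift_f \<A> Ds X) S.energy w = 0" if w: "w \<in> points (\<T> \<A>)" for w
    proof -
      note t = S.T.vector_field_tangent[OF h w]
      have "dir (hlift_f \<A> Ds (rho_f \<A> (hlift_f \<A> Ds X))) L w = 0"
        using conservative[rule_format, OF h w] .
      then have "hlift \<A> Ds w (X w) L = 0"
        by (simp add: dir_def H.hlift_props(3)[OF w S.pi_tangent[OF X w]])
      then show ?thesis
        using S.T.tangent_cmult[OF t S.T.smooth_at_mult[OF S.L_smooth[OF w] S.L_smooth[OF w]], of "1/2"]
          S.T.tangent_mult[OF t S.L_smooth[OF w] S.L_smooth[OF w]]
        by (simp add: dir_def S.energy_def[abs_def] power2_eq_square)
    qed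
    then have "S.zext (dir (hlift_f \<A> Ds X) S.energy) = 0" by (intro S.zext_ext) simp_all
    then show "S.nact (S.nbet Ds X) (S.zext S.energy) = 0"
      by (simp only: S.zext_dir h S.zext_hlift S.PP_D(2)[OF \<open>X \<in> S.PP\<close>])
  qed
  have pi: "X \<in> pi_fields \<A>" "Y \<in> pi_fields \<A>" "Z \<in> pi_fields \<A>" "W \<in> pi_fields \<A>" "eta \<in> pi_fields \<A>"
    using assms S.eta_pi_field by simp_all
  note zP = S.zext_PP[OF pi(1)] S.zext_PP[OF pi(2)] S.zext_PP[OF pi(3)] S.zext_PP[OF pi(4)] S.zext_PP[OF pi(5)]
  \<comment> \<open>\<open>closed\<close> discharges the side conditions of the conditional rewrite
    rules in \<open>push\<close>; together they move \<open>S.zext\<close> inwards until both sides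
    are expressions of the model.\<close>
  note closed = pi S.vlift_vector_field C.hlift_vector_field H.hlift_vector_field H.D_closed H.P_curvature_pi_field
    C.P_hat_pi_field C.T_torsion_pi_field
  note push = S.zext_diff S.zext_add S.zext_minus S.zext_dir S.zext_metric C.zext_T_torsion C.zext_P_hat H.zext_cov
    H.zext_P_curvature S.zext_hlift S.zext_vlift
  have at: "h u = k u" if "S.zext h = S.zext k" for h k :: "'m tb \<Rightarrow> 'z::ab_group_add"
    using fun_cong[OF that, of u] u by simp
  let ?S = "cov_s3 Ds (vlift_f \<A> Y) Ph X Z W"
  \<comment> \<open>Doubled terms are written as sums because the model has no multiplication by
    scalars.\<close>
  have "S.zext (metric_f L (Ps X Y Z) W + metric_f L (Ps X Y W) Z)
      = S.zext (?S + ?S + (Ph (T X Y) Z W + Ph (T X Y) Z W))"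
    unfolding Ps_def Ph_def T_def cov_s3_def
    by (simp only: push closed pair.curvature_metric[OF zP(1-4)])
  from at[OF this] have a: "metric_f L (Ps X Y Z) W u + metric_f L (Ps X Y W) Z u = 2 * ?S u + 2 * Ph (T X Y) Z W u"
    by simp
  have "S.zext (Ps X Y Z - Ps Z Y X)
      = S.zext (cov_v2 Ds (hlift_f \<A> D Z) T Y X - cov_v2 Ds (hlift_f \<A> D X) T Y Z)"
    unfolding Ps_def T_def cov_v2_def
    by (simp only: push closed pair.curvature_hv_bianchi[OF zP(1-3)])
  from at[OF this] have c: "Ps X Y Z u - Ps Z Y X u
      = cov_v2 Ds (hlift_f \<A> D Z) T Y X u - cov_v2 Ds (hlift_f \<A> D X) T Y Z u" by simp
  have "S.zext (Ps X Y Z) = S.zext (Ps X Z Y)"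
    unfolding Ps_def by (simp only: push closed pair.curvature_swap[OF zP(1-3)])
  note d = at[OF this]
  have "S.zext (Ps eta X Y) = S.zext (- cov_v2 Ds (hlift_f \<A> D eta) T X Y)"
    unfolding Ps_def T_def cov_v2_def
    by (simp only: push closed pair.curvature_et_left[OF zP(1,2)])
  from at[OF this] have e: "Ps eta X Y u = - cov_v2 Ds (hlift_f \<A> D eta) T X Y u" by simp
  have "S.zext (Ps X eta Y) = S.zext 0"
    unfolding Ps_def by (simp only: push closed pair.curvature_et_right[OF zP(1,2)]) (simp add: S.zext_def fun_eq_iff)
  from at[OF this] have e': "Ps X eta Y u = 0" by simp
  have "S.zext (cov_v3 Ds (vlift_f \<A> eta) Ps X Y Z) = S.zext (- Ps X Y Z)"
    unfolding Ps_def cov_v3_def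
    by (simp only: push closed pair.curvature_homogeneous[OF zP(1-3)])
  from at[OF this] have f: "cov_v3 Ds (vlift_f \<A> eta) Ps X Y Z u = - Ps X Y Z u" by simp
  have b: "P_hat \<A> Ds X Y u = 0" using hashiguchi pi u by blast
  show ?thesis using a b c d e e' f by blast
qed

end
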